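(* Let $n>3$, and let $x,\tilde x:M\to\mathbb{R}^n$ be two umbilical free oriented hypersurfaces with non-zero principal curvatures, with Laguerre metrics $g,\tilde g$ and Laguerre second fundamental forms $\mathbb{B},\tilde{\mathbb{B}}$. Then $x$ and $\tilde x$ are Laguerre equivalent if and only if they have the same Laguerre metric and the same Laguerre second fundamental form, i.e. $g=\tilde g$ and $\mathbb{B}=\tilde{\mathbb{B}}$ on $M$.
   Context: All maps are smooth. An oriented hypersurface $x:M\to\mathbb{R}^n$ is an immersion of an $(n-1)$-manifold $M$ with a chosen unit normal field $\xi:M\to S^{n-1}$. Its principal curvatures $k_i$ are defined by $e_i(\xi)=-k_ie_i(x)$ for principal vectors $e_i$; "umbilical free" means that at no point do all principal curvatures coincide. Let $\mathbb{R}^{n+3}_2$ be $\mathbb{R}^{n+3}$ (row vectors) with inner product $\langle X,Y\rangle=-X_1Y_1+X_2Y_2+\cdots+X_{n+2}Y_{n+2}-X_{n+3}Y_{n+3}$, let $O(n+1,2)$ be its group of linear isometries, acting by right multiplication $X\mapsto XT$, and let $\wp=(1,-1,\mathbf{0},0)$ with $\mathbf{0}\in\mathbb{R}^n$. The Laguerre group is $L\mathbb{G}=\{T\in O(n+1,2): \wp T=\wp\}$. Let $U\mathbb{R}^n=\mathbb{R}^n\times S^{n-1}$. For $(x,\xi)\in U\mathbb{R}^n$ put $\gamma_1(x,\xi)=(\tfrac12(1+|x|^2),\tfrac12(1-|x|^2),x,0)$ and $\gamma_2(x,\xi)=(x\cdot\xi,-x\cdot\xi,\xi,1)$. Each $T\in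 L\mathbb{G}$ induces a Laguerre transformation $\phi_T:U\mathbb{R}^n\to U\mathbb{R}^n$, where $\phi_T(x,\xi)=(\tilde x,\tilde\xi)$ is the unique point with $\mathrm{span}\{\gamma_1(\tilde x,\tilde\xi),\gamma_2(\tilde x,\tilde\xi)\}=\mathrm{span}\{\gamma_1(x,\xi)T,\gamma_2(x,\xi)T\}$. Two oriented hypersurfaces $x,\tilde x:M\to\mathbb{R}^n$ with non-zero principal curvatures and unit normals $\xi,\tilde\xi$ are Laguerre equivalent if there is $T\in L\mathbb{G}$ with $(\tilde x,\tilde\xi)=\phi_T\circ(x,\xi)$ on $M$. For an umbilical free oriented hypersurface with non-zero principal curvatures put $r_i=1/k_i$, $r=\frac{1}{n-1}\sum_i r_i$, $\rho=\sqrt{\sum_i(r_i-r)^2}>0$. The Laguerre position vector is $Y=\rho\,(x\cdot\xi,-x\cdot\xi,\xi,1):M\to\mathbb{R}^{n+3}_2$, and the Laguerre Gauss map is $\eta=(\tfrac12(1+|x|^2),\tfrac12(1-|x|^2),x,0)+r\,(x\cdot\xi,-x\cdot\xi,\xi,1)$. The Laguerre metric is $g=\langle dY,dY\rangle=\rho^2\,d\xi\cdot d\xi$. The Laguerre second fundamental form is the symmetric 2-tensor $\mathbb{B}=\sum_{ij}B_{ij}\,\omega_i\otimes\omega_j$, where $\{E_i\}$ is a local $g$-orthonormal frame with dual coframe $\{\omega_i\}$ and the $B_{ij}$ are determined by $E_i(\eta)=-C_iY+\sum_jB_{ij}E_j(Y)$, i.e. $B_{ij}=\langle E_i(\eta)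,E_j(Y)\rangle$.
   Formalization: M is assumed connected, and Laguerre equivalence uses only orientation-preserving T (last diagonal entry positive): reversing ξ to -ξ keeps g but turns B into -B, and on a disconnected M different transformations could act on different components. *)

theory Defs
  imports "HOL-Analysis.Analysis"
begin

section \<open>Smooth manifolds\<close>

text \<open>For an open set \<open>S\<close> of a Euclidean space, \<open>Ck_on k S f\<close> says that \<open>f\<close> is of class \<open>C\<^sup>k\<close> on
  \<open>S\<close> (iterated directional derivatives exist and are continuous).\<close>

fun Ck_on :: "nat \<Rightarrow> 'a::euclidean_space set \<Rightarrow> ('a \<Rightarrow> 'b::real_normed_vector) \<Rightarrow> bool" where
  "Ck_on 0 S f \<longleftrightarrow> continuous_on S f"
| "Ck_on (Suc k) S f \<longleftrightarrow>
     (\<forall>x\<in>S. f differentiable (at x)) \<and> (\<forall>v. Ck_on k S (\<lambda>x. frechet_derivative f (at x) v))"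

definition smooth_on :: "'a::euclidean_space set \<Rightarrow> ('a \<Rightarrow> 'b::real_normed_vector) \<Rightarrow> bool" where
  "smooth_on S f \<longleftrightarrow> (\<forall>k. Ck_on k S f)"

text \<open>A chart is a pair of its domain and its coordinate map. The manifold is the whole
  type \<open>'p\<close>; its dimension is \<open>CARD('m)\<close>.\<close>

type_synonym ('p, 'm) chart = "'p set \<times> ('p \<Rightarrow> real ^ 'm)"

definition chart_inv :: "('p, 'm) chart \<Rightarrow> real ^ 'm \<Rightarrow> 'p" where
  "chart_inv c = inv_into (fst c) (snd c)"

definition smooth_atlas ::
  "('p::{t2_space, second_countable_topology}, 'm::finite) chart set \<Rightarrow> bool" where
  "smooth_atlas A \<longleftrightarrow>
     (\<forall>c\<in>A. open (fst c) \<and> open (snd c ` fst c) \<and>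
            homeomorphism (fst c) (snd c ` fst c) (snd c) (chart_inv c)) \<and>
     (\<Union>c\<in>A. fst c) = UNIV \<and>
     (\<forall>c\<in>A. \<forall>d\<in>A. smooth_on (snd c ` (fst c \<inter> fst d)) (snd d \<circ> chart_inv c))"

definition smooth_map ::
  "('p, 'm::finite) chart set \<Rightarrow> ('p \<Rightarrow> 'b::real_normed_vector) \<Rightarrow> bool" where
  "smooth_map A f \<longleftrightarrow> (\<forall>c\<in>A. smooth_on (snd c ` fst c) (f \<circ> chart_inv c))"

text \<open>A tangent vector at a point \<open>p\<close> of the domain of the chart \<open>c\<close> is given by its components
  \<open>v :: real ^ 'm\<close> in the coordinates of \<open>c\<close>; \<open>chart_deriv c f p v\<close> is the derivative of \<open>f\<close>
  along it, i.e. \<open>v(f)\<close> or \<open>df(v)\<close>. A tensor field on the manifold is given by its values in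
  all charts.\<close>

definition chart_deriv ::
  "('p, 'm::finite) chart \<Rightarrow> ('p \<Rightarrow> 'b::real_normed_vector) \<Rightarrow> 'p \<Rightarrow> real ^ 'm \<Rightarrow> 'b" where
  "chart_deriv c f p v = frechet_derivative (f \<circ> chart_inv c) (at (snd c p)) v"


section \<open>Oriented hypersurfaces and principal curvatures\<close>

definition oriented_hypersurface ::
  "('p, 'm::finite) chart set \<Rightarrow> ('p \<Rightarrow> real ^ 'n) \<Rightarrow> ('p \<Rightarrow> real ^ 'n::finite) \<Rightarrow> bool" where
  "oriented_hypersurface A x \<xi> \<longleftrightarrow>
     CARD('n) = CARD('m) + 1 \<and> smooth_map A x \<and> smooth_map A \<xi> \<and>
     (\<forall>c\<in>A. \<forall>p\<in>fst c. inj (chart_deriv c x p)) \<and>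
     (\<forall>p. norm (\<xi> p) = 1) \<and>
     (\<forall>c\<in>A. \<forall>p\<in>fst c. \<forall>v. \<xi> p \<bullet> chart_deriv c x p v = 0)"

text \<open>The vectors \<open>e i\<close> form a basis of principal vectors at \<open>p\<close>, orthonormal for the induced
  metric, with principal curvatures \<open>k i\<close>.\<close>

definition principal_frame ::
  "('p, 'm::finite) chart \<Rightarrow> ('p \<Rightarrow> real ^ 'n) \<Rightarrow> ('p \<Rightarrow> real ^ 'n::finite) \<Rightarrow> 'p \<Rightarrow>
   ('m \<Rightarrow> real ^ 'm) \<Rightarrow> ('m \<Rightarrow> real) \<Rightarrow> bool" where
  "principal_frame c x \<xi> p e k \<longleftrightarrow>
     (\<forall>i j. chart_deriv c x p (e i) \<bullet> chart_deriv c x p (e j) = (if i = j then 1 else 0)) \<and>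
     (\<forall>i. chart_deriv c \<xi> p (e i) = - k i *\<^sub>R chart_deriv c x p (e i))"

text \<open>The principal curvatures, repeated according to multiplicity, are determined up to their
  order, which is chosen arbitrarily at each point.\<close>

definition principal_curvatures ::
  "('p, 'm::finite) chart set \<Rightarrow> ('p \<Rightarrow> real ^ 'n) \<Rightarrow> ('p \<Rightarrow> real ^ 'n::finite) \<Rightarrow> 'p \<Rightarrow> 'm \<Rightarrow> real"
  where
  "principal_curvatures A x \<xi> p =
     (SOME k. \<exists>c\<in>A. p \<in> fst c \<and> (\<exists>e. principal_frame c x \<xi> p e k))"

definition nonzero_principal_curvatures ::
  "('p, 'm::finite) chart set \<Rightarrow> ('p \<Rightarrow> real ^ 'n) \<Rightarrow> ('p \<Rightarrow> real ^ 'n::finite) \<Rightarrow> bool" where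
  "nonzero_principal_curvatures A x \<xi> \<longleftrightarrow> (\<forall>p i. principal_curvatures A x \<xi> p i \<noteq> 0)"

definition umbilical_free ::
  "('p, 'm::finite) chart set \<Rightarrow> ('p \<Rightarrow> real ^ 'n) \<Rightarrow> ('p \<Rightarrow> real ^ 'n::finite) \<Rightarrow> bool" where
  "umbilical_free A x \<xi> \<longleftrightarrow>
     (\<forall>p. \<exists>i j. principal_curvatures A x \<xi> p i \<noteq> principal_curvatures A x \<xi> p j)"


section \<open>Laguerre transformations\<close>

text \<open>The vector \<open>(X\<^sub>1, X\<^sub>2, (X\<^sub>3, \<dots>, X\<^bsub>n+2\<^esub>), X\<^bsub>n+3\<^esub>)\<close> of \<open>\<real>\<^sup>n\<^sup>+\<^sup>3\<close>. Matrices acting on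
  row vectors from the right are rendered as linear maps, \<open>X T\<close> being \<open>T X\<close>.\<close>

type_synonym 'n ambient = "real \<times> real \<times> (real ^ 'n) \<times> real"

definition lip :: "'n::finite ambient \<Rightarrow> 'n ambient \<Rightarrow> real" where
  "lip = (\<lambda>(a, b, x, t) (a', b', x', t'). - a * a' + b * b' + x \<bullet> x' - t * t')"

definition wp :: "'n::finite ambient" where
  "wp = (1, - 1, 0, 0)"

text \<open>Bijectivity of \<open>T\<close> follows from nondegeneracy of the inner product.\<close>

definition laguerre_group :: "('n::finite ambient \<Rightarrow> 'n ambient) set" where
  "laguerre_group =
     {T. linear T \<and> (\<forall>X Y. lip (T X) (T Y) = lip X Y) \<and> T wp = wp}"

definition gamma1 :: "(real ^ 'n) \<times> (real ^ 'n) \<Rightarrow> 'n::finite ambient" where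
  "gamma1 = (\<lambda>(x, \<xi>). ((1 + (norm x)\<^sup>2) / 2, (1 - (norm x)\<^sup>2) / 2, x, 0))"

definition gamma2 :: "(real ^ 'n) \<times> (real ^ 'n) \<Rightarrow> 'n::finite ambient" where
  "gamma2 = (\<lambda>(x, \<xi>). (x \<bullet> \<xi>, - (x \<bullet> \<xi>), \<xi>, 1))"

definition laguerre_transformation ::
  "('n::finite ambient \<Rightarrow> 'n ambient) \<Rightarrow> (real ^ 'n) \<times> (real ^ 'n) \<Rightarrow> (real ^ 'n) \<times> (real ^ 'n)"
  where
  "laguerre_transformation T q =
     (THE q'. norm (snd q') = 1 \<and>
        span {gamma1 q', gamma2 q'} = span {T (gamma1 q), T (gamma2 q)})"

text \<open>The last component \<open>T\<^bsub>n+3,n+3\<^esub>\<close> of \<open>T (0, 0, 0, 1)\<close> never vanishes for \<open>T\<close> in the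
  Laguerre group. If it is positive, \<open>T (gamma2 q)\<close> is a positive multiple of \<open>gamma2\<close> at the
  image of \<open>q\<close>; if it is negative, a negative one.\<close>

definition orientation_preserving :: "('n::finite ambient \<Rightarrow> 'n ambient) \<Rightarrow> bool" where
  "orientation_preserving T \<longleftrightarrow> 0 < snd (snd (snd (T (0, 0, 0, 1))))"

text \<open>Hypersurfaces are oriented, and equivalence is by transformations respecting orientation.
  This matters: the element \<open>(a, b, x, t) \<mapsto> (a, b, x, -t)\<close> of the Laguerre group induces
  \<open>(x, \<xi>) \<mapsto> (x, -\<xi>)\<close>, and replacing \<open>\<xi>\<close> by \<open>-\<xi>\<close> replaces the nonzero Laguerre second
  fundamental form by its negative, so the form is invariant only under
  orientation-preserving elements.\<close>

definition laguerre_equivalent ::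
  "('p \<Rightarrow> real ^ 'n) \<Rightarrow> ('p \<Rightarrow> real ^ 'n) \<Rightarrow> ('p \<Rightarrow> real ^ 'n) \<Rightarrow> ('p \<Rightarrow> real ^ 'n::finite) \<Rightarrow> bool" where
  "laguerre_equivalent x \<xi> x' \<xi>' \<longleftrightarrow>
     (\<exists>T\<in>laguerre_group. orientation_preserving T \<and>
        (\<forall>p. (x' p, \<xi>' p) = laguerre_transformation T (x p, \<xi> p)))"

lemma time_reversal_in_laguerre_group:
  "(\<lambda>(a, b, x, t). (a, b, x, - t)) \<in> (laguerre_group :: ('n::finite ambient \<Rightarrow> 'n ambient) set)"
proof -
  have "linear (\<lambda>(a, b, x, t). (a, b, x, - t) :: 'n ambient)"
    by (rule linearI) (auto simp: algebra_simps)
  then show ?thesis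
    by (auto simp: laguerre_group_def lip_def wp_def)
qed

lemma span_gamma_inject:
  fixes q q' :: "(real ^ 'n::finite) \<times> (real ^ 'n)"
  assumes "span {gamma1 q', gamma2 q'} = span {gamma1 q, gamma2 q}"
  shows "q' = q"
proof -
  have span2: "\<exists>a b. w = a *\<^sub>R u + b *\<^sub>R v" if w: "w \<in> span {u, v}" for u v w :: "'n ambient"
  proof -
    obtain a where "w - a *\<^sub>R u \<in> span {v}"
      using w unfolding span_insert[of u] by auto
    then obtain b where "w - a *\<^sub>R u = b *\<^sub>R v"
      unfolding span_singleton by auto
    then have "w = a *\<^sub>R u + b *\<^sub>R v"
      by (simp add: diff_eq_eq add.commute)
    then show ?thesis by blast
  qed
  have "gamma1 q' \<in> span {gamma1 q, gamma2 q}" "gamma2 q' \<in> span {gamma1 q, gamma2 q}"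
    unfolding assms[symmetric] by (auto intro: span_base)
  then obtain a b a' b' where
    1: "gamma1 q' = a *\<^sub>R gamma1 q + b *\<^sub>R gamma2 q" and
    2: "gamma2 q' = a' *\<^sub>R gamma1 q + b' *\<^sub>R gamma2 q"
    using span2 by meson
  obtain x y x' y' where q: "q = (x, y)" "q' = (x', y')"
    by (cases q, cases q')
  have b: "b = 0" "b' = 1"
    using 1 2 by (simp_all add: q gamma1_def gamma2_def)
  define s :: "'n ambient \<Rightarrow> real" where "s X = fst X + fst (snd X)" for X
  have s: "s (gamma1 z) = 1" "s (gamma2 z) = 0" for z :: "(real ^ 'n) \<times> (real ^ 'n)"
    by (simp_all add: s_def gamma1_def gamma2_def split_beta field_simps)
  have s_comb: "s (c *\<^sub>R u + d *\<^sub>R v) = c * s u + d * s v" for c d u v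
    by (simp add: s_def algebra_simps)
  have a: "a = 1" using arg_cong[OF 1, of s] by (simp add: s_comb s)
  have a': "a' = 0" using arg_cong[OF 2, of s] by (simp add: s_comb s)
  show ?thesis
    using 1 2 b a a' by (simp add: q gamma1_def gamma2_def)
qed

lemma laguerre_transformation_time_reversal:
  fixes x \<xi> :: "real ^ 'n::finite"
  assumes "norm \<xi> = 1"
  shows "laguerre_transformation (\<lambda>(a, b, x, t). (a, b, x, - t)) (x, \<xi>) = (x, - \<xi>)"
proof -
  have *: "span {u, - v} = span {u, v}" for u v :: "'n ambient"
  proof (rule antisym; rule span_minimal)
    show "{u, - v} \<subseteq> span {u, v}"
      by (auto intro: span_base span_neg)
    have "- (- v) \<in> span {u, - v}"
      by (rule span_neg) (auto intro: span_base)
    then show "{u, v} \<subseteq> span {u, - v}"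
      by (auto intro: span_base)
  qed auto
  have "gamma1 (x, \<xi>) = gamma1 (x, - \<xi>)"
       "(\<lambda>(a, b, x, t). (a, b, x, - t)) (gamma1 (x, \<xi>)) = gamma1 (x, - \<xi>)"
       "(\<lambda>(a, b, x, t). (a, b, x, - t)) (gamma2 (x, \<xi>)) = - gamma2 (x, - \<xi>)"
    by (simp_all add: gamma1_def gamma2_def)
  then show ?thesis
    unfolding laguerre_transformation_def using assms
    by (intro the_equality span_gamma_inject) (simp_all add: *)
qed


section \<open>Laguerre invariants\<close>

definition curvature_radius ::
  "('p, 'm::finite) chart set \<Rightarrow> ('p \<Rightarrow> real ^ 'n) \<Rightarrow> ('p \<Rightarrow> real ^ 'n::finite) \<Rightarrow> 'p \<Rightarrow> 'm \<Rightarrow> real"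
  where
  "curvature_radius A x \<xi> p i = 1 / principal_curvatures A x \<xi> p i"

definition mean_radius ::
  "('p, 'm::finite) chart set \<Rightarrow> ('p \<Rightarrow> real ^ 'n) \<Rightarrow> ('p \<Rightarrow> real ^ 'n::finite) \<Rightarrow> 'p \<Rightarrow> real" where
  "mean_radius A x \<xi> p = (\<Sum>i\<in>UNIV. curvature_radius A x \<xi> p i) / (real CARD('n) - 1)"

definition laguerre_rho ::
  "('p, 'm::finite) chart set \<Rightarrow> ('p \<Rightarrow> real ^ 'n) \<Rightarrow> ('p \<Rightarrow> real ^ 'n::finite) \<Rightarrow> 'p \<Rightarrow> real" where
  "laguerre_rho A x \<xi> p =
     sqrt (\<Sum>i\<in>UNIV. (curvature_radius A x \<xi> p i - mean_radius A x \<xi> p)\<^sup>2)"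

definition laguerre_position ::
  "('p, 'm::finite) chart set \<Rightarrow> ('p \<Rightarrow> real ^ 'n) \<Rightarrow> ('p \<Rightarrow> real ^ 'n::finite) \<Rightarrow> 'p \<Rightarrow> 'n ambient"
  where
  "laguerre_position A x \<xi> p = laguerre_rho A x \<xi> p *\<^sub>R gamma2 (x p, \<xi> p)"

definition laguerre_gauss_map ::
  "('p, 'm::finite) chart set \<Rightarrow> ('p \<Rightarrow> real ^ 'n) \<Rightarrow> ('p \<Rightarrow> real ^ 'n::finite) \<Rightarrow> 'p \<Rightarrow> 'n ambient"
  where
  "laguerre_gauss_map A x \<xi> p =
     gamma1 (x p, \<xi> p) + mean_radius A x \<xi> p *\<^sub>R gamma2 (x p, \<xi> p)"

definition laguerre_metric ::
  "('p, 'm::finite) chart set \<Rightarrow> ('p \<Rightarrow> real ^ 'n) \<Rightarrow> ('p \<Rightarrow> real ^ 'n::finite) \<Rightarrow>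
   ('p, 'm) chart \<Rightarrow> 'p \<Rightarrow> real ^ 'm \<Rightarrow> real ^ 'm \<Rightarrow> real" where
  "laguerre_metric A x \<xi> c p v w =
     lip (chart_deriv c (laguerre_position A x \<xi>) p v) (chart_deriv c (laguerre_position A x \<xi>) p w)"

definition laguerre_orthonormal ::
  "('p, 'm::finite) chart set \<Rightarrow> ('p \<Rightarrow> real ^ 'n) \<Rightarrow> ('p \<Rightarrow> real ^ 'n::finite) \<Rightarrow>
   ('p, 'm) chart \<Rightarrow> 'p \<Rightarrow> ('m \<Rightarrow> real ^ 'm) \<Rightarrow> bool" where
  "laguerre_orthonormal A x \<xi> c p E \<longleftrightarrow>
     (\<forall>i j. laguerre_metric A x \<xi> c p (E i) (E j) = (if i = j then 1 else 0))"

text \<open>The dual coframe of a \<open>g\<close>-orthonormal frame \<open>E\<close> is \<open>\<omega>\<^sub>i = g(E\<^sub>i, \<cdot>)\<close>. The tensor does not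
  depend on the frame.\<close>

definition laguerre_second_form ::
  "('p, 'm::finite) chart set \<Rightarrow> ('p \<Rightarrow> real ^ 'n) \<Rightarrow> ('p \<Rightarrow> real ^ 'n::finite) \<Rightarrow>
   ('p, 'm) chart \<Rightarrow> 'p \<Rightarrow> real ^ 'm \<Rightarrow> real ^ 'm \<Rightarrow> real" where
  "laguerre_second_form A x \<xi> c p v w =
     (let E = (SOME E. laguerre_orthonormal A x \<xi> c p E);
          B = (\<lambda>i j. lip (chart_deriv c (laguerre_gauss_map A x \<xi>) p (E i))
                         (chart_deriv c (laguerre_position A x \<xi>) p (E j)));
          \<omega> = (\<lambda>i. laguerre_metric A x \<xi> c p (E i))
      in \<Sum>i\<in>UNIV. \<Sum>j\<in>UNIV. B i j * \<omega> i v * \<omega> j w)"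

end

theory Submission
  imports Defs
begin

text \<open>Write \<open>\<langle>(a, s), (b, t)\<rangle> = a \<bullet> b - s t\<close> for the product of the Minkowski space
  \<open>\<real>\<^sup>n \<times> \<real>\<close> (the constant \<open>mip\<close>). This space is the quotient of the orthogonal
  complement of \<open>wp\<close> by \<open>wp\<close>, a contact element \<open>(x, \<xi>)\<close> is the null line through
  \<open>(x, 0)\<close> with direction \<open>(\<xi>, 1)\<close>, and the Laguerre group is the group of affine isometries of this
  space. The proof moves between the two pictures.

  Let \<open>T\<close> be an orientation-preserving element of the Laguerre group that maps \<open>(x, \<xi>)\<close> to \<open>(x', \<xi>')\<close>. Then
  \<open>T (gamma2 (x, \<xi>))\<close> is \<open>b > 0\<close> times \<open>gamma2 (x', \<xi>')\<close> and \<open>T (gamma1 (x, \<xi>))\<close> is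
  \<open>gamma1 (x', \<xi>') + d gamma2 (x', \<xi>')\<close>. Principal vectors are preserved and the radii of curvature \<open>r\<^sub>i\<close> become
  \<open>b r\<^sub>i + d\<close> (\<open>image_frame\<close>), so \<open>T\<close> maps the position vector and the Gauss map of the one
  hypersurface to those of the other. This gives the invariance of the metric and of the second
  fundamental form (\<open>laguerre_invariants_eq\<close>).

  Conversely, equality of the metrics \<open>\<rho>\<^sup>2 d\<xi> \<bullet> d\<xi>\<close> says that \<open>y = (\<rho> / \<rho>') (\<xi>, 1)\<close> and
  \<open>y' = (\<xi>', 1)\<close> are isometric immersions into the light cone. In dimension at least three such immersions are
  rigid (\<open>locally_congruent\<close>); this is Liouville's theorem on conformal maps of the sphere, and it
  requires \<open>n > 3\<close>. The Gauss equation shows that all products of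
  second derivatives of \<open>y\<close> are determined by the metric, and then the moving frame formed by \<open>y\<close>, its first
  derivatives and one second derivative has the same Gram matrix and the same connection
  coefficients as the one formed from \<open>y'\<close>, so that the isometry that relates them is constant. As \<open>M\<close> is connected, one
  Lorentz transformation \<open>\<Lambda>\<close> satisfies \<open>y' = \<Lambda> y\<close> everywhere (\<open>congruent\<close>).

  It remains to find a translation. Equality of the second fundamental forms determines the
  derivative of \<open>\<Lambda> (x, 0) - (x', 0)\<close> up to multiples of \<open>(\<xi>', 1)\<close>: after subtracting such a
  multiple one has a map \<open>S\<close> into \<open>\<real>\<^sup>n\<close> with \<open>dS = \<phi> d\<xi>'\<close>. Symmetry of second
  derivatives forces \<open>\<phi>\<close> to be constant, hence \<open>S - \<phi> \<xi>'\<close> is constant too. So an affine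
  isometry with linear part \<open>\<Lambda>\<close> maps the null line of \<open>(x, \<xi>)\<close> to that of \<open>(x', \<xi>')\<close>
  (\<open>affine_motion\<close>), and the corresponding element of the Laguerre group is the required one.\<close>

section \<open>Calculus of smooth maps\<close>

abbreviation dderiv :: "'a::real_normed_vector \<Rightarrow> ('a \<Rightarrow> 'b::real_normed_vector) \<Rightarrow> 'a \<Rightarrow> 'b" where
  "dderiv v f \<equiv> (\<lambda>x. frechet_derivative f (at x) v)"

lemma dderiv_eqI: "(f has_derivative f') (at x) \<Longrightarrow> dderiv v f x = f' v"
  by (metis frechet_derivative_at)

lemma dderiv_cong:
  assumes "open S" "\<And>x. x \<in> S \<Longrightarrow> f x = g x" "x \<in> S"
  shows "dderiv v f x = dderiv v g x"
proof -
  have "(f has_derivative D) (at x) \<longleftrightarrow> (g has_derivative D) (at x)" for D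
    using has_derivative_transform_within_open[of f D x UNIV S g] has_derivative_transform_within_open[of g D x UNIV S f] assms
    by auto
  then show ?thesis unfolding frechet_derivative_def by simp
qed

lemma differentiable_cong_open:
  assumes "open S" "\<And>x. x \<in> S \<Longrightarrow> f x = g x" "x \<in> S"
  shows "f differentiable at x \<longleftrightarrow> g differentiable at x"
  using has_derivative_transform_within_open[of f _ x UNIV S g] has_derivative_transform_within_open[of g _ x UNIV S f] assms
  unfolding differentiable_def by auto

lemma Ck_on_cong:
  assumes "open S" "\<And>x. x \<in> S \<Longrightarrow> f x = g x"
  shows "Ck_on k S f \<longleftrightarrow> Ck_on k S g"
  using assms
proof (induction k arbitrary: f g)
  case 0
  then show ?case by (simp cong: continuous_on_cong)
next
  case (Suc k)
  have "Ck_on k S (dderiv v f) \<longleftrightarrow> Ck_on k S (dderiv v g)" for v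
    by (rule Suc.IH[OF Suc.prems(1)]) (rule dderiv_cong[OF Suc.prems], auto)
  moreover have "f differentiable at x \<longleftrightarrow> g differentiable at x" if "x \<in> S" for x
    using Suc.prems that by (rule differentiable_cong_open)
  ultimately show ?case by simp
qed

lemma Ck_on_Suc_imp: "Ck_on (Suc k) S f \<Longrightarrow> Ck_on k S f"
proof (induction k arbitrary: f)
  case 0
  then show ?case
    by (simp add: continuous_at_imp_continuous_on differentiable_imp_continuous_within)
next
  case (Suc k)
  from Suc.prems have "Ck_on (Suc k) S (dderiv v f)" for v
    unfolding Ck_on.simps(2)[of "Suc k"] by (rule conjunct2[THEN spec])
  then have "Ck_on k S (dderiv v f)" for v by (rule Suc.IH)
  with Suc.prems show ?case by simp
qed

text \<open>Derivatives on an open set may be prescribed by any formula that is valid there.\<close>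

lemma Ck_on_SucI:
  assumes "open S" "\<And>x. x \<in> S \<Longrightarrow> (f has_derivative (\<lambda>v. F v x)) (at x)" "\<And>v. Ck_on k S (F v)"
  shows "Ck_on (Suc k) S f"
proof -
  have "Ck_on k S (dderiv v f)" for v
    using Ck_on_cong[OF assms(1), of "dderiv v f" "F v"] dderiv_eqI[OF assms(2)] assms(3) by blast
  with differentiableI[OF assms(2)] show ?thesis by simp
qed

lemma Ck_on_Suc_has_derivative:
  "Ck_on (Suc k) S f \<Longrightarrow> x \<in> S \<Longrightarrow> (f has_derivative (\<lambda>v. dderiv v f x)) (at x)"
  by (simp add: frechet_derivative_works)

lemma Ck_on_add:
  assumes "open S" "Ck_on k S f" "Ck_on k S g"
  shows "Ck_on k S (\<lambda>x. f x + g x)"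
  using assms(2,3)
proof (induction k arbitrary: f g)
  case 0
  then show ?case by (simp add: continuous_on_add)
next
  case (Suc k)
  show ?case
  proof (rule Ck_on_SucI[OF assms(1)])
    show "((\<lambda>x. f x + g x) has_derivative (\<lambda>v. dderiv v f x + dderiv v g x)) (at x)" if "x \<in> S" for x
      using Suc.prems that by (intro has_derivative_add Ck_on_Suc_has_derivative)
    show "Ck_on k S (\<lambda>x. dderiv v f x + dderiv v g x)" for v
      using Suc.prems by (intro Suc.IH) simp_all
  qed
qed

lemma Ck_on_bilinear:
  assumes "bounded_bilinear B" "open S" "Ck_on k S f" "Ck_on k S g"
  shows "Ck_on k S (\<lambda>x. B (f x) (g x))"
  using assms(3,4)
proof (induction k arbitrary: f g)
  case 0
  then show ?case by (simp add: bounded_bilinear.continuous_on[OF assms(1)])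
next
  case (Suc k)
  have "Ck_on k S f" "Ck_on k S g"
    by (rule Ck_on_Suc_imp, rule Suc.prems)+
  then have "Ck_on k S (\<lambda>x. B (f x) (dderiv v g x) + B (dderiv v f x) (g x))" for v
    using Suc.prems by (intro Ck_on_add Suc.IH assms(2)) simp_all
  then show ?case
    using bounded_bilinear.FDERIV[OF assms(1) Ck_on_Suc_has_derivative[OF Suc.prems(1)] Ck_on_Suc_has_derivative[OF Suc.prems(2)]]
    by (intro Ck_on_SucI[OF assms(2)])
qed

lemma Ck_on_const: "Ck_on k S (\<lambda>x. c)"
  by (induction k arbitrary: c) simp_all

lemma Ck_on_linear:
  assumes "bounded_linear L" "open S" "Ck_on k S f"
  shows "Ck_on k S (\<lambda>x. L (f x))"
proof -
  interpret L: bounded_linear L by fact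
  have "bounded_bilinear (\<lambda>(c::real) w. c *\<^sub>R L w)"
    by (rule bounded_bilinear.comp[OF bounded_bilinear_scaleR bounded_linear_ident assms(1)])
  from Ck_on_bilinear[OF this assms(2) Ck_on_const[of _ _ 1] assms(3)] show ?thesis by simp
qed

lemma smooth_on_bilinear:
  "bounded_bilinear B \<Longrightarrow> open S \<Longrightarrow> smooth_on S f \<Longrightarrow> smooth_on S g \<Longrightarrow> smooth_on S (\<lambda>x. B (f x) (g x))"
  by (simp add: smooth_on_def Ck_on_bilinear)

lemma smooth_on_linear:
  "bounded_linear L \<Longrightarrow> open S \<Longrightarrow> smooth_on S f \<Longrightarrow> smooth_on S (\<lambda>x. L (f x))"
  by (simp add: smooth_on_def Ck_on_linear)

lemma smooth_on_const: "smooth_on S (\<lambda>x. c)"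
  by (simp add: smooth_on_def Ck_on_const)

lemma smooth_on_cong: "open S \<Longrightarrow> (\<And>x. x \<in> S \<Longrightarrow> f x = g x) \<Longrightarrow> smooth_on S f \<longleftrightarrow> smooth_on S g"
  unfolding smooth_on_def using Ck_on_cong by blast

lemma smooth_on_dderiv: "smooth_on S f \<Longrightarrow> smooth_on S (dderiv v f)"
  unfolding smooth_on_def by (metis Ck_on.simps(2))

lemma smooth_on_differentiable: "smooth_on S f \<Longrightarrow> x \<in> S \<Longrightarrow> f differentiable at x"
  unfolding smooth_on_def by (metis Ck_on.simps(2))

lemma smooth_on_has_derivative:
  "smooth_on S f \<Longrightarrow> x \<in> S \<Longrightarrow> (f has_derivative (\<lambda>v. dderiv v f x)) (at x)"
  using smooth_on_differentiable frechet_derivative_works by blast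

lemma smooth_on_continuous: "smooth_on S f \<Longrightarrow> continuous_on S f"
  unfolding smooth_on_def by (metis Ck_on.simps(1))

lemma smooth_on_Pair:
  assumes "open S" "smooth_on S f" "smooth_on S g"
  shows "smooth_on S (\<lambda>x. (f x, g x))"
proof -
  have "Ck_on k S (\<lambda>x. (f x, g x))" if "Ck_on k S f" "Ck_on k S g" for k
    using that
  proof (induction k arbitrary: f g)
    case 0
    then show ?case by (simp add: continuous_on_Pair)
  next
    case (Suc k)
    show ?case
    proof (rule Ck_on_SucI[OF assms(1)])
      show "((\<lambda>x. (f x, g x)) has_derivative (\<lambda>v. (dderiv v f x, dderiv v g x))) (at x)" if "x \<in> S" for x
        using Suc.prems that by (intro has_derivative_Pair Ck_on_Suc_has_derivative)
      show "Ck_on k S (\<lambda>x. (dderiv v f x, dderiv v g x))" for v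
        using Suc.prems by (intro Suc.IH) simp_all
    qed
  qed
  with assms show ?thesis by (simp add: smooth_on_def)
qed

lemma smooth_on_add:
  assumes "open S" "smooth_on S f" "smooth_on S g"
  shows "smooth_on S (\<lambda>x. f x + g x)"
  using assms by (simp add: smooth_on_def Ck_on_add)

lemma smooth_on_diff:
  assumes "open S" "smooth_on S f" "smooth_on S g"
  shows "smooth_on S (\<lambda>x. f x - g x)"
  using smooth_on_add[OF assms(1,2) smooth_on_linear[OF bounded_linear_minus[OF bounded_linear_ident] assms(1,3)]] by simp

lemma smooth_on_inner:
  "open S \<Longrightarrow> smooth_on S f \<Longrightarrow> smooth_on S g \<Longrightarrow> smooth_on S (\<lambda>x. f x \<bullet> g x)"
  by (rule smooth_on_bilinear[OF bounded_bilinear_inner])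

lemma smooth_on_scaleR:
  "open S \<Longrightarrow> smooth_on S f \<Longrightarrow> smooth_on S g \<Longrightarrow> smooth_on S (\<lambda>x. f x *\<^sub>R g x)"
  by (rule smooth_on_bilinear[OF bounded_bilinear_scaleR])

lemma smooth_on_inverse:
  fixes f :: "'a::euclidean_space \<Rightarrow> real"
  assumes "open S" "smooth_on S f" "\<And>x. x \<in> S \<Longrightarrow> f x \<noteq> 0"
  shows "smooth_on S (\<lambda>x. inverse (f x))"
proof -
  have "Ck_on k S (\<lambda>x. inverse (f x))" for k
  proof (induction k)
    case 0
    then show ?case using smooth_on_continuous[OF assms(2)] assms(3) by (simp add: continuous_on_inverse)
  next
    case (Suc k)
    have d: "((\<lambda>x. inverse (f x)) has_derivative
        (\<lambda>v. - (inverse (f x) * (dderiv v f x * inverse (f x))))) (at x)" if "x \<in> S" for x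
      using that by (auto intro!: derivative_eq_intros smooth_on_has_derivative[OF assms(2)] simp: assms(3) algebra_simps)
    have "Ck_on k S (\<lambda>x. - (inverse (f x) * (dderiv v f x * inverse (f x))))" for v
      using smooth_on_dderiv[OF assms(2)] Suc
      by (intro Ck_on_linear[OF bounded_linear_minus[OF bounded_linear_ident]] Ck_on_bilinear[OF bounded_bilinear_mult] \<open>open S\<close>)
         (auto simp: smooth_on_def)
    with d show ?case by (intro Ck_on_SucI[OF assms(1)])
  qed
  then show ?thesis by (simp add: smooth_on_def)
qed

text \<open>The derivative is written as \<open>sqrt f * (f' / f) / 2\<close>, so that the induction hypothesis applies to it.\<close>

lemma smooth_on_sqrt:
  fixes f :: "'a::euclidean_space \<Rightarrow> real"
  assumes "open S" "smooth_on S f" "\<And>x. x \<in> S \<Longrightarrow> f x > 0"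
  shows "smooth_on S (\<lambda>x. sqrt (f x))"
proof -
  have *: "smooth_on S (\<lambda>x. inverse (f x))"
    using assms by (intro smooth_on_inverse) (auto simp: less_imp_neq[symmetric] dual_order.strict_implies_not_eq)
  have "Ck_on k S (\<lambda>x. sqrt (f x))" for k
  proof (induction k)
    case 0
    then show ?case using smooth_on_continuous[OF assms(2)] by (simp add: continuous_on_real_sqrt)
  next
    case (Suc k)
    have d: "((\<lambda>x. sqrt (f x)) has_derivative
        (\<lambda>v. (1/2) * (sqrt (f x) * (dderiv v f x * inverse (f x))))) (at x)" if "x \<in> S" for x
    proof -
      have e: "(sqrt (f x) * inverse (f x)) = inverse (sqrt (f x))"
        using assms(3)[OF that] by (simp add: field_simps)
      show ?thesis
        using that assms(3)[OF that]
        by (auto intro!: derivative_eq_intros smooth_on_has_derivative[OF assms(2)] simp: e[symmetric] algebra_simps)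
    qed
    have "Ck_on k S (\<lambda>x. (1/2) * (sqrt (f x) * (dderiv v f x * inverse (f x))))" for v
      using smooth_on_dderiv[OF assms(2)] Suc *
      by (intro Ck_on_bilinear[OF bounded_bilinear_mult] Ck_on_const \<open>open S\<close>) (auto simp: smooth_on_def)
    with d show ?case by (intro Ck_on_SucI[OF assms(1)])
  qed
  then show ?thesis by (simp add: smooth_on_def)
qed

lemma dderiv_bilinear:
  assumes "bounded_bilinear B" "f differentiable at x" "g differentiable at x"
  shows "dderiv v (\<lambda>x. B (f x) (g x)) x = B (f x) (dderiv v g x) + B (dderiv v f x) (g x)"
  by (rule dderiv_eqI[OF bounded_bilinear.FDERIV[OF assms(1)]])
     (use assms(2,3) in \<open>auto simp: frechet_derivative_works\<close>)

lemma dderiv_linear: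
  assumes "bounded_linear L" "f differentiable at x"
  shows "dderiv v (\<lambda>x. L (f x)) x = L (dderiv v f x)"
  by (rule dderiv_eqI[OF bounded_linear.has_derivative[OF assms(1)]])
     (use assms(2) in \<open>auto simp: frechet_derivative_works\<close>)

lemma linear_dderiv: "f differentiable at x \<Longrightarrow> linear (\<lambda>v. dderiv v f x)"
  by (simp add: linear_frechet_derivative)

text \<open>Equality of mixed second derivatives. For a real function, the second difference
  \<open>f (x + s u + s v) - f (x + s u) - f (x + s v) + f x\<close> is symmetric in \<open>u\<close> and \<open>v\<close>, and two
  applications of the mean value theorem turn it into \<open>s\<^sup>2\<close> times a mixed derivative at a point
  close to \<open>x\<close>; the values of a Euclidean space are treated componentwise.\<close>

lemma mixed_difference_mvt:
  fixes f :: "'a::euclidean_space \<Rightarrow> real"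
  assumes S: "open S" "smooth_on S f" and s: "s > 0"
    and sub: "\<And>a b. \<lbrakk>0 \<le> a; a \<le> s; 0 \<le> b; b \<le> s\<rbrakk> \<Longrightarrow> x + a *\<^sub>R u + b *\<^sub>R v \<in> S"
  shows "\<exists>a b. 0 < a \<and> a < s \<and> 0 < b \<and> b < s \<and>
     f (x + s *\<^sub>R u + s *\<^sub>R v) - f (x + s *\<^sub>R u) - f (x + s *\<^sub>R v) + f x =
       s * s * dderiv v (dderiv u f) (x + a *\<^sub>R u + b *\<^sub>R v)"
proof -
  define \<phi> where "\<phi> a = f (x + a *\<^sub>R u + s *\<^sub>R v) - f (x + a *\<^sub>R u + 0 *\<^sub>R v)" for a
  have lines: "((\<lambda>a. f (x + a *\<^sub>R u + b *\<^sub>R v)) has_real_derivative dderiv u f (x + a *\<^sub>R u + b *\<^sub>R v)) (at a)"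
    if "0 \<le> a" "a \<le> s" "0 \<le> b" "b \<le> s" for a b
  proof -
    have l: "linear (\<lambda>w. dderiv w f (x + a *\<^sub>R u + b *\<^sub>R v))"
      by (intro linear_dderiv smooth_on_differentiable[OF S(2)] sub that)
    have "((\<lambda>a. f (x + a *\<^sub>R u + b *\<^sub>R v)) has_derivative
        (\<lambda>h. dderiv (h *\<^sub>R u) f (x + a *\<^sub>R u + b *\<^sub>R v))) (at a)"
      by (rule has_derivative_compose[where f="\<lambda>a. x + a *\<^sub>R u + b *\<^sub>R v" and g=f and g'="\<lambda>w. dderiv w f (x + a *\<^sub>R u + b *\<^sub>R v)"])
         (auto intro!: derivative_eq_intros smooth_on_has_derivative[OF S(2)] sub that)
    then show ?thesis
      unfolding has_field_derivative_def by (simp add: linear_cmul[OF l] mult.commute[of _ "dderiv _ _ _"])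
  qed
  have "(\<phi> has_real_derivative dderiv u f (x + a *\<^sub>R u + s *\<^sub>R v) - dderiv u f (x + a *\<^sub>R u + 0 *\<^sub>R v)) (at a)"
    if "0 \<le> a" "a \<le> s" for a
    unfolding \<phi>_def using s that by (intro DERIV_diff lines) auto
  from MVT2[OF s this] obtain a where a: "0 < a" "a < s" and
    1: "\<phi> s - \<phi> 0 = s * (dderiv u f (x + a *\<^sub>R u + s *\<^sub>R v) - dderiv u f (x + a *\<^sub>R u + 0 *\<^sub>R v))"
    by auto
  have "((\<lambda>b. dderiv u f (x + a *\<^sub>R u + b *\<^sub>R v)) has_real_derivative
        dderiv v (dderiv u f) (x + a *\<^sub>R u + b *\<^sub>R v)) (at b)"
    if "0 \<le> b" "b \<le> s" for b
  proof -
    note S' = smooth_on_dderiv[OF S(2), of u]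
    have l: "linear (\<lambda>w. dderiv w (dderiv u f) (x + a *\<^sub>R u + b *\<^sub>R v))"
      by (intro linear_dderiv smooth_on_differentiable[OF S'] sub that) (use a in auto)
    have "((\<lambda>b. dderiv u f (x + a *\<^sub>R u + b *\<^sub>R v)) has_derivative
        (\<lambda>h. dderiv (h *\<^sub>R v) (dderiv u f) (x + a *\<^sub>R u + b *\<^sub>R v))) (at b)"
      by (rule has_derivative_compose[where f="\<lambda>b. x + a *\<^sub>R u + b *\<^sub>R v" and g="dderiv u f" and g'="\<lambda>w. dderiv w (dderiv u f) (x + a *\<^sub>R u + b *\<^sub>R v)"])
         (use a in \<open>auto intro!: derivative_eq_intros smooth_on_has_derivative[OF S'] sub that\<close>)
    then show ?thesis
      unfolding has_field_derivative_def by (simp add: linear_cmul[OF l] mult.commute[of _ "dderiv _ _ _"])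
  qed
  from MVT2[OF s this] obtain b where b: "0 < b" "b < s" and
    2: "dderiv u f (x + a *\<^sub>R u + s *\<^sub>R v) - dderiv u f (x + a *\<^sub>R u + 0 *\<^sub>R v) =
        s * dderiv v (dderiv u f) (x + a *\<^sub>R u + b *\<^sub>R v)"
    by auto
  show ?thesis
    using a b 1 2 unfolding \<phi>_def by (intro exI[of _ a] exI[of _ b]) (simp add: algebra_simps)
qed

lemma dderiv_commute_real:
  fixes f :: "'a::euclidean_space \<Rightarrow> real"
  assumes S: "open S" "smooth_on S f" and x: "x \<in> S"
  shows "dderiv v (dderiv u f) x = dderiv u (dderiv v f) x"
proof (rule ccontr)
  assume neq: "dderiv v (dderiv u f) x \<noteq> dderiv u (dderiv v f) x"
  define e where "e = \<bar>dderiv v (dderiv u f) x - dderiv u (dderiv v f) x\<bar> / 2"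
  have e: "e > 0" using neq by (simp add: e_def)
  have cont: "isCont (dderiv b (dderiv a f)) x" for a b
    using smooth_on_continuous[OF smooth_on_dderiv[OF smooth_on_dderiv[OF S(2)]]] S(1) x
    by (simp add: continuous_on_eq_continuous_at)
  have near: "\<exists>d>0. \<forall>y. dist y x < d \<longrightarrow> \<bar>dderiv b (dderiv a f) y - dderiv b (dderiv a f) x\<bar> < e" for a b
    using cont[of a b] e by (simp add: continuous_at_eps_delta dist_real_def)
  obtain d1 where d1: "d1 > 0" "\<forall>y. dist y x < d1 \<longrightarrow> \<bar>dderiv v (dderiv u f) y - dderiv v (dderiv u f) x\<bar> < e"
    using near[of u v] by (elim exE conjE) (rule that)
  obtain d2 where d2: "d2 > 0" "\<forall>y. dist y x < d2 \<longrightarrow> \<bar>dderiv u (dderiv v f) y - dderiv u (dderiv v f) x\<bar> < e"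
    using near[of v u] by (elim exE conjE) (rule that)
  obtain d3 where d3: "d3 > 0" "\<And>y. dist y x < d3 \<Longrightarrow> y \<in> S"
    using S(1) x by (auto simp: open_dist)
  define d where "d = min d1 (min d2 d3)"
  define s where "s = d / (2 * (norm u + norm v + 1))"
  have d: "d > 0" using d1(1) d2(1) d3(1) by (simp add: d_def)
  then have s: "s > 0" by (simp add: s_def add_nonneg_pos)
  have sd: "s * (norm u + norm v) < d"
  proof -
    have "s * (norm u + norm v) \<le> s * (norm u + norm v + 1)" using s by simp
    also have "\<dots> = d / 2"
      unfolding s_def using add_nonneg_pos[of "norm u + norm v" 1] by (simp add: field_simps)
    also have "\<dots> < d" using d by simp
    finally show ?thesis .
  qed
  have close: "dist (x + a *\<^sub>R p + b *\<^sub>R q) x < d"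
    if "0 \<le> a" "a \<le> s" "0 \<le> b" "b \<le> s" "norm p + norm q = norm u + norm v" for a b p q
  proof -
    have "dist (x + a *\<^sub>R p + b *\<^sub>R q) x \<le> norm (a *\<^sub>R p) + norm (b *\<^sub>R q)"
      using norm_triangle_ineq[of "a *\<^sub>R p" "b *\<^sub>R q"] by (simp add: dist_norm add.assoc)
    also have "\<dots> \<le> s * norm p + s * norm q" using that by (auto intro!: add_mono mult_right_mono)
    also have "\<dots> = s * (norm u + norm v)" using that(5) by (simp add: algebra_simps[symmetric])
    finally show ?thesis using sd by simp
  qed
  obtain a b where ab: "0 < a" "a < s" "0 < b" "b < s"
    "f (x + s *\<^sub>R u + s *\<^sub>R v) - f (x + s *\<^sub>R u) - f (x + s *\<^sub>R v) + f x =
       s * s * dderiv v (dderiv u f) (x + a *\<^sub>R u + b *\<^sub>R v)"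
    using mixed_difference_mvt[OF S s, of x u v] close d3 by (auto simp: d_def)
  obtain a' b' where ab': "0 < a'" "a' < s" "0 < b'" "b' < s"
    "f (x + s *\<^sub>R v + s *\<^sub>R u) - f (x + s *\<^sub>R v) - f (x + s *\<^sub>R u) + f x =
       s * s * dderiv u (dderiv v f) (x + a' *\<^sub>R v + b' *\<^sub>R u)"
    using mixed_difference_mvt[OF S s, of x v u] close[of _ _ v u] d3 by (auto simp: d_def)
  have "f (x + s *\<^sub>R u + s *\<^sub>R v) = f (x + s *\<^sub>R v + s *\<^sub>R u)" by (simp add: algebra_simps)
  then have "s * s * dderiv v (dderiv u f) (x + a *\<^sub>R u + b *\<^sub>R v) = s * s * dderiv u (dderiv v f) (x + a' *\<^sub>R v + b' *\<^sub>R u)"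
    using ab(5) ab'(5) by linarith
  then have eq: "dderiv v (dderiv u f) (x + a *\<^sub>R u + b *\<^sub>R v) = dderiv u (dderiv v f) (x + a' *\<^sub>R v + b' *\<^sub>R u)"
    using s by simp
  have "\<bar>dderiv v (dderiv u f) (x + a *\<^sub>R u + b *\<^sub>R v) - dderiv v (dderiv u f) x\<bar> < e"
    using close[of a b u v] ab by (intro d1(2)[rule_format]) (simp_all add: d_def)
  moreover have "\<bar>dderiv u (dderiv v f) (x + a' *\<^sub>R v + b' *\<^sub>R u) - dderiv u (dderiv v f) x\<bar> < e"
    using close[of a' b' v u] ab' by (intro d2(2)[rule_format]) (simp_all add: d_def)
  ultimately show False using eq unfolding e_def by (simp add: abs_if split: if_splits)
qed

lemma dderiv_commute:
  fixes f :: "'a::euclidean_space \<Rightarrow> 'b::euclidean_space"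
  assumes S: "open S" "smooth_on S f" and x: "x \<in> S"
  shows "dderiv v (dderiv u f) x = dderiv u (dderiv v f) x"
proof (rule euclidean_eqI)
  fix b :: 'b
  have sm: "smooth_on S (\<lambda>x. f x \<bullet> b)"
    by (intro smooth_on_linear[OF bounded_linear_inner_left] S)
  have 1: "dderiv w (\<lambda>x. f x \<bullet> b) y = dderiv w f y \<bullet> b" if "y \<in> S" for w y
    by (rule dderiv_linear[OF bounded_linear_inner_left smooth_on_differentiable[OF S(2) that]])
  have 2: "dderiv w (dderiv u (\<lambda>x. f x \<bullet> b)) x = dderiv w (dderiv u f) x \<bullet> b" for w u
  proof -
    have "dderiv w (dderiv u (\<lambda>x. f x \<bullet> b)) x = dderiv w (\<lambda>x. dderiv u f x \<bullet> b) x"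
      by (rule dderiv_cong[OF S(1) _ x]) (rule 1)
    also have "\<dots> = dderiv w (dderiv u f) x \<bullet> b"
      by (rule dderiv_linear[OF bounded_linear_inner_left smooth_on_differentiable[OF smooth_on_dderiv[OF S(2)] x]])
    finally show ?thesis .
  qed
  show "dderiv v (dderiv u f) x \<bullet> b = dderiv u (dderiv v f) x \<bullet> b"
    using dderiv_commute_real[OF S(1) sm x] by (simp add: 2)
qed

section \<open>Charts\<close>

context
  fixes A :: "('p::{t2_space, second_countable_topology}, 'm::finite) chart set"
  assumes A: "smooth_atlas A"
begin

lemma chart_facts:
  assumes "c \<in> A"
  shows open_chart_domain: "open (fst c)"
    and open_chart_image: "open (snd c ` fst c)"
    and chart_inv_chart: "p \<in> fst c \<Longrightarrow> chart_inv c (snd c p) = p"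
    and continuous_chart: "continuous_on (fst c) (snd c)"
    and continuous_chart_inv: "continuous_on (snd c ` fst c) (chart_inv c)"
    and chart_inv_in: "y \<in> snd c ` fst c \<Longrightarrow> chart_inv c y \<in> fst c"
    and chart_chart_inv: "y \<in> snd c ` fst c \<Longrightarrow> snd c (chart_inv c y) = y"
proof -
  have *: "open (fst c)" "open (snd c ` fst c)" "homeomorphism (fst c) (snd c ` fst c) (snd c) (chart_inv c)"
    using A assms by (simp_all add: smooth_atlas_def)
  show "open (fst c)" "open (snd c ` fst c)" by fact+
  show "p \<in> fst c \<Longrightarrow> chart_inv c (snd c p) = p"
    "y \<in> snd c ` fst c \<Longrightarrow> chart_inv c y \<in> fst c" "y \<in> snd c ` fst c \<Longrightarrow> snd c (chart_inv c y) = y"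
    "continuous_on (fst c) (snd c)" "continuous_on (snd c ` fst c) (chart_inv c)"
    using *(3) unfolding homeomorphism_def by auto
qed

lemma chart_cover: obtains c where "c \<in> A" "p \<in> fst c"
  using A unfolding smooth_atlas_def by blast

text \<open>The components of a tangent vector in two charts are related by the derivative of the
  transition map.\<close>

lemma chart_deriv_change:
  assumes c: "c \<in> A" "p \<in> fst c" and d: "d \<in> A" "p \<in> fst d"
    and f: "(f \<circ> chart_inv c) differentiable at (snd c p)"
  shows "chart_deriv d f p v = chart_deriv c f p (dderiv v (snd c \<circ> chart_inv d) (snd d p))"
proof -
  let ?W = "snd d ` (fst d \<inter> fst c)"
  have W_eq: "?W = snd d ` fst d \<inter> chart_inv d -` fst c"
    using chart_inv_chart[OF d(1)] chart_chart_inv[OF d(1)] by force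
  have "open ?W"
    unfolding W_eq
    by (rule continuous_open_preimage[OF continuous_chart_inv[OF d(1)] open_chart_image[OF d(1)] open_chart_domain[OF c(1)]])
  have p: "snd d p \<in> ?W" using c d by auto
  have "smooth_on ?W (snd c \<circ> chart_inv d)"
    using A c d unfolding smooth_atlas_def by blast
  then have t: "((snd c \<circ> chart_inv d) has_derivative (\<lambda>v. dderiv v (snd c \<circ> chart_inv d) (snd d p))) (at (snd d p))"
    using p by (rule smooth_on_has_derivative)
  have at: "(snd c \<circ> chart_inv d) (snd d p) = snd c p"
    using chart_inv_chart[OF d] by simp
  have "((f \<circ> chart_inv c) has_derivative (\<lambda>v. chart_deriv c f p v)) (at ((snd c \<circ> chart_inv d) (snd d p)))"
    using f unfolding at chart_deriv_def by (simp add: frechet_derivative_works)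
  from diff_chain_at[OF t this]
  have D: "((f \<circ> chart_inv c) \<circ> (snd c \<circ> chart_inv d) has_derivative
      (\<lambda>v. chart_deriv c f p (dderiv v (snd c \<circ> chart_inv d) (snd d p)))) (at (snd d p))"
    by (simp add: o_def)
  have "chart_deriv d f p v = dderiv v ((f \<circ> chart_inv c) \<circ> (snd c \<circ> chart_inv d)) (snd d p)"
    unfolding chart_deriv_def
  proof (rule dderiv_cong[OF \<open>open ?W\<close> _ p])
    fix y assume "y \<in> ?W"
    then show "(f \<circ> chart_inv d) y = ((f \<circ> chart_inv c) \<circ> (snd c \<circ> chart_inv d)) y"
      using chart_inv_chart[OF c(1)] chart_inv_chart[OF d(1)] by auto
  qed
  then show ?thesis using dderiv_eqI[OF D] by simp
qed

lemma locally_constant_imp_constant: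
  fixes f :: "'p \<Rightarrow> 'b"
  assumes "connected (UNIV :: 'p set)" and "\<And>p. \<exists>W. open W \<and> p \<in> W \<and> (\<forall>q\<in>W. f q = f p)"
  shows "f p = f q"
proof (rule connected_local_const[OF assms(1), of p q f])
  show "\<forall>a\<in>UNIV. \<forall>\<^sub>F b in at a within UNIV. f a = f b"
  proof
    fix a
    obtain W where W: "open W" "a \<in> W" "\<forall>q\<in>W. f q = f a" using assms(2)[of a] by blast
    then have "\<forall>q\<in>W. q \<noteq> a \<longrightarrow> q \<in> UNIV \<longrightarrow> f a = f q" by metis
    with W(1,2) show "\<forall>\<^sub>F b in at a within UNIV. f a = f b"
      unfolding eventually_at_topological by blast
  qed
qed auto

lemma zero_chart_derivative_imp_constant:
  fixes f :: "'p \<Rightarrow> 'b::real_normed_vector"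
  assumes conn: "connected (UNIV :: 'p set)"
    and D: "\<And>c y. c \<in> A \<Longrightarrow> y \<in> snd c ` fst c \<Longrightarrow> ((f \<circ> chart_inv c) has_derivative (\<lambda>_. 0)) (at y)"
  shows "f p = f q"
proof (rule locally_constant_imp_constant[OF conn])
  fix p
  obtain c where c: "c \<in> A" "p \<in> fst c" by (rule chart_cover)
  obtain e where e: "e > 0" "ball (snd c p) e \<subseteq> snd c ` fst c"
    using open_chart_image[OF c(1)] c(2) by (metis imageI open_contains_ball)
  let ?W = "fst c \<inter> snd c -` ball (snd c p) e"
  have "open ?W"
    by (rule continuous_open_preimage[OF continuous_chart[OF c(1)] open_chart_domain[OF c(1)]]) simp
  moreover have "p \<in> ?W" using c e by simp
  moreover have "f q = f p" if q: "q \<in> ?W" for q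
  proof -
    have "\<exists>k. \<forall>y\<in>ball (snd c p) e. (f \<circ> chart_inv c) y = k"
    proof (rule has_derivative_zero_constant)
      show "((f \<circ> chart_inv c) has_derivative (\<lambda>h. 0)) (at y within ball (snd c p) e)"
        if "y \<in> ball (snd c p) e" for y
      proof (rule has_derivative_at_withinI)
        have "y \<in> snd c ` fst c" using e(2) that by (rule subsetD)
        then show "((f \<circ> chart_inv c) has_derivative (\<lambda>h. 0)) (at y)" by (rule D[OF c(1)])
      qed
    qed simp
    moreover have "snd c q \<in> ball (snd c p) e" "snd c p \<in> ball (snd c p) e" using q e by auto
    ultimately have "(f \<circ> chart_inv c) (snd c q) = (f \<circ> chart_inv c) (snd c p)" by metis
    then show ?thesis using chart_inv_chart[OF c(1)] c(2) q by simp
  qed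
  ultimately show "\<exists>W. open W \<and> p \<in> W \<and> (\<forall>q\<in>W. f q = f p)" by blast
qed

end

lemma smooth_map_chart: "smooth_map A f \<Longrightarrow> c \<in> A \<Longrightarrow> smooth_on (snd c ` fst c) (f \<circ> chart_inv c)"
  by (simp add: smooth_map_def)


section \<open>Principal frames\<close>

lemma nonneg_quadratic_imp_linear_zero:
  fixes c d :: real
  assumes "\<And>t. 0 \<le> 2 * t * c + t\<^sup>2 * d" "d \<ge> 0"
  shows "c = 0"
proof -
  \<comment> \<open>The quadratic is minimal at \<open>- c / d\<close>; adding \<open>1\<close> covers the case \<open>d = 0\<close>.\<close>
  define t where "t = - c / (d + 1)"
  have c: "c = - t * (d + 1)" using assms(2) by (simp add: t_def)
  have "0 \<le> 2 * t * c + t\<^sup>2 * d" by (rule assms)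
  also have "\<dots> = - (t\<^sup>2 * (d + 2))" unfolding c by (simp add: power2_eq_square algebra_simps)
  finally have "t\<^sup>2 * (d + 2) \<le> 0" by simp
  then have "t = 0" using assms(2) by (auto simp: mult_le_0_iff)
  then show ?thesis using c by simp
qed

lemma dim_orthogonal_hyperplane_in:
  fixes V :: "'a::euclidean_space set"
  assumes "subspace V" "b \<in> V" "norm b = 1"
  shows "subspace {v \<in> V. b \<bullet> v = 0}" "dim V = Suc (dim {v \<in> V. b \<bullet> v = 0})"
proof -
  let ?W = "{v \<in> V. b \<bullet> v = 0}"
  show W: "subspace ?W"
    using assms(1) unfolding subspace_def by (auto simp: inner_add_right)
  have bb: "b \<bullet> b = 1" using assms(3) by (simp add: norm_eq_1)
  have "span (insert b ?W) = V"
  proof (rule antisym)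
    show "span (insert b ?W) \<subseteq> V" using assms by (intro span_minimal) auto
    show "V \<subseteq> span (insert b ?W)"
    proof
      fix v assume v: "v \<in> V"
      have "v - (b \<bullet> v) *\<^sub>R b \<in> ?W"
        using assms v bb by (auto simp: inner_diff_right intro!: subspace_diff subspace_scale)
      then have "v - (b \<bullet> v) *\<^sub>R b \<in> span ?W" by (rule span_base)
      then show "v \<in> span (insert b ?W)" unfolding span_insert by blast
    qed
  qed
  moreover have "b \<notin> span ?W" using bb W by (simp add: span_eq_iff[THEN iffD2])
  ultimately have "dim (insert b ?W) = Suc (dim ?W)" "dim (insert b ?W) = dim V"
    using dim_insert[of b ?W] dim_span[of "insert b ?W"] by simp_all
  then show "dim V = Suc (dim ?W)" by simp
qed

text \<open>The spectral theorem: a maximiser \<open>b\<close> of the Rayleigh quotient is an eigenvector, and the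
  operator restricts to the orthogonal complement of \<open>b\<close>.\<close>

lemma selfadjoint_eigenbasis:
  fixes V :: "'a::euclidean_space set" and f :: "'a \<Rightarrow> 'a"
  assumes "subspace V" "linear f" "f ` V \<subseteq> V" "\<And>u v. u \<in> V \<Longrightarrow> v \<in> V \<Longrightarrow> f u \<bullet> v = u \<bullet> f v"
  shows "\<exists>B\<subseteq>V. finite B \<and> card B = dim V \<and> (\<forall>b\<in>B. norm b = 1) \<and>
    (\<forall>b\<in>B. \<forall>b'\<in>B. b \<noteq> b' \<longrightarrow> b \<bullet> b' = 0) \<and> (\<forall>b\<in>B. \<exists>k. f b = k *\<^sub>R b)"
  using assms
proof (induction "dim V" arbitrary: V)
  case 0
  then show ?case by (intro exI[of _ "{}"]) simp
next
  case (Suc d)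
  note V = \<open>subspace V\<close> and lin = \<open>linear f\<close> and sa = Suc.prems(4)
  let ?S = "sphere 0 1 \<inter> V"
  have "V \<noteq> {0}" using Suc.hyps(2) by (metis dim_singleton dim_eq_0 nat.simps(3) subset_refl)
  then obtain v0 where v0: "v0 \<in> V" "v0 \<noteq> 0" using subspace_0[OF V] by blast
  have "compact ?S" using closed_subspace[OF V] by (simp add: compact_Int_closed)
  moreover have "(1 / norm v0) *\<^sub>R v0 \<in> ?S" using v0 subspace_scale[OF V] by simp
  then have "?S \<noteq> {}" by blast
  moreover have "continuous_on ?S (\<lambda>v. v \<bullet> f v)"
    by (intro continuous_on_inner continuous_on_id linear_continuous_on linear_linear[THEN iffD2] lin)
  ultimately have "\<exists>b\<in>?S. \<forall>v\<in>?S. v \<bullet> f v \<le> b \<bullet> f b"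
    by (intro continuous_attains_sup)
  then obtain b where b: "b \<in> ?S" "\<And>v. v \<in> ?S \<Longrightarrow> v \<bullet> f v \<le> b \<bullet> f b"
    by (elim bexE) (rule that, assumption, drule bspec)
  define k where "k = b \<bullet> f b"
  have bV: "b \<in> V" "norm b = 1" using b(1) by auto
  then have bb: "b \<bullet> b = 1" by (simp add: norm_eq_1)
  have q: "0 \<le> k * (v \<bullet> v) - v \<bullet> f v" if v: "v \<in> V" for v
  proof (cases "v = 0")
    case True
    then show ?thesis by simp
  next
    case False
    have "((1 / norm v) *\<^sub>R v) \<bullet> f ((1 / norm v) *\<^sub>R v) \<le> k"
      unfolding k_def using False v subspace_scale[OF V] by (intro b(2)) simp
    then have "(v \<bullet> f v) / (norm v)\<^sup>2 \<le> k"
      by (simp add: linear_cmul[OF lin] power2_eq_square)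
    then show ?thesis using False by (simp add: field_simps dot_square_norm)
  qed
  have crit: "k * (b \<bullet> w) - f b \<bullet> w = 0" if w: "w \<in> V" for w
  proof (rule nonneg_quadratic_imp_linear_zero[OF _ q[OF w]])
    fix t :: real
    have "0 \<le> k * ((b + t *\<^sub>R w) \<bullet> (b + t *\<^sub>R w)) - (b + t *\<^sub>R w) \<bullet> f (b + t *\<^sub>R w)"
      using w bV V by (intro q) (auto intro: subspace_add subspace_scale)
    also have "(b + t *\<^sub>R w) \<bullet> (b + t *\<^sub>R w) = 1 + 2 * t * (b \<bullet> w) + t\<^sup>2 * (w \<bullet> w)"
      using bb inner_commute[of w b] by (simp add: inner_add_left inner_add_right power2_eq_square algebra_simps)
    also have "(b + t *\<^sub>R w) \<bullet> f (b + t *\<^sub>R w) = k + 2 * t * (f b \<bullet> w) + t\<^sup>2 * (w \<bullet> f w)"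
    proof -
      have e: "b \<bullet> f w = f b \<bullet> w" "w \<bullet> f b = f b \<bullet> w" "b \<bullet> f b = k"
        using sa[OF bV(1) w] inner_commute[of w "f b"] by (simp_all only: k_def)
      have "(b + t *\<^sub>R w) \<bullet> f (b + t *\<^sub>R w) = k + t * (f b \<bullet> w) + t * ((f b \<bullet> w) + t * (w \<bullet> f w))"
        by (simp only: linear_add[OF lin] linear_cmul[OF lin] inner_add_left inner_add_right
            inner_scaleR_left inner_scaleR_right e)
      then show ?thesis by (simp add: power2_eq_square algebra_simps)
    qed
    also have "k * (1 + 2 * t * (b \<bullet> w) + t\<^sup>2 * (w \<bullet> w)) - (k + 2 * t * (f b \<bullet> w) + t\<^sup>2 * (w \<bullet> f w)) =
        2 * t * (k * (b \<bullet> w) - f b \<bullet> w) + t\<^sup>2 * (k * (w \<bullet> w) - w \<bullet> f w)"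
      by (simp add: algebra_simps)
    finally show "0 \<le> 2 * t * (k * (b \<bullet> w) - f b \<bullet> w) + t\<^sup>2 * (k * (w \<bullet> w) - w \<bullet> f w)" .
  qed
  have "f b \<in> V" using bV(1) Suc.prems(3) by (simp add: image_subset_iff)
  then have "k * (b \<bullet> (k *\<^sub>R b - f b)) - f b \<bullet> (k *\<^sub>R b - f b) = 0"
    by (intro crit subspace_diff subspace_scale V bV(1))
  then have "(k *\<^sub>R b - f b) \<bullet> (k *\<^sub>R b - f b) = 0"
    by (simp only: inner_diff_left inner_scaleR_left)
  then have eig: "f b = k *\<^sub>R b" by simp
  let ?W = "{v \<in> V. b \<bullet> v = 0}"
  note W = dim_orthogonal_hyperplane_in[OF V bV]
  have "\<exists>B\<subseteq>?W. finite B \<and> card B = dim ?W \<and> (\<forall>b\<in>B. norm b = 1) \<and>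
    (\<forall>b\<in>B. \<forall>b'\<in>B. b \<noteq> b' \<longrightarrow> b \<bullet> b' = 0) \<and> (\<forall>b\<in>B. \<exists>k. f b = k *\<^sub>R b)"
  proof (rule Suc.hyps(1))
    show "d = dim ?W" using W(2) Suc.hyps(2) by simp
    have "b \<bullet> f v = 0" if "v \<in> ?W" for v
      using that sa[OF bV(1), of v] eig by simp
    then show "f ` ?W \<subseteq> ?W" using Suc.prems(3) by auto
  qed (use W lin sa in auto)
  then obtain B where B: "B \<subseteq> ?W" "finite B" "card B = dim ?W" "\<forall>b\<in>B. norm b = 1"
    "\<forall>b\<in>B. \<forall>b'\<in>B. b \<noteq> b' \<longrightarrow> b \<bullet> b' = 0" "\<forall>b\<in>B. \<exists>k. f b = k *\<^sub>R b"
    by blast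
  have "b \<notin> B" using B(1) bb by auto
  then have "card (insert b B) = dim V" using B(2,3) W(2) by simp
  moreover have "\<forall>a\<in>B. b \<bullet> a = 0" "\<forall>a\<in>B. a \<bullet> b = 0" using B(1) by (auto simp: inner_commute)
  ultimately show ?case
    using B bV eig by (intro exI[of _ "insert b B"]) auto
qed

lemma range_eq_normal_hyperplane:
  fixes X :: "real ^ 'm::finite \<Rightarrow> real ^ 'n::finite"
  assumes "CARD('n) = CARD('m) + 1" "linear X" "inj X" "norm \<nu> = 1" "\<And>v. \<nu> \<bullet> X v = 0"
  shows "range X = {v. \<nu> \<bullet> v = 0}"
proof (rule subspace_dim_equal)
  show "subspace (range X)" by (rule linear_subspace_image[OF assms(2) subspace_UNIV])
  have "\<nu> \<noteq> 0" using assms(4) by auto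
  then have "dim {v. \<nu> \<bullet> v = 0} = CARD('m)"
    using assms(1) by (simp add: dim_hyperplane)
  moreover have "dim (range X) = CARD('m)"
    using dim_image_eq[OF assms(2), of UNIV] assms(3) by (simp add: dim_UNIV)
  ultimately show "dim {v. \<nu> \<bullet> v = 0} \<le> dim (range X)" by simp
qed (use assms(5) in \<open>auto simp: subspace_hyperplane\<close>)

text \<open>The shape operator \<open>N \<circ> X\<^sup>-\<^sup>1\<close> maps the tangent hyperplane to itself and is selfadjoint.\<close>

lemma principal_frame_linear:
  fixes X N :: "real ^ 'm::finite \<Rightarrow> real ^ 'n::finite"
  assumes "CARD('n) = CARD('m) + 1" "linear X" "inj X" "norm \<nu> = 1" "\<And>v. \<nu> \<bullet> X v = 0"
    and "linear N" "\<And>v. \<nu> \<bullet> N v = 0" "\<And>u v. N u \<bullet> X v = N v \<bullet> X u"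
  shows "\<exists>e k. (\<forall>i j. X (e i) \<bullet> X (e j) = (if i = j then 1 else (0::real))) \<and>
    (\<forall>i. N (e i) = - k i *\<^sub>R X ((e :: 'm \<Rightarrow> real ^ 'm) i))"
proof -
  note V = range_eq_normal_hyperplane[OF assms(1-5)]
  obtain g where g: "linear g" "\<And>v. g (X v) = v"
    using linear_injective_left_inverse[OF assms(2,3)] by (metis comp_apply id_apply)
  define f where "f = N \<circ> g"
  have "\<exists>B\<subseteq>range X. finite B \<and> card B = dim (range X) \<and> (\<forall>b\<in>B. norm b = 1) \<and>
    (\<forall>b\<in>B. \<forall>b'\<in>B. b \<noteq> b' \<longrightarrow> b \<bullet> b' = 0) \<and> (\<forall>b\<in>B. \<exists>k. f b = k *\<^sub>R b)"
  proof (rule selfadjoint_eigenbasis)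
    show "subspace (range X)" by (rule linear_subspace_image[OF assms(2) subspace_UNIV])
    show "linear f" unfolding f_def by (rule linear_compose[OF g(1) assms(6)])
    show "f ` range X \<subseteq> range X" unfolding V f_def using assms(7) by auto
    fix u v assume "u \<in> range X" "v \<in> range X"
    then show "f u \<bullet> v = u \<bullet> f v"
      using assms(8) by (auto simp: f_def g(2)) (metis inner_commute)
  qed
  moreover have "dim (range X) = CARD('m)"
    using dim_image_eq[OF assms(2), of UNIV] assms(3) by (simp add: dim_UNIV)
  ultimately obtain B where B: "B \<subseteq> range X" "finite B" "card B = CARD('m)" "\<forall>b\<in>B. norm b = 1"
    "\<forall>b\<in>B. \<forall>b'\<in>B. b \<noteq> b' \<longrightarrow> b \<bullet> b' = 0" "\<forall>b\<in>B. \<exists>k. f b = k *\<^sub>R b"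
    by auto
  obtain h where h: "bij_betw h (UNIV :: 'm set) B"
    using finite_same_card_bij[of "UNIV :: 'm set" B] B(2,3) by auto
  then have hB: "h i \<in> B" and hinj: "h i = h j \<longleftrightarrow> i = j" for i j
    by (auto simp: bij_betw_def inj_eq)
  define e where "e i = g (h i)" for i
  have Xe: "X (e i) = h i" for i
    using hB[of i] B(1) by (auto simp: e_def g(2))
  obtain k where k: "\<And>b. b \<in> B \<Longrightarrow> f b = k b *\<^sub>R b" using B(6) by metis
  have "X (e i) \<bullet> X (e j) = (if i = j then 1 else 0)" for i j
    using B(4,5) hB hinj by (auto simp: Xe norm_eq_1)
  moreover have "N (e i) = - (- k (h i)) *\<^sub>R X (e i)" for i
  proof -
    have "N (e i) = f (h i)" by (simp add: f_def e_def)
    also have "\<dots> = k (h i) *\<^sub>R X (e i)" unfolding Xe by (rule k[OF hB])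
    finally show ?thesis by simp
  qed
  ultimately show ?thesis
    by (intro exI[of _ e] exI[of _ "\<lambda>i. - k (h i)"] conjI allI)
qed

section \<open>Hypersurfaces in a chart\<close>

locale local_hypersurface =
  fixes U :: "(real ^ 'm::finite) set" and X N :: "real ^ 'm \<Rightarrow> real ^ 'n::finite"
  assumes card: "CARD('n) = CARD('m) + 1"
    and U: "open U"
    and smooth_X: "smooth_on U X" and smooth_N: "smooth_on U N"
    and immersion: "y \<in> U \<Longrightarrow> inj (\<lambda>v. dderiv v X y)"
    and unit: "y \<in> U \<Longrightarrow> norm (N y) = 1"
    and normal: "y \<in> U \<Longrightarrow> N y \<bullet> dderiv v X y = 0"
begin

lemma linear_dX: "y \<in> U \<Longrightarrow> linear (\<lambda>v. dderiv v X y)"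
  by (rule linear_dderiv[OF smooth_on_differentiable[OF smooth_X]])

lemma linear_dN: "y \<in> U \<Longrightarrow> linear (\<lambda>v. dderiv v N y)"
  by (rule linear_dderiv[OF smooth_on_differentiable[OF smooth_N]])

lemma normal_dN:
  assumes y: "y \<in> U"
  shows "N y \<bullet> dderiv v N y = 0"
proof -
  have "dderiv v (\<lambda>y. N y \<bullet> N y) y = dderiv v (\<lambda>y. 1) y"
    by (rule dderiv_cong[OF U _ y]) (use unit in \<open>simp add: norm_eq_1\<close>)
  also have "\<dots> = 0" by simp
  also have "dderiv v (\<lambda>y. N y \<bullet> N y) y = N y \<bullet> dderiv v N y + dderiv v N y \<bullet> N y"
    using smooth_on_differentiable[OF smooth_N y] by (intro dderiv_bilinear[OF bounded_bilinear_inner])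
  finally show ?thesis by (simp add: inner_commute[of "dderiv v N y"])
qed

lemma shape_symmetric:
  assumes y: "y \<in> U"
  shows "dderiv u N y \<bullet> dderiv v X y = dderiv v N y \<bullet> dderiv u X y"
proof -
  have "N y \<bullet> dderiv u (dderiv v X) y + dderiv u N y \<bullet> dderiv v X y = 0" for u v
  proof -
    have "dderiv u (\<lambda>y. N y \<bullet> dderiv v X y) y = dderiv u (\<lambda>y. 0) y"
      by (rule dderiv_cong[OF U _ y]) (use normal in simp)
    then have "dderiv u (\<lambda>y. N y \<bullet> dderiv v X y) y = 0" by simp
    moreover have "dderiv u (\<lambda>y. N y \<bullet> dderiv v X y) y =
        N y \<bullet> dderiv u (dderiv v X) y + dderiv u N y \<bullet> dderiv v X y"
      by (rule dderiv_bilinear[OF bounded_bilinear_inner smooth_on_differentiable[OF smooth_N y]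
            smooth_on_differentiable[OF smooth_on_dderiv[OF smooth_X] y]])
    ultimately show ?thesis by simp
  qed
  from this[of u v] this[of v u] show ?thesis
    using dderiv_commute[OF U smooth_X y, of u v] by simp
qed

lemma principal_frame_exists:
  assumes y: "y \<in> U"
  shows "\<exists>e k. (\<forall>i j. dderiv (e i) X y \<bullet> dderiv (e j) X y = (if i = j then 1 else (0::real))) \<and>
    (\<forall>i. dderiv (e i) N y = - k i *\<^sub>R dderiv ((e :: 'm \<Rightarrow> real ^ 'm) i) X y)"
  by (rule principal_frame_linear[OF card linear_dX[OF y] immersion[OF y] unit[OF y] normal[OF y]
      linear_dN[OF y] normal_dN[OF y] shape_symmetric[OF y]])

end

lemma local_hypersurface_chart:
  fixes A :: "('p::{t2_space, second_countable_topology}, 'm::finite) chart set"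
    and x \<xi> :: "'p \<Rightarrow> real ^ 'n::finite"
  assumes A: "smooth_atlas A" and h: "oriented_hypersurface A x \<xi>" and c: "c \<in> A"
  shows "local_hypersurface (snd c ` fst c) (x \<circ> chart_inv c) (\<xi> \<circ> chart_inv c)"
proof
  have *: "chart_inv c y \<in> fst c" "chart_deriv c f (chart_inv c y) v = dderiv v (f \<circ> chart_inv c) y"
    if "y \<in> snd c ` fst c" for y v and f :: "'p \<Rightarrow> real ^ 'n"
    using chart_inv_in[OF A c that] chart_chart_inv[OF A c that] by (simp_all add: chart_deriv_def)
  note h' = h[unfolded oriented_hypersurface_def]
  show "CARD('n) = CARD('m) + 1" using h' by simp
  show "open (snd c ` fst c)" by (rule open_chart_image[OF A c])
  show "smooth_on (snd c ` fst c) (x \<circ> chart_inv c)" "smooth_on (snd c ` fst c) (\<xi> \<circ> chart_inv c)"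
    using smooth_map_chart[OF _ c] h' by blast+
  fix y assume y: "y \<in> snd c ` fst c"
  have "inj (chart_deriv c x (chart_inv c y))" using h' c *(1)[OF y] by blast
  also have "chart_deriv c x (chart_inv c y) = (\<lambda>v. dderiv v (x \<circ> chart_inv c) y)"
    using *(2)[OF y] by blast
  finally show "inj (\<lambda>v. dderiv v (x \<circ> chart_inv c) y)" .
  show "norm ((\<xi> \<circ> chart_inv c) y) = 1" using h' by simp
  fix v
  have "\<xi> (chart_inv c y) \<bullet> chart_deriv c x (chart_inv c y) v = 0" using h' c *(1)[OF y] by blast
  then show "(\<xi> \<circ> chart_inv c) y \<bullet> dderiv v (x \<circ> chart_inv c) y = 0" using *(2)[OF y] by simp
qed

text \<open>The choice in the definition of the principal curvatures is made in an arbitrary chart, whereas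
  invariants are computed in a given one; the frame is carried over by the transition map.\<close>

lemma principal_frame_principal_curvatures:
  fixes A :: "('p::{t2_space, second_countable_topology}, 'm::finite) chart set"
    and x \<xi> :: "'p \<Rightarrow> real ^ 'n::finite"
  assumes A: "smooth_atlas A" and h: "oriented_hypersurface A x \<xi>" and c: "c \<in> A" "p \<in> fst c"
  shows "\<exists>e. principal_frame c x \<xi> p e (principal_curvatures A x \<xi> p)"
proof -
  have y: "snd c p \<in> snd c ` fst c" using c(2) by blast
  have "\<exists>e k. principal_frame c x \<xi> p e k"
    using local_hypersurface.principal_frame_exists[OF local_hypersurface_chart[OF A h c(1)] y]
    unfolding principal_frame_def chart_deriv_def .
  then have "\<exists>k. \<exists>c\<in>A. p \<in> fst c \<and> (\<exists>e. principal_frame c x \<xi> p e k)" using c by blast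
  then have "\<exists>c\<in>A. p \<in> fst c \<and> (\<exists>e. principal_frame c x \<xi> p e (principal_curvatures A x \<xi> p))"
    unfolding principal_curvatures_def by (rule someI_ex)
  then obtain d e' where d: "d \<in> A" "p \<in> fst d"
    and e': "principal_frame d x \<xi> p e' (principal_curvatures A x \<xi> p)" by blast
  \<comment> \<open>The frame may come from another chart \<open>d\<close>.\<close>
  define e'' where "e'' i = dderiv (e' i) (snd c \<circ> chart_inv d) (snd d p)" for i
  have "chart_deriv d f p (e' i) = chart_deriv c f p (e'' i)" if "smooth_map A f" for i and f :: "'p \<Rightarrow> real ^ 'n"
    unfolding e''_def using chart_deriv_change[OF A c d smooth_on_differentiable[OF smooth_map_chart[OF that c(1)] y]] .
  then have "principal_frame c x \<xi> p e'' (principal_curvatures A x \<xi> p)"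
    using e' h unfolding principal_frame_def oriented_hypersurface_def by simp
  then show ?thesis by blast
qed


section \<open>Radii of curvature\<close>

text \<open>Pairing with the family shows that it is linearly independent, and it has as many members as the
  dimension.\<close>

lemma orthonormal_family_expansion:
  fixes e :: "'m::finite \<Rightarrow> real ^ 'm"
  assumes lin: "\<And>u. linear (\<lambda>v. G v u)" and orth: "\<And>i j. G (e i) (e j) = (if i = j then 1 else (0::real))"
  shows "v = (\<Sum>i\<in>UNIV. G v (e i) *\<^sub>R e i)"
proof -
  define \<phi> where "\<phi> a = (\<Sum>i\<in>UNIV. a $ i *\<^sub>R e i)" for a :: "real ^ 'm"
  have \<phi>: "linear \<phi>"
    unfolding \<phi>_def by (intro linear_compose_sum ballI linearI) (auto simp: algebra_simps)
  have G: "G (\<phi> a) (e j) = a $ j" for a j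
  proof -
    have "G (\<phi> a) (e j) = (\<Sum>i\<in>UNIV. a $ i * G (e i) (e j))"
      unfolding \<phi>_def by (simp add: linear_sum[OF lin] linear_cmul[OF lin])
    also have "\<dots> = (\<Sum>i\<in>UNIV. if i = j then a $ i else 0)"
      by (intro sum.cong) (simp_all add: orth)
    finally show ?thesis by simp
  qed
  have "inj \<phi>"
  proof (rule injI)
    fix a b assume "\<phi> a = \<phi> b"
    then have "a $ j = b $ j" for j using G[of a j] G[of b j] by simp
    then show "a = b" by (simp add: vec_eq_iff)
  qed
  then obtain a where a: "v = \<phi> a" using linear_injective_imp_surjective[OF \<phi>] by (metis surjD)
  then show ?thesis using G[of a] by (simp add: \<phi>_def)
qed

lemma axis_expansion: "(\<Sum>i\<in>UNIV. a $ i *\<^sub>R axis i 1) = (a :: real ^ 'm::finite)"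
  using basis_expansion[of a] by (simp only: scalar_mult_eq_scaleR)

text \<open>Traces depend smoothly on the matrix, although single eigenvalues need not.\<close>

lemma trace_eigenbasis:
  fixes W :: "real ^ 'm::finite ^ 'm" and e :: "'m \<Rightarrow> real ^ 'm"
  assumes inv: "invertible (\<chi> r i. e i $ r)" and eig: "\<And>i. W *v e i = \<mu> i *\<^sub>R e i"
  shows "trace W = (\<Sum>i\<in>UNIV. \<mu> i)"
proof -
  define E :: "real ^ 'm ^ 'm" where "E = (\<chi> r i. e i $ r)"
  define D :: "real ^ 'm ^ 'm" where "D = (\<chi> i j. if i = j then \<mu> i else 0)"
  have WE: "W ** E = E ** D"
  proof -
    have "(W ** E) $ r $ i = (E ** D) $ r $ i" for r i
    proof -
      have "(W ** E) $ r $ i = (W *v e i) $ r"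
        by (simp add: matrix_matrix_mult_def matrix_vector_mult_def E_def)
      also have "\<dots> = \<mu> i * e i $ r" by (simp add: eig)
      also have "\<dots> = (E ** D) $ r $ i"
        by (simp add: matrix_matrix_mult_def E_def D_def if_distrib cong: if_cong)
      finally show ?thesis .
    qed
    then show ?thesis by (simp add: vec_eq_iff)
  qed
  obtain E' where E': "E ** E' = mat 1" "E' ** E = mat 1"
    using inv unfolding invertible_def E_def[symmetric] by blast
  have "trace W = trace (W ** (E ** E'))" by (simp add: E')
  also have "\<dots> = trace ((E ** D) ** E')" by (simp only: matrix_mul_assoc WE)
  also have "\<dots> = trace (E' ** (E ** D))" by (rule trace_mul_sym)
  also have "\<dots> = trace D" by (simp only: matrix_mul_assoc E' matrix_mul_lid)
  also have "\<dots> = (\<Sum>i\<in>UNIV. \<mu> i)" by (simp add: trace_def D_def)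
  finally show ?thesis .
qed

lemma trace_square_eigenbasis:
  fixes W :: "real ^ 'm::finite ^ 'm" and e :: "'m \<Rightarrow> real ^ 'm"
  assumes "invertible (\<chi> r i. e i $ r)" "\<And>i. W *v e i = \<mu> i *\<^sub>R e i"
  shows "trace (W ** W) = (\<Sum>i\<in>UNIV. (\<mu> i)\<^sup>2)"
  by (rule trace_eigenbasis[OF assms(1)])
     (simp add: matrix_vector_mul_assoc[symmetric] assms(2) matrix_vector_mult_scaleR power2_eq_square)

lemma smooth_on_sum:
  assumes "open S" "finite I" "\<And>i. i \<in> I \<Longrightarrow> smooth_on S (f i)"
  shows "smooth_on S (\<lambda>y. \<Sum>i\<in>I. f i y)"
  using assms(2,3) by (induction I) (simp_all add: smooth_on_const smooth_on_add[OF assms(1)])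

lemma smooth_on_mult:
  fixes f g :: "'a::euclidean_space \<Rightarrow> real"
  shows "open S \<Longrightarrow> smooth_on S f \<Longrightarrow> smooth_on S g \<Longrightarrow> smooth_on S (\<lambda>y. f y * g y)"
  by (rule smooth_on_bilinear[OF bounded_bilinear_mult])

lemma smooth_on_prod:
  fixes f :: "'i \<Rightarrow> 'a::euclidean_space \<Rightarrow> real"
  assumes "open S" "finite I" "\<And>i. i \<in> I \<Longrightarrow> smooth_on S (f i)"
  shows "smooth_on S (\<lambda>y. \<Prod>i\<in>I. f i y)"
  using assms(2,3) by (induction I) (simp_all add: smooth_on_const smooth_on_mult[OF assms(1)])

lemma smooth_on_det:
  fixes M :: "'a::euclidean_space \<Rightarrow> real ^ 'm::finite ^ 'm"
  assumes "open S" "\<And>i j. smooth_on S (\<lambda>y. M y $ i $ j)"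
  shows "smooth_on S (\<lambda>y. det (M y))"
  unfolding det_def
  by (intro smooth_on_sum smooth_on_mult smooth_on_prod smooth_on_const assms finite_permutations) simp_all

context local_hypersurface
begin

definition third_form :: "real ^ 'm \<Rightarrow> real ^ 'm ^ 'm" where
  "third_form y = (\<chi> i j. dderiv (axis i 1) N y \<bullet> dderiv (axis j 1) N y)"

text \<open>The solution \<open>W\<close> of \<open>III W = II\<close> given by Cramer's rule, where \<open>II = dN \<bullet> dX\<close>. Its
  eigenvalues are the negatives of the radii of curvature.\<close>

definition radius_matrix :: "real ^ 'm \<Rightarrow> real ^ 'm ^ 'm" where
  "radius_matrix y = (\<chi> k l. det (\<chi> i j. if j = k then dderiv (axis i 1) N y \<bullet> dderiv (axis l 1) X y
     else third_form y $ i $ j) / det (third_form y))"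

lemma third_form_mult:
  assumes y: "y \<in> U"
  shows "(third_form y *v b) $ i = dderiv (axis i 1) N y \<bullet> dderiv b N y"
proof -
  have "dderiv b N y = dderiv (\<Sum>j\<in>UNIV. b $ j *\<^sub>R axis j 1) N y"
    by (simp only: axis_expansion)
  also have "\<dots> = (\<Sum>j\<in>UNIV. b $ j *\<^sub>R dderiv (axis j 1) N y)"
    by (simp add: linear_sum[OF linear_dN[OF y]] linear_cmul[OF linear_dN[OF y]])
  finally show ?thesis
    by (simp add: third_form_def matrix_vector_mult_def inner_sum_right mult.commute)
qed

lemma det_third_form_nonzero:
  assumes y: "y \<in> U" and inj: "inj (\<lambda>v. dderiv v N y)"
  shows "det (third_form y) \<noteq> 0"
proof -
  have "a = 0" if "third_form y *v a = 0" for a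
  proof -
    have "dderiv (axis i 1) N y \<bullet> dderiv a N y = 0" for i
      using third_form_mult[OF y, of a i] that by simp
    moreover have "dderiv a N y = (\<Sum>j\<in>UNIV. a $ j *\<^sub>R dderiv (axis j 1) N y)"
      using linear_sum[OF linear_dN[OF y], of "\<lambda>j. a $ j *\<^sub>R axis j 1" UNIV]
      by (simp only: axis_expansion linear_cmul[OF linear_dN[OF y]])
    ultimately have "dderiv a N y \<bullet> dderiv a N y = 0"
      by (metis (no_types, lifting) inner_scaleR_left inner_sum_left mult_zero_right sum.neutral)
    then have "dderiv a N y = dderiv 0 N y" by (simp add: linear_0[OF linear_dN[OF y]])
    then show "a = 0" using inj by (simp add: inj_eq)
  qed
  then have "\<exists>B. B ** third_form y = mat 1" by (simp add: matrix_left_invertible_ker)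
  then show ?thesis by (simp add: invertible_left_inverse[symmetric] invertible_det_nz)
qed

lemma radius_matrix_eigenvector:
  assumes y: "y \<in> U" and inj: "inj (\<lambda>v. dderiv v N y)" and v: "dderiv v X y = - s *\<^sub>R dderiv v N y"
  shows "radius_matrix y *v v = - s *\<^sub>R v"
proof -
  note nz = det_third_form_nonzero[OF y inj]
  have col: "third_form y *v (\<chi> k. radius_matrix y $ k $ l) = (\<chi> i. dderiv (axis i 1) N y \<bullet> dderiv (axis l 1) X y)" for l
    unfolding cramer[OF nz] by (simp add: radius_matrix_def cong: if_cong)
  have "(third_form y *v (radius_matrix y *v v)) = third_form y *v (- s *\<^sub>R v)"
  proof -
    have "(third_form y *v (radius_matrix y *v v)) $ i = (third_form y *v (- s *\<^sub>R v)) $ i" for i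
    proof -
      have "(radius_matrix y *v v) = (\<Sum>l\<in>UNIV. v $ l *\<^sub>R (\<chi> k. radius_matrix y $ k $ l))"
        by (simp add: vec_eq_iff matrix_vector_mult_def mult.commute)
      then have "(third_form y *v (radius_matrix y *v v)) =
          (\<Sum>l\<in>UNIV. v $ l *\<^sub>R (third_form y *v (\<chi> k. radius_matrix y $ k $ l)))"
        by (simp add: linear_sum[OF matrix_vector_mul_linear] matrix_vector_mult_scaleR)
      then have "(third_form y *v (radius_matrix y *v v)) $ i =
          (\<Sum>l\<in>UNIV. v $ l * (dderiv (axis i 1) N y \<bullet> dderiv (axis l 1) X y))"
        by (simp add: col)
      also have "\<dots> = dderiv (axis i 1) N y \<bullet> dderiv (\<Sum>l\<in>UNIV. v $ l *\<^sub>R axis l 1) X y"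
        by (simp add: linear_sum[OF linear_dX[OF y]] linear_cmul[OF linear_dX[OF y]] inner_sum_right)
      also have "\<dots> = dderiv (axis i 1) N y \<bullet> dderiv v X y"
        by (simp only: axis_expansion)
      also have "\<dots> = dderiv (axis i 1) N y \<bullet> dderiv (- s *\<^sub>R v) N y"
        unfolding v linear_cmul[OF linear_dN[OF y]] ..
      also have "\<dots> = (third_form y *v (- s *\<^sub>R v)) $ i"
        by (simp only: third_form_mult[OF y])
      finally show ?thesis .
    qed
    then show ?thesis by (simp add: vec_eq_iff)
  qed
  moreover have "inj ((*v) (third_form y))"
    using nz by (simp add: inj_matrix_vector_mult invertible_det_nz)
  ultimately show ?thesis by (simp add: inj_eq)
qed

lemma smooth_radius_matrix:
  assumes inj: "\<And>y. y \<in> U \<Longrightarrow> inj (\<lambda>v. dderiv v N y)"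
  shows "smooth_on U (\<lambda>y. radius_matrix y $ k $ l)"
proof -
  have III: "smooth_on U (\<lambda>y. third_form y $ i $ j)" for i j
    unfolding third_form_def by (simp add: smooth_on_inner[OF U] smooth_on_dderiv smooth_N)
  have II: "smooth_on U (\<lambda>y. dderiv (axis i 1) N y \<bullet> dderiv (axis j 1) X y)" for i j
    by (simp add: smooth_on_inner[OF U] smooth_on_dderiv smooth_N smooth_X)
  have "smooth_on U (\<lambda>y. det (\<chi> i j. if j = k then dderiv (axis i 1) N y \<bullet> dderiv (axis l 1) X y
     else third_form y $ i $ j) * inverse (det (third_form y)))"
  proof (intro smooth_on_mult[OF U] smooth_on_inverse[OF U] smooth_on_det[OF U])
    fix i j
    show "smooth_on U (\<lambda>y. (\<chi> i j. if j = k then dderiv (axis i 1) N y \<bullet> dderiv (axis l 1) X y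
       else third_form y $ i $ j) $ i $ j)"
      by (cases "j = k") (simp_all add: II III)
  qed (use III det_third_form_nonzero inj in simp_all)
  then show ?thesis by (simp add: radius_matrix_def divide_inverse)
qed

end

lemma invertible_orthonormal_family:
  fixes e :: "'m::finite \<Rightarrow> real ^ 'm"
  assumes "\<And>u. linear (\<lambda>v. G v u)" "\<And>i j. G (e i) (e j) = (if i = j then 1 else (0::real))"
  shows "invertible (\<chi> r i. e i $ r)"
proof -
  have "(\<chi> r i. e i $ r) *v (\<chi> i. G v (e i)) = v" for v
  proof -
    have "(\<chi> r i. e i $ r) *v (\<chi> i. G v (e i)) = (\<Sum>i\<in>UNIV. G v (e i) *\<^sub>R e i)"
      by (simp add: vec_eq_iff matrix_vector_mult_def mult.commute)
    then show ?thesis using orthonormal_family_expansion[of G e v, OF assms] by simp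
  qed
  then have "surj ((*v) (\<chi> r i. e i $ r))" by (rule surjI)
  then show ?thesis by (simp add: matrix_right_invertible_surjective[symmetric] invertible_right_inverse)
qed

section \<open>Laguerre invariants in a chart\<close>

locale laguerre_hypersurface =
  fixes A :: "('p::{t2_space, second_countable_topology}, 'm::finite) chart set"
    and x \<xi> :: "'p \<Rightarrow> real ^ 'n::finite"
  assumes atlas: "smooth_atlas A"
    and hypersurface: "oriented_hypersurface A x \<xi>"
    and umbilical_free: "umbilical_free A x \<xi>"
    and nonzero_curvatures: "nonzero_principal_curvatures A x \<xi>"
begin

abbreviation "radius \<equiv> curvature_radius A x \<xi>"
abbreviation "mean \<equiv> mean_radius A x \<xi>"
abbreviation "rho \<equiv> laguerre_rho A x \<xi>"

lemma card_n: "CARD('n) = CARD('m) + 1"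
  using hypersurface by (simp add: oriented_hypersurface_def)

lemma smooth_x: "smooth_map A x" and smooth_\<xi>: "smooth_map A \<xi>"
  using hypersurface by (simp_all add: oriented_hypersurface_def)

lemma norm_\<xi>: "norm (\<xi> p) = 1"
  using hypersurface by (simp add: oriented_hypersurface_def)

lemma local_in_chart: "c \<in> A \<Longrightarrow> local_hypersurface (snd c ` fst c) (x \<circ> chart_inv c) (\<xi> \<circ> chart_inv c)"
  by (rule local_hypersurface_chart[OF atlas hypersurface])

context
  fixes c p
  assumes c: "c \<in> A" and p: "p \<in> fst c"
begin

interpretation H: local_hypersurface "snd c ` fst c" "x \<circ> chart_inv c" "\<xi> \<circ> chart_inv c"
  by (rule local_in_chart[OF c])

lemma chart_point: "snd c p \<in> snd c ` fst c" using p by blast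

lemma chart_inv_point: "chart_inv c (snd c p) = p" by (rule chart_inv_chart[OF atlas c p])

lemma linear_dx: "linear (chart_deriv c x p)"
  using H.linear_dX[OF chart_point] by (simp add: chart_deriv_def[abs_def])

lemma linear_d\<xi>: "linear (chart_deriv c \<xi> p)"
  using H.linear_dN[OF chart_point] by (simp add: chart_deriv_def[abs_def])

lemma \<xi>_dx: "\<xi> p \<bullet> chart_deriv c x p v = 0"
  using H.normal[OF chart_point, of v] by (simp add: chart_deriv_def chart_inv_point)

lemma \<xi>_d\<xi>: "\<xi> p \<bullet> chart_deriv c \<xi> p v = 0"
  using H.normal_dN[OF chart_point, of v] by (simp add: chart_deriv_def chart_inv_point)

lemma d\<xi>_dx_symmetric: "chart_deriv c \<xi> p u \<bullet> chart_deriv c x p v = chart_deriv c \<xi> p v \<bullet> chart_deriv c x p u"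
  using H.shape_symmetric[OF chart_point, of u v] by (simp add: chart_deriv_def)

lemma linear_inner_dx: "linear (\<lambda>v. chart_deriv c x p v \<bullet> w)"
  using linear_compose[OF linear_dx bounded_linear.linear[OF bounded_linear_inner_left[of w]]] by (simp add: o_def)

lemma linear_inner_d\<xi>: "linear (\<lambda>v. chart_deriv c \<xi> p v \<bullet> w)"
  using linear_compose[OF linear_d\<xi> bounded_linear.linear[OF bounded_linear_inner_left[of w]]] by (simp add: o_def)

lemma radius_frame_exists:
  "\<exists>e. (\<forall>i j. chart_deriv c x p (e i) \<bullet> chart_deriv c x p (e j) = (if i = j then 1 else 0)) \<and>
    (\<forall>i. chart_deriv c x p (e i) = - radius p i *\<^sub>R chart_deriv c \<xi> p (e i))"
proof -
  obtain e where e: "principal_frame c x \<xi> p e (principal_curvatures A x \<xi> p)"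
    using principal_frame_principal_curvatures[OF atlas hypersurface c p] by blast
  have "chart_deriv c x p (e i) = - radius p i *\<^sub>R chart_deriv c \<xi> p (e i)" for i
    using e nonzero_curvatures
    by (simp add: principal_frame_def curvature_radius_def nonzero_principal_curvatures_def)
  then show ?thesis using e unfolding principal_frame_def by blast
qed

text \<open>Nonvanishing of the principal curvatures makes \<open>\<xi>\<close> an immersion into the sphere.\<close>

lemma inj_d\<xi>: "inj (chart_deriv c \<xi> p)"
proof -
  obtain e where e: "\<And>i j. chart_deriv c x p (e i) \<bullet> chart_deriv c x p (e j) = (if i = j then 1 else 0)"
    and r: "\<And>i. chart_deriv c x p (e i) = - radius p i *\<^sub>R chart_deriv c \<xi> p (e i)"
    using radius_frame_exists by blast
  have "v = 0" if v: "chart_deriv c \<xi> p v = 0" for v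
  proof -
    have "chart_deriv c x p v \<bullet> chart_deriv c x p (e i) = 0" for i
    proof -
      have "chart_deriv c x p v \<bullet> chart_deriv c x p (e i) = - radius p i * (chart_deriv c \<xi> p (e i) \<bullet> chart_deriv c x p v)"
        by (subst r[of i]) (simp add: inner_commute)
      also have "\<dots> = 0" unfolding d\<xi>_dx_symmetric[of "e i" v] v by simp
      finally show ?thesis .
    qed
    then show ?thesis
      using orthonormal_family_expansion[of "\<lambda>v u. chart_deriv c x p v \<bullet> chart_deriv c x p u" e v, OF linear_inner_dx e]
      by simp
  qed
  then show ?thesis using linear_injective_0[OF linear_d\<xi>] by blast
qed

lemma range_d\<xi>: "range (chart_deriv c \<xi> p) = {w. \<xi> p \<bullet> w = 0}"
  by (rule range_eq_normal_hyperplane[OF card_n linear_d\<xi> inj_d\<xi> norm_\<xi> \<xi>_d\<xi>])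

text \<open>Symmetric functions of the radii of curvature may be computed from any basis of vectors
  that \<open>dx\<close> and \<open>d\<xi>\<close> map to parallel vectors, because they are traces.\<close>

lemma trace_radius_matrix:
  fixes e :: "'m \<Rightarrow> real ^ 'm"
  assumes "invertible (\<chi> r i. e i $ r)" "\<And>i. chart_deriv c x p (e i) = - s i *\<^sub>R chart_deriv c \<xi> p (e i)"
  shows "trace (H.radius_matrix (snd c p)) = - (\<Sum>i\<in>UNIV. s i)"
    and "trace (H.radius_matrix (snd c p) ** H.radius_matrix (snd c p)) = (\<Sum>i\<in>UNIV. (s i)\<^sup>2)"
proof -
  have "H.radius_matrix (snd c p) *v e i = - s i *\<^sub>R e i" for i
    using H.radius_matrix_eigenvector[OF chart_point, of "e i" "s i"] inj_d\<xi> assms(2)[of i]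
    by (simp add: chart_deriv_def[abs_def])
  from trace_eigenbasis[OF assms(1) this] trace_square_eigenbasis[OF assms(1) this]
  show "trace (H.radius_matrix (snd c p)) = - (\<Sum>i\<in>UNIV. s i)"
    "trace (H.radius_matrix (snd c p) ** H.radius_matrix (snd c p)) = (\<Sum>i\<in>UNIV. (s i)\<^sup>2)"
    by (simp_all add: sum_negf)
qed

lemma radius_traces:
  shows "trace (H.radius_matrix (snd c p)) = - (\<Sum>i\<in>UNIV. radius p i)"
    and "trace (H.radius_matrix (snd c p) ** H.radius_matrix (snd c p)) = (\<Sum>i\<in>UNIV. (radius p i)\<^sup>2)"
proof -
  obtain e where e: "\<And>i j. chart_deriv c x p (e i) \<bullet> chart_deriv c x p (e j) = (if i = j then 1 else 0)"
    and r: "\<And>i. chart_deriv c x p (e i) = - radius p i *\<^sub>R chart_deriv c \<xi> p (e i)"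
    using radius_frame_exists by blast
  have "invertible (\<chi> r i. e i $ r)"
    by (rule invertible_orthonormal_family[of "\<lambda>v u. chart_deriv c x p v \<bullet> chart_deriv c x p u", OF linear_inner_dx e])
  from trace_radius_matrix[OF this r]
  show "trace (H.radius_matrix (snd c p)) = - (\<Sum>i\<in>UNIV. radius p i)"
    "trace (H.radius_matrix (snd c p) ** H.radius_matrix (snd c p)) = (\<Sum>i\<in>UNIV. (radius p i)\<^sup>2)" .
qed

lemma radius_sums:
  fixes e :: "'m \<Rightarrow> real ^ 'm"
  assumes "invertible (\<chi> r i. e i $ r)" "\<And>i. chart_deriv c x p (e i) = - s i *\<^sub>R chart_deriv c \<xi> p (e i)"
  shows "(\<Sum>i\<in>UNIV. radius p i) = (\<Sum>i\<in>UNIV. s i)" "(\<Sum>i\<in>UNIV. (radius p i)\<^sup>2) = (\<Sum>i\<in>UNIV. (s i)\<^sup>2)"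
  using trace_radius_matrix[OF assms] radius_traces by simp_all

end

lemma mean_eq: "mean p = (\<Sum>i\<in>UNIV. radius p i) / CARD('m)"
  by (simp add: mean_radius_def card_n)

lemma rho_eq: "rho p = sqrt ((\<Sum>i\<in>UNIV. (radius p i)\<^sup>2) - CARD('m) * (mean p)\<^sup>2)"
proof -
  have "(\<Sum>i\<in>UNIV. (radius p i - mean p)\<^sup>2) =
      (\<Sum>i\<in>UNIV. (radius p i)\<^sup>2) - 2 * mean p * (\<Sum>i\<in>UNIV. radius p i) + CARD('m) * (mean p)\<^sup>2"
    by (simp add: power2_diff sum.distrib sum_subtractf sum_distrib_left mult_ac)
  also have "(\<Sum>i\<in>UNIV. radius p i) = CARD('m) * mean p" by (simp add: mean_eq)
  finally show ?thesis by (simp add: laguerre_rho_def power2_eq_square algebra_simps)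
qed

lemma rho_pos: "rho p > 0"
proof -
  obtain i j where "principal_curvatures A x \<xi> p i \<noteq> principal_curvatures A x \<xi> p j"
    using umbilical_free unfolding umbilical_free_def by blast
  then have "radius p i \<noteq> radius p j"
    using nonzero_curvatures by (simp add: curvature_radius_def nonzero_principal_curvatures_def)
  then obtain k where "radius p k \<noteq> mean p" by metis
  then have "0 < (\<Sum>i\<in>UNIV. (radius p i - mean p)\<^sup>2)"
    by (intro sum_pos2[of _ k]) auto
  then show ?thesis by (simp add: laguerre_rho_def)
qed

lemma smooth_mean_rho:
  assumes c: "c \<in> A"
  shows "smooth_on (snd c ` fst c) (mean \<circ> chart_inv c)" "smooth_on (snd c ` fst c) (rho \<circ> chart_inv c)"
proof -
  let ?U = "snd c ` fst c"
  interpret H: local_hypersurface ?U "x \<circ> chart_inv c" "\<xi> \<circ> chart_inv c"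
    by (rule local_in_chart[OF c])
  have inj: "inj (\<lambda>v. dderiv v (\<xi> \<circ> chart_inv c) y)" if "y \<in> ?U" for y
    using inj_d\<xi>[OF c chart_inv_in[OF atlas c that]] chart_chart_inv[OF atlas c that]
    by (simp add: chart_deriv_def[abs_def])
  note W = H.smooth_radius_matrix[OF inj]
  have tr: "smooth_on ?U (\<lambda>y. trace (H.radius_matrix y))"
    "smooth_on ?U (\<lambda>y. trace (H.radius_matrix y ** H.radius_matrix y))"
    unfolding trace_def matrix_matrix_mult_def
    by (simp_all add: W smooth_on_sum[OF H.U] smooth_on_mult[OF H.U])
  have m: "smooth_on ?U (\<lambda>y. - (1 / CARD('m)) * trace (H.radius_matrix y))"
    by (intro smooth_on_mult[OF H.U] smooth_on_const tr)
  have mean: "mean (chart_inv c y) = - (1 / CARD('m)) * trace (H.radius_matrix y)" if "y \<in> ?U" for y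
    using radius_traces(1)[OF c chart_inv_in[OF atlas c that]] chart_chart_inv[OF atlas c that]
    by (simp add: mean_eq)
  then show "smooth_on ?U (mean \<circ> chart_inv c)"
    using m smooth_on_cong[OF H.U, of "mean \<circ> chart_inv c" "\<lambda>y. - (1 / CARD('m)) * trace (H.radius_matrix y)"] by simp
  let ?f = "\<lambda>y. trace (H.radius_matrix y ** H.radius_matrix y) -
    CARD('m) * ((- (1 / CARD('m)) * trace (H.radius_matrix y)) * (- (1 / CARD('m)) * trace (H.radius_matrix y)))"
  have f: "rho (chart_inv c y) = sqrt (?f y)" if "y \<in> ?U" for y
    using radius_traces(2)[OF c chart_inv_in[OF atlas c that]] chart_chart_inv[OF atlas c that] mean[OF that]
    by (simp add: rho_eq power2_eq_square)
  have "smooth_on ?U (\<lambda>y. sqrt (?f y))"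
  proof (rule smooth_on_sqrt[OF H.U])
    show "smooth_on ?U ?f"
      by (intro smooth_on_diff[OF H.U] tr smooth_on_mult[OF H.U] m smooth_on_const)
    show "?f y > 0" if "y \<in> ?U" for y
      using rho_pos[of "chart_inv c y"] unfolding f[OF that] by (rule real_sqrt_gt_0_iff[THEN iffD1])
  qed
  then show "smooth_on ?U (rho \<circ> chart_inv c)"
    using f smooth_on_cong[OF H.U, of "rho \<circ> chart_inv c" "\<lambda>y. sqrt (?f y)"] by simp
qed

lemma gamma_has_derivative:
  assumes c: "c \<in> A" and p: "p \<in> fst c"
  shows "((\<lambda>y. gamma1 (x (chart_inv c y), \<xi> (chart_inv c y))) has_derivative
      (\<lambda>v. (x p \<bullet> chart_deriv c x p v, - (x p \<bullet> chart_deriv c x p v), chart_deriv c x p v, 0))) (at (snd c p))"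
    and "((\<lambda>y. gamma2 (x (chart_inv c y), \<xi> (chart_inv c y))) has_derivative
      (\<lambda>v. (x p \<bullet> chart_deriv c \<xi> p v, - (x p \<bullet> chart_deriv c \<xi> p v), chart_deriv c \<xi> p v, 0))) (at (snd c p))"
proof -
  note y = chart_point[OF c p]
  have X: "((\<lambda>y. x (chart_inv c y)) has_derivative chart_deriv c x p) (at (snd c p))"
    using smooth_on_has_derivative[OF smooth_map_chart[OF smooth_x c] y] by (simp add: chart_deriv_def[abs_def] o_def)
  have N: "((\<lambda>y. \<xi> (chart_inv c y)) has_derivative chart_deriv c \<xi> p) (at (snd c p))"
    using smooth_on_has_derivative[OF smooth_map_chart[OF smooth_\<xi> c] y] by (simp add: chart_deriv_def[abs_def] o_def)
  note inv = chart_inv_point[OF c p]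
  have a: "((\<lambda>y. x (chart_inv c y) \<bullet> x (chart_inv c y) / 2) has_derivative (\<lambda>v. x p \<bullet> chart_deriv c x p v)) (at (snd c p))"
    by (rule derivative_eq_intros X refl | simp add: inv inner_commute)+
  have b: "((\<lambda>y. x (chart_inv c y) \<bullet> \<xi> (chart_inv c y)) has_derivative (\<lambda>v. x p \<bullet> chart_deriv c \<xi> p v)) (at (snd c p))"
    by (rule derivative_eq_intros X N refl | simp add: inv \<xi>_dx[OF c p] inner_commute[of _ "\<xi> p"])+
  have 1: "((\<lambda>y. (1/2 + x (chart_inv c y) \<bullet> x (chart_inv c y) / 2, 1/2 - x (chart_inv c y) \<bullet> x (chart_inv c y) / 2, x (chart_inv c y), 0::real)) has_derivative
      (\<lambda>v. (0 + x p \<bullet> chart_deriv c x p v, 0 - (x p \<bullet> chart_deriv c x p v), chart_deriv c x p v, 0))) (at (snd c p))"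
    by (intro has_derivative_Pair has_derivative_add has_derivative_diff has_derivative_const a X)
  show "((\<lambda>y. gamma1 (x (chart_inv c y), \<xi> (chart_inv c y))) has_derivative
      (\<lambda>v. (x p \<bullet> chart_deriv c x p v, - (x p \<bullet> chart_deriv c x p v), chart_deriv c x p v, 0))) (at (snd c p))"
    using 1 by (simp add: gamma1_def dot_square_norm add_divide_distrib diff_divide_distrib)
  have 2: "((\<lambda>y. (x (chart_inv c y) \<bullet> \<xi> (chart_inv c y), - (x (chart_inv c y) \<bullet> \<xi> (chart_inv c y)), \<xi> (chart_inv c y), 1::real)) has_derivative
      (\<lambda>v. (x p \<bullet> chart_deriv c \<xi> p v, - (x p \<bullet> chart_deriv c \<xi> p v), chart_deriv c \<xi> p v, 0))) (at (snd c p))"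
    by (intro has_derivative_Pair has_derivative_minus has_derivative_const b N)
  then show "((\<lambda>y. gamma2 (x (chart_inv c y), \<xi> (chart_inv c y))) has_derivative
      (\<lambda>v. (x p \<bullet> chart_deriv c \<xi> p v, - (x p \<bullet> chart_deriv c \<xi> p v), chart_deriv c \<xi> p v, 0))) (at (snd c p))"
    by (simp add: gamma2_def)
qed

lemma position_has_derivative:
  assumes c: "c \<in> A" and p: "p \<in> fst c"
  shows "((laguerre_position A x \<xi> \<circ> chart_inv c) has_derivative
    (\<lambda>v. rho p *\<^sub>R (x p \<bullet> chart_deriv c \<xi> p v, - (x p \<bullet> chart_deriv c \<xi> p v), chart_deriv c \<xi> p v, 0) +
      chart_deriv c rho p v *\<^sub>R gamma2 (x p, \<xi> p))) (at (snd c p))"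
proof -
  have r: "((\<lambda>y. rho (chart_inv c y)) has_derivative chart_deriv c rho p) (at (snd c p))"
    using smooth_on_has_derivative[OF smooth_mean_rho(2)[OF c] chart_point[OF c p]] by (simp add: chart_deriv_def[abs_def] o_def)
  show ?thesis
    using has_derivative_scaleR[OF r gamma_has_derivative(2)[OF c p]]
    by (simp only: laguerre_position_def o_def chart_inv_point[OF c p])
qed

lemma gauss_map_has_derivative:
  assumes c: "c \<in> A" and p: "p \<in> fst c"
  shows "((laguerre_gauss_map A x \<xi> \<circ> chart_inv c) has_derivative
    (\<lambda>v. (x p \<bullet> chart_deriv c x p v, - (x p \<bullet> chart_deriv c x p v), chart_deriv c x p v, 0) +
      (mean p *\<^sub>R (x p \<bullet> chart_deriv c \<xi> p v, - (x p \<bullet> chart_deriv c \<xi> p v), chart_deriv c \<xi> p v, 0) +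
      chart_deriv c mean p v *\<^sub>R gamma2 (x p, \<xi> p)))) (at (snd c p))"
proof -
  have r: "((\<lambda>y. mean (chart_inv c y)) has_derivative chart_deriv c mean p) (at (snd c p))"
    using smooth_on_has_derivative[OF smooth_mean_rho(1)[OF c] chart_point[OF c p]] by (simp add: chart_deriv_def[abs_def] o_def)
  show ?thesis
    using has_derivative_add[OF gamma_has_derivative(1)[OF c p] has_derivative_scaleR[OF r gamma_has_derivative(2)[OF c p]]]
    by (simp only: laguerre_gauss_map_def o_def chart_inv_point[OF c p])
qed

lemma chart_deriv_position:
  assumes "c \<in> A" "p \<in> fst c"
  shows "chart_deriv c (laguerre_position A x \<xi>) p v =
    rho p *\<^sub>R (x p \<bullet> chart_deriv c \<xi> p v, - (x p \<bullet> chart_deriv c \<xi> p v), chart_deriv c \<xi> p v, 0) +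
      chart_deriv c rho p v *\<^sub>R gamma2 (x p, \<xi> p)"
  unfolding chart_deriv_def[of c "laguerre_position A x \<xi>"] by (rule dderiv_eqI[OF position_has_derivative[OF assms]])

lemma chart_deriv_gauss_map:
  assumes "c \<in> A" "p \<in> fst c"
  shows "chart_deriv c (laguerre_gauss_map A x \<xi>) p v =
    (x p \<bullet> chart_deriv c x p v, - (x p \<bullet> chart_deriv c x p v), chart_deriv c x p v, 0) +
      (mean p *\<^sub>R (x p \<bullet> chart_deriv c \<xi> p v, - (x p \<bullet> chart_deriv c \<xi> p v), chart_deriv c \<xi> p v, 0) +
      chart_deriv c mean p v *\<^sub>R gamma2 (x p, \<xi> p))"
  unfolding chart_deriv_def[of c "laguerre_gauss_map A x \<xi>"] by (rule dderiv_eqI[OF gauss_map_has_derivative[OF assms]])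

lemma laguerre_metric_eq:
  assumes c: "c \<in> A" and p: "p \<in> fst c"
  shows "laguerre_metric A x \<xi> c p v w = (rho p)\<^sup>2 * (chart_deriv c \<xi> p v \<bullet> chart_deriv c \<xi> p w)"
proof -
  have sw: "chart_deriv c \<xi> p v \<bullet> \<xi> p = 0" "chart_deriv c x p v \<bullet> \<xi> p = 0" for v
    unfolding inner_commute[of _ "\<xi> p"] by (rule \<xi>_d\<xi>[OF c p] \<xi>_dx[OF c p])+
  have "\<xi> p \<bullet> \<xi> p = 1" using norm_\<xi>[of p] by (simp add: norm_eq_1)
  then show ?thesis
    unfolding laguerre_metric_def chart_deriv_position[OF c p]
    using \<xi>_d\<xi>[OF c p]
    by (simp add: lip_def gamma2_def inner_add_left inner_add_right sw power2_eq_square algebra_simps)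
qed

lemma laguerre_second_form_lip:
  assumes c: "c \<in> A" and p: "p \<in> fst c"
  shows "lip (chart_deriv c (laguerre_gauss_map A x \<xi>) p v) (chart_deriv c (laguerre_position A x \<xi>) p w) =
    rho p * (chart_deriv c x p v \<bullet> chart_deriv c \<xi> p w + mean p * (chart_deriv c \<xi> p v \<bullet> chart_deriv c \<xi> p w))"
proof -
  have sw: "chart_deriv c \<xi> p v \<bullet> \<xi> p = 0" "chart_deriv c x p v \<bullet> \<xi> p = 0" for v
    unfolding inner_commute[of _ "\<xi> p"] by (rule \<xi>_d\<xi>[OF c p] \<xi>_dx[OF c p])+
  have "\<xi> p \<bullet> \<xi> p = 1" using norm_\<xi>[of p] by (simp add: norm_eq_1)
  then show ?thesis
    unfolding chart_deriv_position[OF c p] chart_deriv_gauss_map[OF c p]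
    using \<xi>_d\<xi>[OF c p] \<xi>_dx[OF c p]
    by (simp add: lip_def gamma2_def inner_add_left inner_add_right sw algebra_simps)
qed

lemma laguerre_orthonormal_exists:
  assumes c: "c \<in> A" and p: "p \<in> fst c"
  shows "\<exists>E. laguerre_orthonormal A x \<xi> c p E"
proof -
  obtain e where e: "\<And>i j. chart_deriv c x p (e i) \<bullet> chart_deriv c x p (e j) = (if i = j then 1 else 0)"
    and r: "\<And>i. chart_deriv c x p (e i) = - radius p i *\<^sub>R chart_deriv c \<xi> p (e i)"
    using radius_frame_exists[OF c p] by blast
  \<comment> \<open>The unit vector \<open>e i\<close> has an image under \<open>d\<xi>\<close> of length \<open>1 / \<bar>radius p i\<bar>\<close>.\<close>
  have d: "chart_deriv c \<xi> p ((radius p i / rho p) *\<^sub>R e i) = - (1 / rho p) *\<^sub>R chart_deriv c x p (e i)" for i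
    by (simp add: r linear_cmul[OF linear_d\<xi>[OF c p]])
  have "laguerre_metric A x \<xi> c p ((radius p i / rho p) *\<^sub>R e i) ((radius p j / rho p) *\<^sub>R e j) = (if i = j then 1 else 0)" for i j
    unfolding laguerre_metric_eq[OF c p] d using rho_pos[of p] e[of i j]
    by (simp add: power2_eq_square)
  then show ?thesis
    unfolding laguerre_orthonormal_def by (intro exI[of _ "\<lambda>i. (radius p i / rho p) *\<^sub>R e i"] allI)
qed

text \<open>The definition expands the bilinear form \<open>\<langle>d\<eta>, dY\<rangle>\<close> in an orthonormal frame chosen
  arbitrarily, and the expansion returns the form itself. The terms with \<open>d\<rho>\<close> and \<open>dr\<close> drop out because \<open>gamma2\<close>
  is null and orthogonal to its own derivative and to that of \<open>gamma1\<close>.\<close>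

lemma laguerre_second_form_eq:
  assumes c: "c \<in> A" and p: "p \<in> fst c"
  shows "laguerre_second_form A x \<xi> c p v w =
    rho p * (chart_deriv c x p v \<bullet> chart_deriv c \<xi> p w + mean p * (chart_deriv c \<xi> p v \<bullet> chart_deriv c \<xi> p w))"
proof -
  define E where "E = (SOME E. laguerre_orthonormal A x \<xi> c p E)"
  have "laguerre_orthonormal A x \<xi> c p E"
    unfolding E_def by (rule someI_ex[OF laguerre_orthonormal_exists[OF c p]])
  then have orth: "laguerre_metric A x \<xi> c p (E i) (E j) = (if i = j then 1 else 0)" for i j
    by (simp add: laguerre_orthonormal_def)
  have lin: "linear (\<lambda>v. laguerre_metric A x \<xi> c p v u)" for u
    unfolding laguerre_metric_eq[OF c p]
    using linear_compose[OF linear_inner_d\<xi>[OF c p], of "\<lambda>t. (rho p)\<^sup>2 * t"] by (simp add: o_def linear_times)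
  have sym: "laguerre_metric A x \<xi> c p v u = laguerre_metric A x \<xi> c p u v" for u v
    by (simp add: laguerre_metric_eq[OF c p] inner_commute)
  define B where "B v w = rho p * (chart_deriv c x p v \<bullet> chart_deriv c \<xi> p w + mean p * (chart_deriv c \<xi> p v \<bullet> chart_deriv c \<xi> p w))" for v w
  have "linear (\<lambda>v. B v w)" for w
    unfolding B_def distrib_left
    by (intro linear_compose_add linear_inner_dx[OF c p] linear_inner_d\<xi>[OF c p]
        linear_compose[OF _ linear_times, unfolded o_def])
  note linB1 = linear_sum[OF this] linear_cmul[OF this]
  have B1: "B (\<Sum>i\<in>UNIV. a i *\<^sub>R E i) w = (\<Sum>i\<in>UNIV. a i * B (E i) w)" for a w
    by (simp only: linB1 real_scaleR_def)
  have "linear (\<lambda>w. B v w)" for v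
    unfolding B_def distrib_left inner_commute[of "chart_deriv c x p v"] inner_commute[of "chart_deriv c \<xi> p v"]
    by (intro linear_compose_add linear_inner_d\<xi>[OF c p] linear_compose[OF _ linear_times, unfolded o_def])
  note linB2 = linear_sum[OF this] linear_cmul[OF this]
  have B2: "B v (\<Sum>i\<in>UNIV. a i *\<^sub>R E i) = (\<Sum>i\<in>UNIV. a i * B v (E i))" for a v
    by (simp only: linB2 real_scaleR_def)
  define \<omega> where "\<omega> i v = laguerre_metric A x \<xi> c p (E i) v" for i v
  have ex: "v = (\<Sum>i\<in>UNIV. \<omega> i v *\<^sub>R E i)" for v
    using orthonormal_family_expansion[of "laguerre_metric A x \<xi> c p" E v, OF lin orth]
    by (simp only: \<omega>_def sym[of v])
  have "B v w = B (\<Sum>i\<in>UNIV. \<omega> i v *\<^sub>R E i) (\<Sum>j\<in>UNIV. \<omega> j w *\<^sub>R E j)"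
    by (simp only: ex[symmetric])
  also have "\<dots> = (\<Sum>i\<in>UNIV. \<Sum>j\<in>UNIV. B (E i) (E j) * \<omega> i v * \<omega> j w)"
    unfolding B1 unfolding B2 by (simp add: sum_distrib_left mult_ac)
  also have "\<dots> = laguerre_second_form A x \<xi> c p v w"
    unfolding laguerre_second_form_def Let_def E_def[symmetric] laguerre_second_form_lip[OF c p]
    by (simp only: B_def \<omega>_def)
  finally show ?thesis by (simp only: B_def)
qed

end

section \<open>The Laguerre group acting on contact elements\<close>

lemma laguerre_group_lip: "T \<in> laguerre_group \<Longrightarrow> lip (T X) (T Y) = lip X Y"
  unfolding laguerre_group_def by blast

lemma lip_gamma:
  assumes "norm \<xi> = 1"
  shows "lip (gamma1 (x, \<xi>)) (gamma1 (x, \<xi>)) = 0" "lip (gamma1 (x, \<xi>)) (gamma2 (x, \<xi>)) = 0"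
    "lip (gamma2 (x, \<xi>)) (gamma2 (x, \<xi>)) = 0" "lip (gamma1 (x, \<xi>)) wp = -1" "lip (gamma2 (x, \<xi>)) wp = 0"
  using assms
  by (simp_all add: lip_def gamma1_def gamma2_def wp_def dot_square_norm field_simps power2_eq_square)

text \<open>The planes spanned by \<open>gamma1 q, gamma2 q\<close> are exactly the isotropic planes that meet the
  orthogonal complement of \<open>wp\<close> in a line other than the line of \<open>wp\<close>.\<close>

lemma isotropic_pair_gamma:
  fixes Z1 Z2 :: "'n::finite ambient"
  assumes iso: "lip Z1 Z1 = 0" "lip Z1 Z2 = 0" "lip Z2 Z2 = 0" and wp: "lip Z1 wp = -1" "lip Z2 wp = 0"
    and b: "b = snd (snd (snd Z2))" "b \<noteq> 0"
  shows "\<exists>x \<xi>. norm \<xi> = 1 \<and> Z2 = b *\<^sub>R gamma2 (x, \<xi>) \<and>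
    Z1 = gamma1 (x, \<xi>) + snd (snd (snd Z1)) *\<^sub>R gamma2 (x, \<xi>)"
proof -
  obtain a0 a1 w s where Z1: "Z1 = (a0, a1, w, s)" by (cases Z1)
  obtain c0 c1 u where Z2: "Z2 = (c0, c1, u, b)" using b(1) by (cases Z2) auto
  have c1: "c1 = - c0" using wp(2) by (simp add: Z2 lip_def wp_def)
  have a: "a0 + a1 = 1" using wp(1) by (simp add: Z1 lip_def wp_def)
  define \<xi> where "\<xi> = (1 / b) *\<^sub>R u"
  define x where "x = w - s *\<^sub>R \<xi>"
  have u: "u = b *\<^sub>R \<xi>" using b(2) by (simp add: \<xi>_def)
  have "b * b * (\<xi> \<bullet> \<xi>) = b * b" using iso(3) by (simp add: Z2 lip_def c1 u)
  then have \<xi>: "\<xi> \<bullet> \<xi> = 1" using b(2) by simp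
  have w: "w = x + s *\<^sub>R \<xi>" by (simp add: x_def)
  have "c0 * (a0 + a1) = b * (w \<bullet> \<xi>) - s * b"
    using iso(2) by (simp add: Z1 Z2 lip_def c1 u algebra_simps)
  then have c0: "c0 = b * (x \<bullet> \<xi>)"
    by (simp add: a w inner_add_left \<xi> algebra_simps)
  have "(a0 - a1) * (a0 + a1) = w \<bullet> w - s * s"
    using iso(1) by (simp add: Z1 lip_def algebra_simps)
  then have "a0 - a1 = x \<bullet> x + 2 * s * (x \<bullet> \<xi>)"
    by (simp add: a w inner_add_left inner_add_right \<xi> inner_commute[of \<xi> x] algebra_simps)
  with a have a01: "a0 = (1 + x \<bullet> x) / 2 + s * (x \<bullet> \<xi>)" "a1 = (1 - x \<bullet> x) / 2 - s * (x \<bullet> \<xi>)"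
    by (simp_all add: field_simps)
  have "norm \<xi> = 1" using \<xi> by (simp add: norm_eq_1)
  moreover have "Z2 = b *\<^sub>R gamma2 (x, \<xi>)" by (simp add: Z2 gamma2_def c0 c1 u)
  moreover have "Z1 = gamma1 (x, \<xi>) + snd (snd (snd Z1)) *\<^sub>R gamma2 (x, \<xi>)"
    by (simp add: Z1 gamma1_def gamma2_def a01 w power2_norm_eq_inner)
  ultimately show ?thesis by (intro exI conjI)
qed

lemma span_pair_shear:
  fixes u v :: "'a::real_vector"
  assumes "b \<noteq> 0"
  shows "span {u + d *\<^sub>R v, b *\<^sub>R v} = span {u, v}"
proof (rule antisym; rule span_minimal)
  show "{u + d *\<^sub>R v, b *\<^sub>R v} \<subseteq> span {u, v}"
    by (auto intro!: span_add span_scale intro: span_base)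
  have e: "(1 / b) *\<^sub>R (b *\<^sub>R v) = v" "(u + d *\<^sub>R v) - (d / b) *\<^sub>R (b *\<^sub>R v) = u"
    using assms by simp_all
  have "(1 / b) *\<^sub>R (b *\<^sub>R v) \<in> span {u + d *\<^sub>R v, b *\<^sub>R v}"
    "(u + d *\<^sub>R v) - (d / b) *\<^sub>R (b *\<^sub>R v) \<in> span {u + d *\<^sub>R v, b *\<^sub>R v}"
    by (intro span_diff span_scale span_base insertI1 insertI2 singletonI)+
  then show "{u, v} \<subseteq> span {u + d *\<^sub>R v, b *\<^sub>R v}" unfolding e by blast
qed (rule subspace_span)+

lemma laguerre_transformation_eqI:
  assumes "norm \<xi>' = 1" "T (gamma1 q) = gamma1 (x', \<xi>') + d *\<^sub>R gamma2 (x', \<xi>')"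
    "T (gamma2 q) = b *\<^sub>R gamma2 (x', \<xi>')" "b \<noteq> 0"
  shows "laguerre_transformation T q = (x', \<xi>')"
proof -
  have span: "span {T (gamma1 q), T (gamma2 q)} = span {gamma1 (x', \<xi>'), gamma2 (x', \<xi>')}"
    unfolding assms(2,3) by (rule span_pair_shear[OF assms(4)])
  show ?thesis
    unfolding laguerre_transformation_def span
  proof (rule the_equality)
    show "norm (snd (x', \<xi>')) = 1 \<and>
        span {gamma1 (x', \<xi>'), gamma2 (x', \<xi>')} = span {gamma1 (x', \<xi>'), gamma2 (x', \<xi>')}"
      using assms(1) by simp
    show "q' = (x', \<xi>')" if "norm (snd q') = 1 \<and>
        span {gamma1 q', gamma2 q'} = span {gamma1 (x', \<xi>'), gamma2 (x', \<xi>')}" for q'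
      using that by (blast intro: span_gamma_inject)
  qed
qed

text \<open>The image of \<open>(0, 0, 0, 1)\<close> is timelike and orthogonal to \<open>wp\<close>, that of \<open>gamma2 q\<close> is null
  and orthogonal to \<open>wp\<close>, and their product is \<open>-1\<close>. Hence the last components have the same sign,
  as for vectors in the future cone of Minkowski space.\<close>

lemma orientation_sign:
  fixes T :: "'n::finite ambient \<Rightarrow> 'n ambient"
  assumes T: "T \<in> laguerre_group" and \<xi>: "norm \<xi> = 1" and b: "b = snd (snd (snd (T (gamma2 (x, \<xi>)))))"
  shows "0 < b \<longleftrightarrow> orientation_preserving T" "b \<noteq> 0"
proof -
  have lipT: "lip (T X) (T Y) = lip X Y" for X Y by (rule laguerre_group_lip[OF T])
  have Twp: "T wp = wp" using T by (simp add: laguerre_group_def)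
  have wpT: "lip (T X) wp = lip X wp" for X using lipT[of X wp] by (simp add: Twp)
  obtain a0 a1 u t where 4: "T (0, 0, 0, 1) = (a0, a1, u, t)" by (cases "T (0, 0, 0, 1)")
  obtain c0 c1 w where 2: "T (gamma2 (x, \<xi>)) = (c0, c1, w, b)" using b by (cases "T (gamma2 (x, \<xi>))") auto
  have a: "a1 = - a0" using wpT[of "(0, 0, 0, 1)"] by (simp add: 4 lip_def wp_def)
  have c: "c1 = - c0" using wpT[of "gamma2 (x, \<xi>)"] lip_gamma[OF \<xi>, of x] by (simp add: 2) (simp add: lip_def wp_def)
  have tt: "t * t = u \<bullet> u + 1" using lipT[of "(0, 0, 0, 1)" "(0, 0, 0, 1)"] by (simp add: 4 a lip_def)
  have bb: "b * b = w \<bullet> w"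
    using lipT[of "gamma2 (x, \<xi>)" "gamma2 (x, \<xi>)"] lip_gamma[OF \<xi>, of x] by (simp add: 2 c) (simp add: lip_def)
  have wu: "w \<bullet> u - b * t = -1"
    using lipT[of "gamma2 (x, \<xi>)" "(0, 0, 0, 1)"] by (simp add: 2 4 a c) (simp add: lip_def gamma2_def)
  show b0: "b \<noteq> 0" using wu bb by auto
  have sq: "\<bar>r\<bar>\<^sup>2 = r * r" for r :: real by (simp only: power2_abs power2_eq_square)
  have "(norm u)\<^sup>2 < \<bar>t\<bar>\<^sup>2" unfolding power2_norm_eq_inner sq tt by simp
  then have "norm u < \<bar>t\<bar>" by (rule power2_less_imp_less) simp
  then have "\<bar>b\<bar> * norm u < \<bar>b\<bar> * \<bar>t\<bar>" using b0 by (intro mult_strict_left_mono) simp_all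
  moreover have "(norm w)\<^sup>2 = \<bar>b\<bar>\<^sup>2" unfolding power2_norm_eq_inner sq bb by (rule refl)
  then have "norm w = \<bar>b\<bar>" by (rule power2_eq_imp_eq) simp_all
  then have "\<bar>w \<bullet> u\<bar> \<le> \<bar>b\<bar> * norm u" using Cauchy_Schwarz_ineq2[of w u] by simp
  ultimately have "\<bar>w \<bullet> u\<bar> < \<bar>b\<bar> * \<bar>t\<bar>" by linarith
  then have "\<bar>b * t - 1\<bar> < \<bar>b * t\<bar>" using wu by (simp only: abs_mult)
  then have "0 < b * t" by linarith
  then show "0 < b \<longleftrightarrow> orientation_preserving T"
    unfolding orientation_preserving_def 4 by (auto simp: zero_less_mult_iff)
qed

lemma laguerre_transformation_image:
  assumes T: "T \<in> laguerre_group" and \<xi>: "norm \<xi> = 1"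
    and q': "(x', \<xi>') = laguerre_transformation T (x, \<xi>)"
  shows "T (gamma2 (x, \<xi>)) = snd (snd (snd (T (gamma2 (x, \<xi>))))) *\<^sub>R gamma2 (x', \<xi>')"
    and "T (gamma1 (x, \<xi>)) = gamma1 (x', \<xi>') + snd (snd (snd (T (gamma1 (x, \<xi>))))) *\<^sub>R gamma2 (x', \<xi>')"
proof -
  define b where "b = snd (snd (snd (T (gamma2 (x, \<xi>)))))"
  note b0 = orientation_sign(2)[OF T \<xi> b_def]
  have lipT: "lip (T X) (T Y) = lip X Y" for X Y by (rule laguerre_group_lip[OF T])
  have Twp: "T wp = wp" using T by (simp add: laguerre_group_def)
  have wpT: "lip (T X) wp = lip X wp" for X using lipT[of X wp] by (simp add: Twp)
  obtain x1 \<xi>1 where *: "norm \<xi>1 = 1" "T (gamma2 (x, \<xi>)) = b *\<^sub>R gamma2 (x1, \<xi>1)"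
    "T (gamma1 (x, \<xi>)) = gamma1 (x1, \<xi>1) + snd (snd (snd (T (gamma1 (x, \<xi>))))) *\<^sub>R gamma2 (x1, \<xi>1)"
    using isotropic_pair_gamma[of "T (gamma1 (x, \<xi>))" "T (gamma2 (x, \<xi>))" b] b0
    unfolding lipT wpT b_def[symmetric] using lip_gamma[OF \<xi>, of x] by blast
  have "(x', \<xi>') = (x1, \<xi>1)"
    unfolding q' by (rule laguerre_transformation_eqI[OF *(1,3,2) b0])
  with * show "T (gamma2 (x, \<xi>)) = snd (snd (snd (T (gamma2 (x, \<xi>))))) *\<^sub>R gamma2 (x', \<xi>')"
    "T (gamma1 (x, \<xi>)) = gamma1 (x', \<xi>') + snd (snd (snd (T (gamma1 (x, \<xi>))))) *\<^sub>R gamma2 (x', \<xi>')"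
    by (simp_all only: b_def)
qed


section \<open>Invariance of the metric and of the second fundamental form\<close>

locale laguerre_image =
  H: laguerre_hypersurface A x \<xi> + H': laguerre_hypersurface A x' \<xi>'
  for A :: "('p::{t2_space, second_countable_topology}, 'm::finite) chart set"
    and x \<xi> x' \<xi>' :: "'p \<Rightarrow> real ^ 'n::finite" +
  fixes T :: "'n ambient \<Rightarrow> 'n ambient"
  assumes T: "T \<in> laguerre_group" "orientation_preserving T"
    and image: "\<And>p. (x' p, \<xi>' p) = laguerre_transformation T (x p, \<xi> p)"
begin

definition "b p = snd (snd (snd (T (gamma2 (x p, \<xi> p)))))"
definition "d p = snd (snd (snd (T (gamma1 (x p, \<xi> p)))))"

lemma b_pos: "b p > 0"
  using orientation_sign(1)[OF T(1) H.norm_\<xi> b_def] T(2) by blast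

lemma T_gamma2: "T (gamma2 (x p, \<xi> p)) = b p *\<^sub>R gamma2 (x' p, \<xi>' p)"
  and T_gamma1: "T (gamma1 (x p, \<xi> p)) = gamma1 (x' p, \<xi>' p) + d p *\<^sub>R gamma2 (x' p, \<xi>' p)"
  unfolding b_def d_def using laguerre_transformation_image[OF T(1) H.norm_\<xi> image] by blast+

lemma bounded_linear_T: "bounded_linear T"
  using T(1) by (simp add: laguerre_group_def linear_conv_bounded_linear)

lemma linear_T: "linear T"
  using T(1) by (simp add: laguerre_group_def)

text \<open>Along a principal vector, \<open>dgamma1 = - r dgamma2\<close>. Applying \<open>T\<close> and differentiating the
  formulas for \<open>T (gamma1 (x, \<xi>))\<close> and \<open>T (gamma2 (x, \<xi>))\<close> gives the same relation for the
  image, with the radius \<open>b r + d\<close>, up to a multiple of \<open>gamma2 (x', \<xi>')\<close>; this multiple is zero because the last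
  components of \<open>dgamma1\<close> and \<open>dgamma2\<close> are.\<close>

lemma image_frame:
  assumes c: "c \<in> A" and p: "p \<in> fst c" and e: "chart_deriv c x p v = - r *\<^sub>R chart_deriv c \<xi> p v"
  shows "chart_deriv c x' p v = - (b p * r + d p) *\<^sub>R chart_deriv c \<xi>' p v"
proof -
  let ?y = "snd c p"
  let ?l = "\<lambda>X :: 'n ambient. snd (snd (snd X))"
  let ?G2 = "(x p \<bullet> chart_deriv c \<xi> p v, - (x p \<bullet> chart_deriv c \<xi> p v), chart_deriv c \<xi> p v, 0::real)"
  let ?G1 = "(x p \<bullet> chart_deriv c x p v, - (x p \<bullet> chart_deriv c x p v), chart_deriv c x p v, 0::real)"
  let ?G2' = "(x' p \<bullet> chart_deriv c \<xi>' p v, - (x' p \<bullet> chart_deriv c \<xi>' p v), chart_deriv c \<xi>' p v, 0::real)"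
  let ?G1' = "(x' p \<bullet> chart_deriv c x' p v, - (x' p \<bullet> chart_deriv c x' p v), chart_deriv c x' p v, 0::real)"
  note D2 = bounded_linear.has_derivative[OF bounded_linear_T H.gamma_has_derivative(2)[OF c p]]
  note D1 = bounded_linear.has_derivative[OF bounded_linear_T H.gamma_has_derivative(1)[OF c p]]
  have l: "bounded_linear ?l"
    by (intro bounded_linear_snd_comp bounded_linear_ident)
  note Db = bounded_linear.has_derivative[OF l D2, folded b_def]
  note Dd = bounded_linear.has_derivative[OF l D1, folded d_def]
  have inv: "chart_inv c (snd c p) = p" by (rule chart_inv_chart[OF H.atlas c p])
  have 2: "T ?G2 = b p *\<^sub>R ?G2' + ?l (T ?G2) *\<^sub>R gamma2 (x' p, \<xi>' p)"
    using fun_cong[OF has_derivative_unique[OF D2[unfolded T_gamma2]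
        has_derivative_scaleR[OF Db H'.gamma_has_derivative(2)[OF c p]]], of v]
    by (simp only: inv)
  have 1: "T ?G1 = ?G1' + (d p *\<^sub>R ?G2' + ?l (T ?G1) *\<^sub>R gamma2 (x' p, \<xi>' p))"
    using fun_cong[OF has_derivative_unique[OF D1[unfolded T_gamma1]
        has_derivative_add[OF H'.gamma_has_derivative(1)[OF c p]
          has_derivative_scaleR[OF Dd H'.gamma_has_derivative(2)[OF c p]]]], of v]
    by (simp only: inv)
  have "?G1 = - r *\<^sub>R ?G2" by (simp add: e)
  then have TG: "T ?G1 = - r *\<^sub>R T ?G2" by (simp only: linear_cmul[OF linear_T])
  have "?l (T ?G1) = - r * ?l (T ?G2)" unfolding TG by simp
  then have "?G1' = - r *\<^sub>R T ?G2 - d p *\<^sub>R ?G2' + (r * ?l (T ?G2)) *\<^sub>R gamma2 (x' p, \<xi>' p)"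
    using 1 unfolding TG by (simp add: algebra_simps)
  also have "- r *\<^sub>R T ?G2 = - r *\<^sub>R (b p *\<^sub>R ?G2' + ?l (T ?G2) *\<^sub>R gamma2 (x' p, \<xi>' p))"
    using 2 by (rule arg_cong)
  finally have "?G1' = (- r) *\<^sub>R (b p *\<^sub>R ?G2' + ?l (T ?G2) *\<^sub>R gamma2 (x' p, \<xi>' p)) - d p *\<^sub>R ?G2' +
      (r * ?l (T ?G2)) *\<^sub>R gamma2 (x' p, \<xi>' p)" .
  also have "\<dots> = - (b p * r + d p) *\<^sub>R ?G2'"
    by (simp only: scaleR_add_right scaleR_scaleR) (simp add: algebra_simps)
  finally show ?thesis by simp
qed

lemma image_mean_rho:
  shows "mean_radius A x' \<xi>' p = b p * mean_radius A x \<xi> p + d p"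
    and "laguerre_rho A x' \<xi>' p = b p * laguerre_rho A x \<xi> p"
proof -
  obtain c where c: "c \<in> A" "p \<in> fst c" by (rule chart_cover[OF H.atlas])
  obtain e where e: "\<And>i j. chart_deriv c x p (e i) \<bullet> chart_deriv c x p (e j) = (if i = j then 1 else 0)"
    and r: "\<And>i. chart_deriv c x p (e i) = - H.radius p i *\<^sub>R chart_deriv c \<xi> p (e i)"
    using H.radius_frame_exists[OF c] by blast
  have inv: "invertible (\<chi> r i. e i $ r)"
    by (rule invertible_orthonormal_family[of "\<lambda>v u. chart_deriv c x p v \<bullet> chart_deriv c x p u", OF H.linear_inner_dx[OF c] e])
  note sums = H'.radius_sums[OF c inv, of "\<lambda>i. b p * H.radius p i + d p", OF image_frame[OF c r]]
  have S: "(\<Sum>i\<in>UNIV. H.radius p i) = CARD('m) * H.mean p" by (simp add: H.mean_eq)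
  have m: "CARD('m) * H'.mean p = CARD('m) * (b p * H.mean p + d p)"
  proof -
    have "CARD('m) * H'.mean p = (\<Sum>i\<in>UNIV. b p * H.radius p i + d p)"
      by (simp add: H'.mean_eq sums(1))
    also have "\<dots> = b p * (\<Sum>i\<in>UNIV. H.radius p i) + CARD('m) * d p"
      by (simp add: sum.distrib sum_distrib_left)
    finally show ?thesis unfolding S by (simp add: algebra_simps)
  qed
  then show mean: "H'.mean p = b p * H.mean p + d p" by simp
  have "(\<Sum>i\<in>UNIV. (H'.radius p i)\<^sup>2) - CARD('m) * (H'.mean p)\<^sup>2 =
      (b p)\<^sup>2 * ((\<Sum>i\<in>UNIV. (H.radius p i)\<^sup>2) - CARD('m) * (H.mean p)\<^sup>2)"
  proof -
    have "(\<Sum>i\<in>UNIV. (H'.radius p i)\<^sup>2) =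
        (b p)\<^sup>2 * (\<Sum>i\<in>UNIV. (H.radius p i)\<^sup>2) + 2 * b p * d p * (\<Sum>i\<in>UNIV. H.radius p i) + CARD('m) * (d p)\<^sup>2"
      unfolding sums(2) by (simp add: power2_sum sum.distrib sum_distrib_left power_mult_distrib mult_ac)
    then show ?thesis unfolding S mean by (simp add: power2_eq_square algebra_simps)
  qed
  then show "H'.rho p = b p * H.rho p"
    unfolding H.rho_eq H'.rho_eq using b_pos[of p] by (simp add: real_sqrt_mult)
qed

lemma image_position: "laguerre_position A x' \<xi>' = T \<circ> laguerre_position A x \<xi>"
  by (rule ext) (simp add: laguerre_position_def linear_cmul[OF linear_T] T_gamma2 image_mean_rho mult.commute)

lemma image_gauss_map: "laguerre_gauss_map A x' \<xi>' = T \<circ> laguerre_gauss_map A x \<xi>"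
  by (rule ext) (simp add: laguerre_gauss_map_def linear_add[OF linear_T] linear_cmul[OF linear_T] T_gamma1 T_gamma2
      image_mean_rho algebra_simps)

lemma image_chart_deriv:
  assumes c: "c \<in> A" and p: "p \<in> fst c"
  shows "chart_deriv c (laguerre_position A x' \<xi>') p v = T (chart_deriv c (laguerre_position A x \<xi>) p v)"
    and "chart_deriv c (laguerre_gauss_map A x' \<xi>') p v = T (chart_deriv c (laguerre_gauss_map A x \<xi>) p v)"
  unfolding chart_deriv_def image_position image_gauss_map comp_assoc
  using dderiv_linear[OF bounded_linear_T differentiableI[OF H.position_has_derivative[OF c p]]]
    dderiv_linear[OF bounded_linear_T differentiableI[OF H.gauss_map_has_derivative[OF c p]]]
  by (simp_all add: o_def)

lemma laguerre_invariants_eq: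
  assumes c: "c \<in> A" and p: "p \<in> fst c"
  shows "laguerre_metric A x \<xi> c p v w = laguerre_metric A x' \<xi>' c p v w"
    and "laguerre_second_form A x \<xi> c p v w = laguerre_second_form A x' \<xi>' c p v w"
proof -
  have lipT: "lip (T X) (T Y) = lip X Y" for X Y by (rule laguerre_group_lip[OF T(1)])
  have g: "laguerre_metric A x' \<xi>' c p = laguerre_metric A x \<xi> c p"
    by (intro ext) (simp add: laguerre_metric_def image_chart_deriv[OF c p] lipT)
  then have o: "laguerre_orthonormal A x' \<xi>' c p = laguerre_orthonormal A x \<xi> c p"
    by (intro ext) (simp add: laguerre_orthonormal_def)
  show "laguerre_metric A x \<xi> c p v w = laguerre_metric A x' \<xi>' c p v w" by (simp add: g)
  show "laguerre_second_form A x \<xi> c p v w = laguerre_second_form A x' \<xi>' c p v w"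
    by (simp add: laguerre_second_form_def g o image_chart_deriv[OF c p] lipT)
qed

end

section \<open>Moving frames\<close>

text \<open>Inverses of a continuous family of linear bijections are locally bounded.\<close>

lemma eventually_bounded_below:
  fixes F :: "'a::euclidean_space \<Rightarrow> 'e::euclidean_space \<Rightarrow> 'v::euclidean_space"
  assumes lin: "\<And>y. y \<in> U \<Longrightarrow> linear (F y)" and U: "open U" "y0 \<in> U" and inj: "inj (F y0)"
    and cont: "\<And>a. isCont (\<lambda>y. F y a) y0"
  shows "\<exists>C>0. \<forall>\<^sub>F y in at y0. \<forall>a. C * norm a \<le> norm (F y a)"
proof -
  obtain C where C: "C > 0" "\<And>a. C * norm a \<le> norm (F y0 a)"
    using linear_inj_bounded_below_pos[OF lin[OF U(2)] inj] by (metis mult.commute)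
  let ?S = "\<lambda>y. \<Sum>b\<in>Basis. norm (F y b - F y0 b)"
  have "(?S \<longlongrightarrow> (\<Sum>b\<in>Basis. norm (F y0 b - F y0 b))) (at y0)"
    using cont unfolding isCont_def by (intro tendsto_intros)
  then have "(?S \<longlongrightarrow> 0) (at y0)" by simp
  then have "\<forall>\<^sub>F y in at y0. ?S y < C / 2"
    using C(1) by (intro order_tendstoD(2)[of ?S 0]) simp_all
  moreover have "\<forall>\<^sub>F y in at y0. y \<in> U"
    using U by (rule eventually_at_in_open')
  ultimately have "\<forall>\<^sub>F y in at y0. \<forall>a. C / 2 * norm a \<le> norm (F y a)"
  proof eventually_elim
    fix y assume S: "?S y < C / 2" and y: "y \<in> U"
    show "\<forall>a. C / 2 * norm a \<le> norm (F y a)"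
    proof
      fix a
      have "linear (\<lambda>a. F y a - F y0 a)" by (intro linear_compose_sub lin y U(2))
      from linear_sum[OF this, of "\<lambda>b. (a \<bullet> b) *\<^sub>R b" Basis] linear_cmul[OF this]
      have "F y a - F y0 a = (\<Sum>b\<in>Basis. (a \<bullet> b) *\<^sub>R (F y b - F y0 b))"
        by (simp add: euclidean_representation)
      also have "norm \<dots> \<le> (\<Sum>b\<in>Basis. norm a * norm (F y b - F y0 b))"
        by (rule sum_norm_le) (simp add: Basis_le_norm mult_right_mono)
      also have "\<dots> = norm a * ?S y" by (simp add: sum_distrib_left)
      also have "\<dots> \<le> norm a * (C / 2)" using S by (intro mult_left_mono) simp_all
      finally have "norm (F y a - F y0 a) \<le> C / 2 * norm a" by (simp add: mult.commute)
      moreover have "norm (F y0 a) \<le> norm (F y a) + norm (F y a - F y0 a)"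
        using norm_triangle_ineq4[of "F y a" "F y a - F y0 a"] by simp
      ultimately show "C / 2 * norm a \<le> norm (F y a)" using C(2)[of a] by simp
    qed
  qed
  with C(1) show ?thesis by (intro exI[of _ "C / 2"]) simp
qed

text \<open>Two moving frames with the same Gram matrix and the same connection coefficients differ by
  a constant isometry. At \<open>y0\<close>, with \<open>\<Lambda> = F' y0 \<circ> (F y0)\<^sup>-\<^sup>1\<close>, the function \<open>F' y - \<Lambda> \<circ> F y\<close>
  vanishes together with its derivative, and multiplication by \<open>(F y)\<^sup>-\<^sup>1\<close>, which is bounded
  near \<open>y0\<close>, turns it into the difference between the transition at \<open>y\<close> and at \<open>y0\<close>.\<close>

lemma frame_transition_derivative:
  fixes F F' :: "'a::euclidean_space \<Rightarrow> 'e::euclidean_space \<Rightarrow> 'v::euclidean_space"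
  assumes bil: "bilinear m" and nondeg: "\<And>X. (\<And>Y. m X Y = (0::real)) \<Longrightarrow> X = 0"
    and U: "open U" "y0 \<in> U"
    and lin: "\<And>y. y \<in> U \<Longrightarrow> linear (F y)" "\<And>y. y \<in> U \<Longrightarrow> linear (F' y)"
    and bij: "\<And>y. y \<in> U \<Longrightarrow> bij (F y)" "bij (F' y0)"
    and diff: "\<And>a. (\<lambda>y. F y a) differentiable at y0" "\<And>a. (\<lambda>y. F' y a) differentiable at y0"
    and gram: "\<And>a b. m (F' y0 a) (F' y0 b) = m (F y0 a) (F y0 b)"
    and conn: "\<And>u a b. m (dderiv u (\<lambda>y. F' y a) y0) (F' y0 b) = m (dderiv u (\<lambda>y. F y a) y0) (F y0 b)"
  shows "((\<lambda>y. F' y (inv (F y) X)) has_derivative (\<lambda>_. 0)) (at y0)"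
proof -
  define L where "L X = F' y0 (inv (F y0) X)" for X
  have F0: "F y0 (inv (F y0) X) = X" "inv (F y0) (F y0 a) = a" for X a
    using bij(1)[OF U(2)] by (simp_all add: bij_is_surj surj_f_inv_f bij_is_inj inv_f_f)
  have linv: "linear (inv (F y))" if "y \<in> U" for y
  proof -
    have "F y (inv (F y) X) = X" for X using bij(1)[OF that] by (simp add: bij_is_surj surj_f_inv_f)
    moreover have "inv (F y) (F y a) = a" for a using bij(1)[OF that] by (simp add: bij_is_inj inv_f_f)
    ultimately show ?thesis
      by (intro linearI) (metis linear_add[OF lin(1)[OF that]], metis linear_cmul[OF lin(1)[OF that]])
  qed
  have linL: "linear L"
    unfolding L_def using linear_compose[OF linv lin(2)] U(2) by (simp add: o_def)
  have isoL: "m (L X) (L Y) = m X Y" for X Y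
    unfolding L_def gram F0 ..
  define D where "D y a = F' y a - L (F y a)" for y a
  have D0: "D y0 a = 0" for a by (simp add: D_def L_def F0)
  have linD: "linear (D y)" if "y \<in> U" for y
    unfolding D_def using linear_compose[OF lin(1)[OF that] linL] lin(2)[OF that]
    by (intro linear_compose_sub) (simp_all add: o_def)
  have derD: "((\<lambda>y. D y a) has_derivative (\<lambda>_. 0)) (at y0)" for a
  proof -
    have "((\<lambda>y. D y a) has_derivative (\<lambda>u. dderiv u (\<lambda>y. F' y a) y0 - L (dderiv u (\<lambda>y. F y a) y0))) (at y0)"
      unfolding D_def using diff linL
      by (intro has_derivative_diff bounded_linear.has_derivative[of L])
         (simp_all add: frechet_derivative_works linear_conv_bounded_linear)
    moreover have "dderiv u (\<lambda>y. F' y a) y0 - L (dderiv u (\<lambda>y. F y a) y0) = 0" (is "?w = 0") for u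
    proof (rule nondeg)
      fix Y
      obtain b where Y: "Y = F' y0 b" using bij(2) by (metis bij_is_surj surjD)
      have "m (L (dderiv u (\<lambda>y. F y a) y0)) Y = m (dderiv u (\<lambda>y. F y a) y0) (F y0 b)"
        using isoL[of _ "F y0 b"] by (simp add: Y L_def F0)
      then show "m ?w Y = 0" using conn[where u=u and a=a and b=b] by (simp add: bilinear_lsub[OF bil] Y)
    qed
    ultimately show ?thesis by simp
  qed
  have "\<exists>C>0. \<forall>\<^sub>F y in at y0. \<forall>a. C * norm a \<le> norm (F y a)"
    by (rule eventually_bounded_below[where U=U], erule lin(1), rule U, rule U, rule bij_is_inj[OF bij(1)[OF U(2)]],
        rule differentiable_imp_continuous_within[OF diff(1)])
  then obtain C where C: "C > 0" "\<forall>\<^sub>F y in at y0. \<forall>a. C * norm a \<le> norm (F y a)"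
    by (elim exE conjE) (rule that)
  let ?S = "\<lambda>y. \<Sum>b\<in>Basis. norm (D y b) / norm (y - y0)"
  have "(?S \<longlongrightarrow> (\<Sum>b\<in>(Basis :: 'e set). 0)) (at y0)"
    using derD unfolding has_derivative_iff_norm by (intro tendsto_sum) (simp add: D0)
  then have S0: "((\<lambda>y. norm X / C * ?S y) \<longlongrightarrow> 0) (at y0)"
    by (intro tendsto_mult_right_zero) simp
  have bound: "\<forall>\<^sub>F y in at y0. norm (norm (F' y (inv (F y) X) - F' y0 (inv (F y0) X) - 0) / norm (y - y0)) \<le> norm X / C * ?S y"
    using C(2) eventually_at_in_open'[OF U]
  proof eventually_elim
    fix y assume low: "\<forall>a. C * norm a \<le> norm (F y a)" and y: "y \<in> U"
    let ?a = "inv (F y) X"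
    have X: "F y ?a = X" using bij(1)[OF y] by (simp add: bij_is_surj surj_f_inv_f)
    have a: "norm ?a \<le> norm X / C"
      using low[rule_format, of ?a] C(1) by (simp add: X field_simps)
    have "F' y ?a - F' y0 (inv (F y0) X) = D y ?a" by (simp add: D_def X L_def)
    also have "D y ?a = (\<Sum>b\<in>Basis. (?a \<bullet> b) *\<^sub>R D y b)"
      using linear_sum[OF linD[OF y], of "\<lambda>b. (?a \<bullet> b) *\<^sub>R b" Basis] linear_cmul[OF linD[OF y]]
      by (simp add: euclidean_representation)
    also have "norm \<dots> \<le> (\<Sum>b\<in>Basis. norm X / C * norm (D y b))"
    proof (rule sum_norm_le)
      fix b :: 'e assume "b \<in> Basis"
      then have "\<bar>?a \<bullet> b\<bar> \<le> norm X / C" using Basis_le_norm[of b ?a] a by linarith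
      then show "norm ((?a \<bullet> b) *\<^sub>R D y b) \<le> norm X / C * norm (D y b)"
        unfolding norm_scaleR by (intro mult_right_mono) simp_all
    qed
    finally have "norm (F' y ?a - F' y0 (inv (F y0) X)) / norm (y - y0) \<le>
        (\<Sum>b\<in>Basis. norm X / C * norm (D y b)) / norm (y - y0)"
      by (rule divide_right_mono) simp
    also have "\<dots> = norm X / C * ?S y" by (simp add: sum_distrib_left sum_divide_distrib)
    finally show "norm (norm (F' y ?a - F' y0 (inv (F y0) X) - 0) / norm (y - y0)) \<le> norm X / C * ?S y"
      by simp
  qed
  show ?thesis
    unfolding has_derivative_iff_norm using Lim_null_comparison[OF bound S0] by (simp add: bounded_linear_zero)
qed


section \<open>Immersions into the light cone\<close>

definition mip :: "(real ^ 'n::finite) \<times> real \<Rightarrow> (real ^ 'n) \<times> real \<Rightarrow> real" where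
  "mip X Y = fst X \<bullet> fst Y - snd X * snd Y"

lemma mip_simps:
  "mip (X + Y) Z = mip X Z + mip Y Z" "mip Z (X + Y) = mip Z X + mip Z Y"
  "mip (X - Y) Z = mip X Z - mip Y Z" "mip Z (X - Y) = mip Z X - mip Z Y"
  "mip (k *\<^sub>R X) Z = k * mip X Z" "mip Z (k *\<^sub>R X) = k * mip Z X"
  "mip 0 Z = 0" "mip Z 0 = 0"
  by (simp_all add: mip_def inner_add_left inner_add_right inner_diff_left inner_diff_right algebra_simps)

lemma mip_sym: "mip X Y = mip Y X"
  by (simp add: mip_def inner_commute mult.commute)

lemma bilinear_mip: "bilinear mip"
  unfolding bilinear_def by (intro conjI allI linearI) (simp_all only: mip_simps real_scaleR_def)

lemma bounded_bilinear_mip: "bounded_bilinear mip"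
  using bilinear_mip by (simp add: bilinear_conv_bounded_bilinear)

lemma mip_nondegenerate:
  assumes "\<And>Y. mip X Y = 0"
  shows "X = 0"
proof -
  have "mip X (fst X, - snd X) = 0" by (rule assms)
  then have "fst X \<bullet> fst X + snd X * snd X = 0" by (simp add: mip_def)
  then have "fst X = 0" "snd X = 0"
    using inner_ge_zero[of "fst X"] zero_le_square[of "snd X"] by (simp_all add: add_nonneg_eq_0_iff)
  then show ?thesis by (simp add: prod_eq_iff)
qed

lemma linear_vanishing_on_orthonormal:
  fixes E :: "'m::finite \<Rightarrow> real ^ 'm" and f :: "real ^ 'm \<Rightarrow> 'b::real_vector"
  assumes "\<And>u. linear (\<lambda>v. G v u)" "\<And>i j. G (E i) (E j) = (if i = j then 1 else (0::real))"
    and f: "linear f" "\<And>i. f (E i) = 0"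
  shows "f v = 0"
proof -
  have "f v = f (\<Sum>i\<in>UNIV. G v (E i) *\<^sub>R E i)"
    using orthonormal_family_expansion[of G E v, OF assms(1,2)] by (rule arg_cong)
  also have "\<dots> = 0" by (simp add: linear_sum[OF f(1)] linear_cmul[OF f(1)] f(2))
  finally show ?thesis .
qed

locale null_immersion =
  fixes U :: "(real ^ 'm::finite) set" and y :: "real ^ 'm \<Rightarrow> (real ^ 'n::finite) \<times> real"
  assumes card: "CARD('n) = CARD('m) + 1"
    and U: "open U" and smooth: "smooth_on U y"
    and null: "p \<in> U \<Longrightarrow> mip (y p) (y p) = 0"
    and orthonormal: "p \<in> U \<Longrightarrow> \<exists>E :: 'm \<Rightarrow> real ^ 'm. \<forall>i j. mip (dderiv (E i) y p) (dderiv (E j) y p) = (if i = j then 1 else 0)"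
begin

definition g :: "real ^ 'm \<Rightarrow> real ^ 'm \<Rightarrow> real ^ 'm \<Rightarrow> real" where
  "g p v w = mip (dderiv v y p) (dderiv w y p)"

lemmas smooth1 = smooth_on_dderiv[OF smooth]
lemmas smooth2 = smooth_on_dderiv[OF smooth1]
lemmas diff0 = smooth_on_differentiable[OF smooth]
lemmas diff1 = smooth_on_differentiable[OF smooth1]
lemmas diff2 = smooth_on_differentiable[OF smooth2]

lemma dderiv_mip:
  assumes "f differentiable at p" "h differentiable at p"
  shows "dderiv u (\<lambda>p. mip (f p) (h p)) p = mip (f p) (dderiv u h p) + mip (dderiv u f p) (h p)"
  by (rule dderiv_bilinear[OF bounded_bilinear_mip assms])

lemma commute: "p \<in> U \<Longrightarrow> dderiv u (dderiv v y) p = dderiv v (dderiv u y) p"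
  by (rule dderiv_commute[OF U smooth])

lemma commute3: "p \<in> U \<Longrightarrow> dderiv u (dderiv v (dderiv w y)) p = dderiv v (dderiv u (dderiv w y)) p"
  by (rule dderiv_commute[OF U smooth1])

lemma linear_d: "p \<in> U \<Longrightarrow> linear (\<lambda>v. dderiv v y p)"
  by (rule linear_dderiv[OF diff0])

lemma linear_d2: "p \<in> U \<Longrightarrow> linear (\<lambda>u. dderiv u (dderiv v y) p)" "p \<in> U \<Longrightarrow> linear (\<lambda>v. dderiv u (dderiv v y) p)"
proof -
  show *: "p \<in> U \<Longrightarrow> linear (\<lambda>u. dderiv u (dderiv v y) p)" for v by (rule linear_dderiv[OF diff1])
  show "p \<in> U \<Longrightarrow> linear (\<lambda>v. dderiv u (dderiv v y) p)" using *[of u] by (simp only: commute[of p u])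
qed

lemma linear_mip: "linear f \<Longrightarrow> linear (\<lambda>v. mip (f v) X)" "linear f \<Longrightarrow> linear (\<lambda>v. mip X (f v))"
  by (auto intro!: linearI simp: linear_add linear_cmul mip_simps)

lemma linear_g: "p \<in> U \<Longrightarrow> linear (\<lambda>v. g p v u)"
  unfolding g_def by (intro linear_mip linear_d)

lemma g_pos:
  assumes p: "p \<in> U" and v: "v \<noteq> 0"
  shows "g p v v > 0"
proof -
  obtain E :: "'m \<Rightarrow> real ^ 'm" where "\<forall>i j. g p (E i) (E j) = (if i = j then 1 else 0)"
    using orthonormal[OF p] unfolding g_def by blast
  then have E: "g p (E i) (E j) = (if i = j then 1 else 0)" for i j by blast
  have sym: "g p (E i) v = g p v (E i)" for i by (simp add: g_def mip_sym)
  have ex: "v = (\<Sum>i\<in>UNIV. g p v (E i) *\<^sub>R E i)"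
    by (rule orthonormal_family_expansion[of "g p" E v, OF linear_g[OF p] E])
  then have "g p v v = g p (\<Sum>i\<in>UNIV. g p v (E i) *\<^sub>R E i) v" by simp
  also have "\<dots> = (\<Sum>i\<in>UNIV. (g p v (E i))\<^sup>2)"
    by (simp add: linear_sum[OF linear_g[OF p]] linear_cmul[OF linear_g[OF p]] sym power2_eq_square)
  finally have *: "g p v v = (\<Sum>i\<in>UNIV. (g p v (E i))\<^sup>2)" .
  have "\<exists>i. g p v (E i) \<noteq> 0"
  proof (rule ccontr)
    assume "\<nexists>i. g p v (E i) \<noteq> 0"
    then show False using ex v by simp
  qed
  then obtain i where "g p v (E i) \<noteq> 0" by blast
  then show ?thesis unfolding * by (intro sum_pos2[of _ i]) auto
qed

lemma mip_y_d: "p \<in> U \<Longrightarrow> mip (y p) (dderiv v y p) = 0"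
proof -
  assume p: "p \<in> U"
  have "dderiv v (\<lambda>p. mip (y p) (y p)) p = dderiv v (\<lambda>p. 0) p"
    by (rule dderiv_cong[OF U _ p]) (rule null)
  then have "mip (y p) (dderiv v y p) + mip (dderiv v y p) (y p) = 0"
    by (simp add: dderiv_mip[OF diff0[OF p] diff0[OF p]])
  then show ?thesis by (simp add: mip_sym[of "dderiv v y p"])
qed

lemma mip_y_d2: "p \<in> U \<Longrightarrow> mip (y p) (dderiv u (dderiv v y) p) = - g p u v"
proof -
  assume p: "p \<in> U"
  have "dderiv u (\<lambda>p. mip (y p) (dderiv v y p)) p = dderiv u (\<lambda>p. 0) p"
    by (rule dderiv_cong[OF U _ p]) (rule mip_y_d)
  then show ?thesis
    by (simp add: dderiv_mip[OF diff0[OF p] diff1[OF p]] g_def)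
qed

lemma mip_d_y: "p \<in> U \<Longrightarrow> mip (dderiv v y p) (y p) = 0"
  by (subst mip_sym) (rule mip_y_d)

lemma mip_d2_y: "p \<in> U \<Longrightarrow> mip (dderiv u (dderiv v y) p) (y p) = - g p u v"
  by (subst mip_sym) (rule mip_y_d2)

text \<open>The position, the tangent vectors and one second derivative, which is not orthogonal to the
  position, span Minkowski space.\<close>

definition frame :: "real ^ 'm \<Rightarrow> real ^ 'm \<Rightarrow> real \<times> (real ^ 'm) \<times> real \<Rightarrow> (real ^ 'n) \<times> real" where
  "frame e p a = fst a *\<^sub>R y p + dderiv (fst (snd a)) y p + snd (snd a) *\<^sub>R dderiv e (dderiv e y) p"

lemma linear_frame:
  assumes "p \<in> U"
  shows "linear (frame e p)"
  by (rule linearI)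
     (simp_all add: frame_def linear_add[OF linear_d[OF assms]] linear_cmul[OF linear_d[OF assms]] algebra_simps)

lemma frame_mip_y: "p \<in> U \<Longrightarrow> mip (frame e p a) (y p) = - snd (snd a) * g p e e"
  by (simp add: frame_def mip_simps null mip_d_y mip_d2_y)

lemma bij_frame:
  assumes p: "p \<in> U" and e: "e \<noteq> 0"
  shows "bij (frame e p)"
proof -
  have "a = 0" if a: "frame e p a = 0" for a
  proof -
    have b: "snd (snd a) = 0"
      using frame_mip_y[OF p, of e a] g_pos[OF p e] by (simp add: a mip_simps)
    have "mip (frame e p a) (dderiv (fst (snd a)) y p) = g p (fst (snd a)) (fst (snd a))"
      using b by (simp add: frame_def mip_simps mip_y_d[OF p] g_def)
    then have v: "fst (snd a) = 0"
      using g_pos[OF p, of "fst (snd a)"] by (force simp: a mip_simps)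
    have "y p \<noteq> 0" using mip_y_d2[OF p, of e e] g_pos[OF p e] by (auto simp: mip_simps)
    have "fst a *\<^sub>R y p = 0"
      using a unfolding frame_def b v linear_0[OF linear_d[OF p]] by simp
    with \<open>y p \<noteq> 0\<close> have "fst a = 0" by simp
    with b v show "a = 0" by (simp only: prod_eq_iff fst_zero snd_zero)
  qed
  then have inj: "inj (frame e p)" unfolding linear_injective_0[OF linear_frame[OF p]] by blast
  have "dim (range (frame e p)) = DIM(real \<times> (real ^ 'm) \<times> real)"
    using dim_image_eq[OF linear_frame[OF p, of e], of UNIV] inj by (simp add: dim_UNIV)
  then have "dim (range (frame e p)) = DIM((real ^ 'n) \<times> real)" using card by simp
  then have "span (range (frame e p)) = UNIV" by (simp only: dim_eq_full)
  then have "surj (frame e p)"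
    using linear_subspace_image[OF linear_frame[OF p, of e] subspace_UNIV] by (simp add: span_eq_iff[THEN iffD2])
  with inj show ?thesis by (simp add: bij_def)
qed

lemma mip_orthogonal_to_y:
  assumes p: "p \<in> U" and E: "\<And>i j. g p (E i) (E j) = (if i = j then 1 else 0)"
    and t: "mip t (y p) = 0" "mip s (y p) = 0"
  shows "mip t s = (\<Sum>i\<in>(UNIV :: 'm set). mip t (dderiv (E i) y p) * mip s (dderiv (E i) y p))"
proof -
  obtain i0 :: 'm where True by blast
  have e: "E i0 \<noteq> 0"
    using E[of i0 i0] by (auto simp: g_def linear_0[OF linear_d[OF p]] mip_simps)
  have *: "\<exists>\<alpha> v. t = \<alpha> *\<^sub>R y p + dderiv v y p" if "mip t (y p) = 0" for t
  proof -
    obtain a where a: "t = frame (E i0) p a" using bij_frame[OF p e] by (metis bij_is_surj surjD)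
    then have "snd (snd a) = 0" using that frame_mip_y[OF p, of "E i0" a] g_pos[OF p e] by simp
    then show ?thesis unfolding a frame_def by auto
  qed
  obtain \<alpha> v where tv: "t = \<alpha> *\<^sub>R y p + dderiv v y p" using *[OF t(1)] by blast
  obtain \<beta> w where sw: "s = \<beta> *\<^sub>R y p + dderiv w y p" using *[OF t(2)] by blast
  have "mip t s = g p v w" by (simp add: tv sw mip_simps null[OF p] mip_y_d[OF p] mip_d_y[OF p] g_def)
  also have "\<dots> = g p (\<Sum>i\<in>UNIV. g p v (E i) *\<^sub>R E i) w"
    using orthonormal_family_expansion[of "g p" E v, OF linear_g[OF p] E] by simp
  also have "\<dots> = (\<Sum>i\<in>UNIV. g p v (E i) * g p (E i) w)"
    by (simp add: linear_sum[OF linear_g[OF p]] linear_cmul[OF linear_g[OF p]])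
  also have "\<dots> = (\<Sum>i\<in>UNIV. mip t (dderiv (E i) y p) * mip s (dderiv (E i) y p))"
    by (simp add: tv sw mip_simps mip_y_d[OF p] g_def mip_sym[of "dderiv w y p"])
  finally show ?thesis .
qed

text \<open>Differentiating twice, \<open>M\<close> also annihilates the derivatives of \<open>y\<close>, hence a spanning frame.\<close>

lemma vanishing_linear_map:
  fixes M :: "(real ^ 'n) \<times> real \<Rightarrow> 'b::euclidean_space"
  assumes M: "linear M" and B: "open B" "B \<subseteq> U" "p \<in> B" and z: "\<And>q. q \<in> B \<Longrightarrow> M (y q) = 0"
  shows "M X = 0"
proof -
  have bl: "bounded_linear M" using M by (simp add: linear_conv_bounded_linear)
  have 1: "M (dderiv v y q) = 0" if q: "q \<in> B" for v q
  proof -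
    have "M (dderiv v y q) = dderiv v (\<lambda>q. M (y q)) q"
      using q B(2) by (intro dderiv_linear[OF bl, symmetric] diff0) blast
    also have "\<dots> = dderiv v (\<lambda>q. 0) q" by (rule dderiv_cong[OF B(1) z q])
    finally show ?thesis by simp
  qed
  have 2: "M (dderiv u (dderiv v y) q) = 0" if q: "q \<in> B" for u v q
  proof -
    have "M (dderiv u (dderiv v y) q) = dderiv u (\<lambda>q. M (dderiv v y q)) q"
      using q B(2) by (intro dderiv_linear[OF bl, symmetric] diff1) blast
    also have "\<dots> = dderiv u (\<lambda>q. 0) q" by (rule dderiv_cong[OF B(1) 1 q])
    finally show ?thesis by simp
  qed
  have p: "p \<in> U" using B by blast
  obtain a where "X = frame (axis undefined 1) p a"
    using bij_frame[OF p, of "axis undefined 1"] by (metis bij_is_surj surjD axis_eq_0_iff zero_neq_one)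
  then show ?thesis
    by (simp add: frame_def linear_add[OF M] linear_cmul[OF M] z[OF B(3)] 1[OF B(3)] 2[OF B(3)])
qed

end

section \<open>Rigidity of isometric immersions into the light cone\<close>

locale isometric_null_immersions =
  Y: null_immersion U y + Y': null_immersion U y'
  for U :: "(real ^ 'm::finite) set" and y y' :: "real ^ 'm \<Rightarrow> (real ^ 'n::finite) \<times> real" +
  assumes isometric: "p \<in> U \<Longrightarrow> Y'.g p v w = Y.g p v w"
    and dimension: "3 \<le> CARD('m)"
begin

definition K :: "real ^ 'm \<Rightarrow> real ^ 'm \<Rightarrow> real ^ 'm \<Rightarrow> real ^ 'm \<Rightarrow> real ^ 'm \<Rightarrow> real" where
  "K p u v w z = mip (dderiv u (dderiv v y') p) (dderiv w (dderiv z y') p) -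
    mip (dderiv u (dderiv v y) p) (dderiv w (dderiv z y) p)"

text \<open>The Christoffel symbols of the first kind are determined by the metric (Koszul).\<close>

lemma christoffel_eq:
  assumes p: "p \<in> U"
  shows "mip (dderiv u (dderiv v y') p) (dderiv w y' p) = mip (dderiv u (dderiv v y) p) (dderiv w y p)"
proof -
  define h where "h u v w = mip (dderiv u (dderiv v y') p) (dderiv w y' p) - mip (dderiv u (dderiv v y) p) (dderiv w y p)" for u v w
  have s12: "h u v w = h v u w" for u v w
    unfolding h_def by (simp only: Y.commute[OF p, of u v] Y'.commute[OF p, of u v])
  have s23: "h u v w = - h u w v" for u v w
  proof -
    have "dderiv u (\<lambda>p. mip (dderiv v y' p) (dderiv w y' p)) p = dderiv u (\<lambda>p. mip (dderiv v y p) (dderiv w y p)) p"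
      by (rule dderiv_cong[OF Y.U _ p]) (use isometric in \<open>simp add: Y.g_def Y'.g_def\<close>)
    then have "mip (dderiv v y' p) (dderiv u (dderiv w y') p) + mip (dderiv u (dderiv v y') p) (dderiv w y' p) =
        mip (dderiv v y p) (dderiv u (dderiv w y) p) + mip (dderiv u (dderiv v y) p) (dderiv w y p)"
      by (simp only: Y.dderiv_mip[OF Y.diff1[OF p] Y.diff1[OF p]] Y'.dderiv_mip[OF Y'.diff1[OF p] Y'.diff1[OF p]])
    then show ?thesis
      unfolding h_def mip_sym[of "dderiv u (dderiv w y') p"] mip_sym[of "dderiv u (dderiv w y) p"] by linarith
  qed
  have "h u v w = - h u w v" by (rule s23)
  also have "h u w v = h w u v" by (rule s12)
  also have "h w u v = - h w v u" by (rule s23)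
  also have "h w v u = h v w u" by (rule s12)
  also have "h v w u = - h v u w" by (rule s23)
  also have "h v u w = h u v w" by (rule s12)
  finally show ?thesis unfolding h_def by simp
qed

text \<open>The Gauss equation. Derivatives of the Christoffel symbols agree, and the third derivatives
  that occur in them are symmetric.\<close>

lemma gauss_eq:
  assumes p: "p \<in> U"
  shows "K p u v l w = K p l v u w"
proof -
  define t where "t l u v w = mip (dderiv l (dderiv u (dderiv v y')) p) (dderiv w y' p) -
    mip (dderiv l (dderiv u (dderiv v y)) p) (dderiv w y p)" for l u v w
  have sym: "t l u v w = t u l v w" for l u v w
    unfolding t_def by (simp only: Y.commute3[OF p, where u=l and v=u] Y'.commute3[OF p, where u=l and v=u])
  have K: "K p u v l w = - t l u v w" for u v l w
  proof -
    have "dderiv l (\<lambda>p. mip (dderiv u (dderiv v y') p) (dderiv w y' p)) p =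
        dderiv l (\<lambda>p. mip (dderiv u (dderiv v y) p) (dderiv w y p)) p"
      by (rule dderiv_cong[OF Y.U _ p]) (rule christoffel_eq)
    then show ?thesis
      unfolding K_def t_def
      by (simp only: Y.dderiv_mip[OF Y.diff2[OF p] Y.diff1[OF p]] Y'.dderiv_mip[OF Y'.diff2[OF p] Y'.diff1[OF p]])
  qed
  show ?thesis by (simp only: K sym[of l u])
qed

text \<open>A vector orthogonal to the position is determined, up to a multiple of the position, by its
  products with the tangent vectors.\<close>

lemma mip_tangential_eq:
  fixes E :: "'m \<Rightarrow> real ^ 'm"
  assumes p: "p \<in> U" and E: "\<And>i j. Y.g p (E i) (E j) = (if i = j then 1 else 0)"
    and "mip t (y p) = 0" "mip s (y p) = 0" "mip t' (y' p) = 0" "mip s' (y' p) = 0"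
    and "\<And>w. mip t' (dderiv w y' p) = mip t (dderiv w y p)" "\<And>w. mip s' (dderiv w y' p) = mip s (dderiv w y p)"
  shows "mip t' s' = mip t s"
proof -
  have E': "Y'.g p (E i) (E j) = (if i = j then 1 else 0)" for i j
    using E isometric[OF p] by simp
  show ?thesis
    unfolding Y.mip_orthogonal_to_y[OF p E assms(3,4)] Y'.mip_orthogonal_to_y[OF p E' assms(5,6)]
    by (simp only: assms(7,8))
qed

text \<open>Here dimension at least three is essential. In an orthonormal basis, \<open>K\<close> vanishes on pairs of
  trace-free combinations, whose second derivatives are orthogonal to the position. Together with the
  Gauss equation and three distinct indices this kills all components.\<close>

lemma K_orthonormal:
  fixes E :: "'m \<Rightarrow> real ^ 'm"
  assumes p: "p \<in> U" and E: "\<And>i j. Y.g p (E i) (E j) = (if i = j then 1 else (0::real))"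
  shows "K p (E a) (E b) (E c) (E d) = 0"
proof -
  let ?y2 = "\<lambda>i j. dderiv (E i) (dderiv (E j) y) p" and ?y2' = "\<lambda>i j. dderiv (E i) (dderiv (E j) y') p"
  let ?K = "\<lambda>i j k l. K p (E i) (E j) (E k) (E l)"
  have y: "mip (?y2 i j) (y p) = (if i = j then -1 else 0)" "mip (?y2' i j) (y' p) = (if i = j then -1 else 0)" for i j
    using E[of i j] isometric[OF p, of "E i" "E j"] by (simp_all add: Y.mip_d2_y[OF p] Y'.mip_d2_y[OF p])
  note teq = mip_tangential_eq[OF p E]
  have sym12: "?K i j k l = ?K j i k l" for i j k l
    unfolding K_def by (simp only: Y.commute[OF p, of "E i" "E j"] Y'.commute[OF p, of "E i" "E j"])
  have sym34: "?K i j k l = ?K i j l k" for i j k l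
    unfolding K_def by (simp only: Y.commute[OF p, of "E k" "E l"] Y'.commute[OF p, of "E k" "E l"])
  have swap: "?K i j k l = ?K k l i j" for i j k l
    unfolding K_def by (simp only: mip_sym[of "?y2 i j"] mip_sym[of "?y2' i j"])
  have gauss: "?K i j k l = ?K k j i l" for i j k l by (rule gauss_eq[OF p])
  have 1: "?K i j k l = 0" if "i \<noteq> j" "k \<noteq> l" for i j k l
    using teq[of "?y2 i j" "?y2 k l" "?y2' i j" "?y2' k l"] that
    by (simp add: K_def y christoffel_eq[OF p])
  have 2: "?K i i k l = ?K j j k l" if "k \<noteq> l" for i j k l
  proof -
    have "mip (?y2' i i - ?y2' j j) (?y2' k l) = mip (?y2 i i - ?y2 j j) (?y2 k l)"
      by (rule teq) (use that in \<open>simp_all add: mip_simps y christoffel_eq[OF p]\<close>)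
    then show ?thesis by (simp add: K_def mip_simps)
  qed
  have 3: "?K i i k k - ?K i i l l - ?K j j k k + ?K j j l l = 0" for i j k l
  proof -
    have "mip (?y2' i i - ?y2' j j) (?y2' k k - ?y2' l l) = mip (?y2 i i - ?y2 j j) (?y2 k k - ?y2 l l)"
      by (rule teq) (simp_all add: mip_simps y christoffel_eq[OF p])
    then show ?thesis by (simp add: K_def mip_simps)
  qed
  have third: "\<exists>k. k \<noteq> i \<and> k \<noteq> j" for i j :: 'm
  proof (rule ccontr)
    assume "\<nexists>k. k \<noteq> i \<and> k \<noteq> j"
    then have "UNIV \<subseteq> {i, j}" by blast
    then have "CARD('m) \<le> card {i, j}" by (intro card_mono) simp_all
    also have "\<dots> \<le> 2" by (simp add: card_insert_if)
    finally show False using dimension by simp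
  qed
  have 4: "?K i i j j = 0" if "i \<noteq> j" for i j
    using gauss[of i i j j] 1[of j i i j] that by simp
  have 5: "?K i i k l = 0" if kl: "k \<noteq> l" for i k l
  proof -
    obtain j where j: "j \<noteq> k" "j \<noteq> l" using third[of k l] by blast
    have "?K i i k l = ?K j j k l" by (rule 2[OF kl])
    also have "\<dots> = ?K k j j l" by (rule gauss)
    also have "\<dots> = 0" using j by (intro 1) simp_all
    finally show ?thesis .
  qed
  have 6: "?K i i i i = 0" for i
  proof -
    obtain j where j: "j \<noteq> i" using third by blast
    obtain k where k: "k \<noteq> i" "k \<noteq> j" using third by blast
    show ?thesis
      using 3[of i i k j] 4[of i k] 4[of j i] 4[of j k] j k by simp
  qed
  show ?thesis
  proof (cases "a = b")
    case True
    show ?thesis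
    proof (cases "c = d")
      case cd: True
      show ?thesis by (cases "a = c") (use True cd 4 6 in simp_all)
    next
      case False
      then show ?thesis using True 5 by simp
    qed
  next
    case ab: False
    show ?thesis
    proof (cases "c = d")
      case True
      then show ?thesis using 5[OF ab, of c] swap[of a b c d] by simp
    next
      case False
      then show ?thesis using ab 1 by simp
    qed
  qed
qed

lemma K_zero:
  assumes p: "p \<in> U"
  shows "K p u v w z = 0"
proof -
  obtain E :: "'m \<Rightarrow> real ^ 'm" where "\<forall>i j. mip (dderiv (E i) y p) (dderiv (E j) y p) = (if i = j then 1 else 0)"
    using Y.orthonormal[OF p] by blast
  then have E: "Y.g p (E i) (E j) = (if i = j then 1 else 0)" for i j by (simp add: Y.g_def)
  note vanish = linear_vanishing_on_orthonormal[of "Y.g p" E, OF Y.linear_g[OF p] E]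
  note lin = linear_compose_sub Y.linear_mip Y'.linear_mip Y.linear_d2[OF p] Y'.linear_d2[OF p]
  have 1: "K p u (E b) (E c) (E d) = 0" for u b c d
    by (rule vanish[of "\<lambda>u. K p u (E b) (E c) (E d)"]) (unfold K_def, intro lin, fold K_def, rule K_orthonormal[OF p E])
  have 2: "K p u v (E c) (E d) = 0" for u v c d
    by (rule vanish[of "\<lambda>v. K p u v (E c) (E d)"]) (unfold K_def, intro lin, fold K_def, rule 1)
  have 3: "K p u v w (E d) = 0" for u v w d
    by (rule vanish[of "\<lambda>w. K p u v w (E d)"]) (unfold K_def, intro lin, fold K_def, rule 2)
  show ?thesis
    by (rule vanish[of "\<lambda>z. K p u v w z"]) (unfold K_def, intro lin, fold K_def, rule 3)
qed

lemma second_derivative_products_eq: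
  "p \<in> U \<Longrightarrow> mip (dderiv u (dderiv v y') p) (dderiv w (dderiv z y') p) =
    mip (dderiv u (dderiv v y) p) (dderiv w (dderiv z y) p)"
  using K_zero[of p u v w z] by (simp add: K_def)

lemma frame_gram_eq:
  assumes p: "p \<in> U"
  shows "mip (Y'.frame e p a) (Y'.frame e p b) = mip (Y.frame e p a) (Y.frame e p b)"
  unfolding Y.frame_def Y'.frame_def
  by (simp add: mip_simps Y.null[OF p] Y'.null[OF p] Y.mip_y_d[OF p] Y'.mip_y_d[OF p] Y.mip_d_y[OF p] Y'.mip_d_y[OF p]
      Y.mip_y_d2[OF p] Y'.mip_y_d2[OF p] Y.mip_d2_y[OF p] Y'.mip_d2_y[OF p] isometric[OF p]
      christoffel_eq[OF p] second_derivative_products_eq[OF p]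
      isometric[OF p, unfolded Y.g_def Y'.g_def]
      mip_sym[of "dderiv _ y p" "dderiv _ (dderiv _ y) p"] mip_sym[of "dderiv _ y' p" "dderiv _ (dderiv _ y') p"])

lemma frame_has_derivative:
  assumes "null_immersion U Z" "p \<in> U"
  shows "((\<lambda>p. null_immersion.frame Z e p a) has_derivative (\<lambda>u. fst a *\<^sub>R dderiv u Z p +
    dderiv u (dderiv (fst (snd a)) Z) p + snd (snd a) *\<^sub>R dderiv u (dderiv e (dderiv e Z)) p)) (at p)"
proof -
  interpret Z: null_immersion U Z by fact
  show ?thesis
    unfolding Z.frame_def using Z.diff0[OF assms(2)] Z.diff1[OF assms(2)] Z.diff2[OF assms(2)]
    by (intro has_derivative_add has_derivative_scaleR_right) (simp_all add: frechet_derivative_works)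
qed

text \<open>The difference \<open>C\<close> of the connection forms is skew because the Gram matrices agree, so the
  coefficients in which third derivatives occur need not be compared.\<close>

lemma frame_connection_eq:
  assumes p: "p \<in> U"
  shows "mip (dderiv u (\<lambda>p. Y'.frame e p a) p) (Y'.frame e p b) = mip (dderiv u (\<lambda>p. Y.frame e p a) p) (Y.frame e p b)"
proof -
  note D = frame_has_derivative[OF Y.null_immersion_axioms p, of e] and D' = frame_has_derivative[OF Y'.null_immersion_axioms p, of e]
  define C where "C a b = mip (dderiv u (\<lambda>p. Y'.frame e p a) p) (Y'.frame e p b) -
    mip (dderiv u (\<lambda>p. Y.frame e p a) p) (Y.frame e p b)" for a b
  have skew: "C a b = - C b a" for a b
  proof -
    have "dderiv u (\<lambda>p. mip (Y'.frame e p a) (Y'.frame e p b)) p = dderiv u (\<lambda>p. mip (Y.frame e p a) (Y.frame e p b)) p"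
      by (rule dderiv_cong[OF Y.U _ p]) (rule frame_gram_eq)
    then have "mip (Y'.frame e p a) (dderiv u (\<lambda>p. Y'.frame e p b) p) + mip (dderiv u (\<lambda>p. Y'.frame e p a) p) (Y'.frame e p b) =
      mip (Y.frame e p a) (dderiv u (\<lambda>p. Y.frame e p b) p) + mip (dderiv u (\<lambda>p. Y.frame e p a) p) (Y.frame e p b)"
      by (simp only: Y.dderiv_mip[OF differentiableI[OF D] differentiableI[OF D]]
          Y'.dderiv_mip[OF differentiableI[OF D'] differentiableI[OF D']])
    then show ?thesis
      unfolding C_def mip_sym[of "dderiv u (\<lambda>p. Y'.frame e p b) p"] mip_sym[of "dderiv u (\<lambda>p. Y.frame e p b) p"] by linarith
  qed
  have first: "C (\<alpha>, v, 0) b = 0" for \<alpha> v b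
    unfolding C_def dderiv_eqI[OF D] dderiv_eqI[OF D'] unfolding Y.frame_def Y'.frame_def
    by (simp add: mip_simps Y.mip_d_y[OF p] Y'.mip_d_y[OF p]
      Y.mip_d2_y[OF p] Y'.mip_d2_y[OF p] isometric[OF p]
      christoffel_eq[OF p] second_derivative_products_eq[OF p]
      isometric[OF p, unfolded Y.g_def Y'.g_def]
      mip_sym[of "dderiv _ y p" "dderiv _ (dderiv _ y) p"] mip_sym[of "dderiv _ y' p" "dderiv _ (dderiv _ y') p"])
  have lin: "C (\<alpha>, v, \<beta>) b = C (\<alpha>, v, 0) b + \<beta> * C (0, 0, 1) b" for \<alpha> v \<beta> b
    unfolding C_def dderiv_eqI[OF D] dderiv_eqI[OF D']
    by (simp add: mip_simps linear_0[OF Y.linear_d2(2)[OF p]] linear_0[OF Y'.linear_d2(2)[OF p]] algebra_simps)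
  have "C (0, 0, 1) (0, 0, 1) = 0" using skew[of "(0, 0, 1)" "(0, 0, 1)"] by linarith
  then have "C b (0, 0, 1) = 0" for b
    using lin[of "fst b" "fst (snd b)" "snd (snd b)" "(0, 0, 1)"] first[of "fst b" "fst (snd b)" "(0, 0, 1)"] by simp
  then have "C (0, 0, 1) b = 0" for b using skew[of "(0, 0, 1)" b] by (simp only: minus_zero)
  then have "C a b = 0" using lin[of "fst a" "fst (snd a)" "snd (snd a)" b] first by simp
  then show ?thesis by (simp add: C_def)
qed

text \<open>The transition between the frames of \<open>y\<close> and of \<open>y'\<close> is an isometry, constant near
  \<open>p0\<close>; the first vectors of the frames are \<open>y\<close> and \<open>y'\<close>.\<close>

lemma locally_congruent:
  assumes p0: "p0 \<in> U"
  shows "\<exists>\<Lambda> B. linear \<Lambda> \<and> (\<forall>X Y. mip (\<Lambda> X) (\<Lambda> Y) = mip X Y) \<and> open B \<and> p0 \<in> B \<and> B \<subseteq> U \<and>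
    (\<forall>p\<in>B. y' p = \<Lambda> (y p))"
proof -
  define e :: "real ^ 'm" where "e = axis undefined 1"
  have e: "e \<noteq> 0" by (simp add: e_def axis_eq_0_iff)
  obtain r where r: "r > 0" "ball p0 r \<subseteq> U" using Y.U p0 by (metis open_contains_ball)
  define \<Lambda> where "\<Lambda> p X = Y'.frame e p (inv (Y.frame e p) X)" for p X
  have inv: "Y.frame e p (inv (Y.frame e p) X) = X" "inv (Y.frame e p) (Y.frame e p a) = a" if "p \<in> U" for p X a
    using Y.bij_frame[OF that e] by (simp_all add: bij_is_surj surj_f_inv_f bij_is_inj inv_f_f)
  have der: "((\<lambda>p. \<Lambda> p X) has_derivative (\<lambda>_. 0)) (at p)" if p: "p \<in> U" for p X
    unfolding \<Lambda>_def
    by (rule frame_transition_derivative[OF bilinear_mip mip_nondegenerate Y.U p Y.linear_frame Y'.linear_frame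
          Y.bij_frame[OF _ e] Y'.bij_frame[OF p e] differentiableI[OF frame_has_derivative[OF Y.null_immersion_axioms p]]
          differentiableI[OF frame_has_derivative[OF Y'.null_immersion_axioms p]] frame_gram_eq[OF p] frame_connection_eq[OF p]])
  have const: "\<Lambda> p X = \<Lambda> p0 X" if p: "p \<in> ball p0 r" for p X
  proof -
    have "\<exists>k. \<forall>p\<in>ball p0 r. \<Lambda> p X = k"
    proof (rule has_derivative_zero_constant)
      fix p assume "p \<in> ball p0 r"
      with r(2) have p: "p \<in> U" by blast
      show "((\<lambda>p. \<Lambda> p X) has_derivative (\<lambda>h. 0)) (at p within ball p0 r)"
        by (rule has_derivative_at_withinI[OF der[OF p]])
    qed simp
    then obtain k where k: "\<forall>p\<in>ball p0 r. \<Lambda> p X = k" by blast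
    have "p0 \<in> ball p0 r" using r(1) by simp
    with k p show ?thesis by metis
  qed
  have "linear (\<Lambda> p0)"
  proof (rule linearI)
    note l = Y.linear_frame[OF p0, of e] and l' = Y'.linear_frame[OF p0, of e]
    have i: "inv (Y.frame e p0) (X + X') = inv (Y.frame e p0) X + inv (Y.frame e p0) X'" for X X'
      using inv[OF p0] by (metis linear_add[OF l])
    show "\<Lambda> p0 (X + X') = \<Lambda> p0 X + \<Lambda> p0 X'" for X X' unfolding \<Lambda>_def i by (rule linear_add[OF l'])
    have i: "inv (Y.frame e p0) (k *\<^sub>R X) = k *\<^sub>R inv (Y.frame e p0) X" for X k
      using inv[OF p0] by (metis linear_cmul[OF l])
    show "\<Lambda> p0 (k *\<^sub>R X) = k *\<^sub>R \<Lambda> p0 X" for X k unfolding \<Lambda>_def i by (rule linear_cmul[OF l'])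
  qed
  moreover have "mip (\<Lambda> p0 X) (\<Lambda> p0 Z) = mip X Z" for X Z
    unfolding \<Lambda>_def frame_gram_eq[OF p0] inv[OF p0] ..
  moreover have "y' p = \<Lambda> p0 (y p)" if p: "p \<in> ball p0 r" for p
  proof -
    have pU: "p \<in> U" using p r(2) by blast
    have y: "Y.frame e p (1, 0, 0) = y p" "Y'.frame e p (1, 0, 0) = y' p"
      by (simp_all add: Y.frame_def Y'.frame_def linear_0[OF Y.linear_d[OF pU]] linear_0[OF Y'.linear_d[OF pU]])
    have "\<Lambda> p (y p) = y' p" unfolding \<Lambda>_def y(1)[symmetric] inv[OF pU] by (rule y(2))
    then show ?thesis using const[OF p] by simp
  qed
  ultimately show ?thesis using r by (intro exI[of _ "\<Lambda> p0"] exI[of _ "ball p0 r"]) simp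
qed

end

section \<open>Laguerre transformations from affine Lorentz isometries\<close>

text \<open>A point \<open>w\<close> of Minkowski space is represented by the null vector
  \<open>o + w + \<langle>w, w\<rangle> wp / 2\<close>, where \<open>o = (1/2, 1/2, 0, 0)\<close>. On these vectors the map is
  \<open>w \<mapsto> \<Lambda> w + t\<close>; \<open>s\<close> and \<open>(fst X - fst (snd X)) / 2\<close> are the coefficients of \<open>X\<close>
  at \<open>o\<close> and \<open>wp\<close>, and \<open>k\<close> is the coefficient of the image at \<open>wp\<close>.\<close>

definition affine_to_laguerre ::
  "((real ^ 'n) \<times> real \<Rightarrow> (real ^ 'n) \<times> real) \<Rightarrow> (real ^ 'n) \<times> real \<Rightarrow> 'n::finite ambient \<Rightarrow> 'n ambient" where
  "affine_to_laguerre \<Lambda> t X =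
    (let s = fst X + fst (snd X); V = \<Lambda> (snd (snd X));
         k = (fst X - fst (snd X)) / 2 + s * mip t t / 2 + mip V t
     in (s / 2 + k, s / 2 - k, s *\<^sub>R t + V))"

lemma affine_to_laguerre_in_group:
  fixes \<Lambda> :: "(real ^ 'n::finite) \<times> real \<Rightarrow> (real ^ 'n) \<times> real"
  assumes lin: "linear \<Lambda>" and iso: "\<And>X Y. mip (\<Lambda> X) (\<Lambda> Y) = mip X Y"
  shows "affine_to_laguerre \<Lambda> t \<in> laguerre_group"
proof -
  have "linear (affine_to_laguerre \<Lambda> t)"
    by (rule linearI) (simp_all add: affine_to_laguerre_def Let_def linear_add[OF lin] linear_cmul[OF lin] mip_simps field_simps)
  moreover have "lip (affine_to_laguerre \<Lambda> t X) (affine_to_laguerre \<Lambda> t Y) = lip X Y" for X Y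
  proof -
    have lip: "lip P Q = - fst P * fst Q + fst (snd P) * fst (snd Q) + mip (snd (snd P)) (snd (snd Q))" for P Q :: "'n ambient"
      by (simp add: lip_def mip_def split_beta)
    show ?thesis
      unfolding lip affine_to_laguerre_def Let_def
      by (simp add: mip_simps iso mip_sym[of t "\<Lambda> _"] field_simps)
  qed
  moreover have "affine_to_laguerre \<Lambda> t wp = wp"
    by (simp add: affine_to_laguerre_def wp_def zero_prod_def[symmetric] linear_0[OF lin] mip_simps)
  ultimately show ?thesis by (simp only: laguerre_group_def mem_Collect_eq) blast
qed

text \<open>A contact element \<open>(x, \<xi>)\<close> corresponds to the null line through \<open>(x, 0)\<close> in the direction
  \<open>(\<xi>, 1)\<close>, and the Laguerre transformation acts on these lines by the affine isometry.\<close>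

lemma affine_to_laguerre_contact:
  fixes \<Lambda> :: "(real ^ 'n::finite) \<times> real \<Rightarrow> (real ^ 'n) \<times> real"
  assumes lin: "linear \<Lambda>" and iso: "\<And>X Y. mip (\<Lambda> X) (\<Lambda> Y) = mip X Y"
    and \<xi>: "norm \<xi> = 1" "norm \<xi>' = 1"
    and dir: "\<Lambda> (\<xi>, 1) = b *\<^sub>R (\<xi>', 1)"
    and pos: "\<Lambda> (x, 0) + t = (x', 0) + \<sigma> *\<^sub>R (\<xi>', 1)"
  shows "affine_to_laguerre \<Lambda> t (gamma1 (x, \<xi>)) = gamma1 (x', \<xi>') + \<sigma> *\<^sub>R gamma2 (x', \<xi>')"
    and "affine_to_laguerre \<Lambda> t (gamma2 (x, \<xi>)) = b *\<^sub>R gamma2 (x', \<xi>')"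
proof -
  define Z where "Z = (x', 0 :: real) + \<sigma> *\<^sub>R (\<xi>', 1)"
  have \<Lambda>x: "\<Lambda> (x, 0) = Z - t" using pos by (simp add: Z_def algebra_simps)
  have \<xi>\<xi>: "\<xi>' \<bullet> \<xi>' = 1" using \<xi> by (simp add: norm_eq_1)
  have xx: "x \<bullet> x = mip (Z - t) (Z - t)"
    unfolding \<Lambda>x[symmetric] iso by (simp add: mip_def)
  have ZZ: "mip Z Z = x' \<bullet> x' + 2 * \<sigma> * (x' \<bullet> \<xi>')"
    by (simp add: Z_def mip_def inner_add_left inner_add_right \<xi>\<xi> inner_commute[of \<xi>' x'] algebra_simps)
  have "(x \<bullet> x) / 2 + mip t t / 2 + mip (Z - t) t = mip Z Z / 2"
    unfolding xx by (simp add: mip_simps mip_sym[of t Z] field_simps)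
  then have k: "(x \<bullet> x) / 2 + mip t t / 2 + mip (Z - t) t = (x' \<bullet> x') / 2 + \<sigma> * (x' \<bullet> \<xi>')"
    unfolding ZZ by (simp add: field_simps)
  have "affine_to_laguerre \<Lambda> t (gamma1 (x, \<xi>)) =
      (1 / 2 + ((x \<bullet> x) / 2 + mip t t / 2 + mip (Z - t) t), 1 / 2 - ((x \<bullet> x) / 2 + mip t t / 2 + mip (Z - t) t), Z)"
    by (simp add: affine_to_laguerre_def Let_def gamma1_def power2_norm_eq_inner \<Lambda>x field_simps)
  also have "\<dots> = gamma1 (x', \<xi>') + \<sigma> *\<^sub>R gamma2 (x', \<xi>')"
    unfolding k by (simp add: gamma1_def gamma2_def Z_def power2_norm_eq_inner field_simps)
  finally show "affine_to_laguerre \<Lambda> t (gamma1 (x, \<xi>)) = gamma1 (x', \<xi>') + \<sigma> *\<^sub>R gamma2 (x', \<xi>')" .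
  have "x \<bullet> \<xi> = mip (\<Lambda> (x, 0)) (\<Lambda> (\<xi>, 1))" unfolding iso by (simp add: mip_def)
  also have "\<dots> = b * mip Z (\<xi>', 1) - b * mip (\<xi>', 1) t"
    unfolding \<Lambda>x dir by (simp only: mip_simps mip_sym[of t "(\<xi>', 1)"] right_diff_distrib)
  also have "mip Z (\<xi>', 1) = x' \<bullet> \<xi>'"
    by (simp add: Z_def mip_def inner_add_left \<xi>\<xi>)
  finally have k2: "x \<bullet> \<xi> + b * mip (\<xi>', 1) t = b * (x' \<bullet> \<xi>')" by simp
  have "affine_to_laguerre \<Lambda> t (gamma2 (x, \<xi>)) =
      (x \<bullet> \<xi> + b * mip (\<xi>', 1) t, - (x \<bullet> \<xi> + b * mip (\<xi>', 1) t), b *\<^sub>R (\<xi>', 1))"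
    by (simp only: affine_to_laguerre_def Let_def gamma2_def split_conv fst_conv snd_conv dir mip_simps) simp
  then show "affine_to_laguerre \<Lambda> t (gamma2 (x, \<xi>)) = b *\<^sub>R gamma2 (x', \<xi>')"
    unfolding k2 by (simp add: gamma2_def)
qed


section \<open>Hypersurfaces with the same invariants\<close>

locale same_invariants =
  H: laguerre_hypersurface A x \<xi> + H': laguerre_hypersurface A x' \<xi>'
  for A :: "('p::{t2_space, second_countable_topology}, 'm::finite) chart set"
    and x \<xi> x' \<xi>' :: "'p \<Rightarrow> real ^ 'n::finite" +
  assumes dimension: "CARD('n) > 3"
    and connected: "connected (UNIV :: 'p set)"
    and metric_eq: "c \<in> A \<Longrightarrow> p \<in> fst c \<Longrightarrow> laguerre_metric A x \<xi> c p v w = laguerre_metric A x' \<xi>' c p v w"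
    and second_form_eq: "c \<in> A \<Longrightarrow> p \<in> fst c \<Longrightarrow>
      laguerre_second_form A x \<xi> c p v w = laguerre_second_form A x' \<xi>' c p v w"
begin

text \<open>By equality of the metrics, \<open>\<xi>\<close> and \<open>\<xi>'\<close> induce metrics whose ratio is the square of \<open>factor\<close>. Rescaling
  \<open>(\<xi>, 1)\<close> along the light cone turns this conformality into an isometry.\<close>

definition factor :: "'p \<Rightarrow> real" where "factor p = H.rho p / H'.rho p"
definition y :: "'p \<Rightarrow> (real ^ 'n) \<times> real" where "y p = factor p *\<^sub>R (\<xi> p, 1)"
definition y' :: "'p \<Rightarrow> (real ^ 'n) \<times> real" where "y' p = (\<xi>' p, 1)"

lemma factor_pos: "factor p > 0"
  by (simp add: factor_def H.rho_pos H'.rho_pos)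

lemma third_form_eq:
  assumes "c \<in> A" "p \<in> fst c"
  shows "chart_deriv c \<xi>' p v \<bullet> chart_deriv c \<xi>' p w = (factor p)\<^sup>2 * (chart_deriv c \<xi> p v \<bullet> chart_deriv c \<xi> p w)"
  using metric_eq[OF assms, of v w] H'.rho_pos[of p]
  by (simp add: H.laguerre_metric_eq[OF assms] H'.laguerre_metric_eq[OF assms] factor_def power_divide field_simps)

lemma smooth_rep:
  assumes c: "c \<in> A"
  shows "smooth_on (snd c ` fst c) (x \<circ> chart_inv c)" "smooth_on (snd c ` fst c) (x' \<circ> chart_inv c)"
    "smooth_on (snd c ` fst c) (\<xi> \<circ> chart_inv c)" "smooth_on (snd c ` fst c) (\<xi>' \<circ> chart_inv c)"
  using H.smooth_x H'.smooth_x H.smooth_\<xi> H'.smooth_\<xi> smooth_map_chart[OF _ c] by blast+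

lemma open_image: "c \<in> A \<Longrightarrow> open (snd c ` fst c)"
  by (rule open_chart_image[OF H.atlas])

lemma smooth_factor:
  assumes c: "c \<in> A"
  shows "smooth_on (snd c ` fst c) (factor \<circ> chart_inv c)" "smooth_on (snd c ` fst c) (\<lambda>q. inverse (factor (chart_inv c q)))"
proof -
  have 1: "smooth_on (snd c ` fst c) (\<lambda>q. H.rho (chart_inv c q))" "smooth_on (snd c ` fst c) (\<lambda>q. H'.rho (chart_inv c q))"
    using H.smooth_mean_rho(2)[OF c] H'.smooth_mean_rho(2)[OF c] by (simp_all add: o_def)
  have nz: "H.rho p \<noteq> 0" "H'.rho p \<noteq> 0" for p using H.rho_pos[of p] H'.rho_pos[of p] by simp_all
  have "smooth_on (snd c ` fst c) (\<lambda>q. H.rho (chart_inv c q) * inverse (H'.rho (chart_inv c q)))"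
    "smooth_on (snd c ` fst c) (\<lambda>q. H'.rho (chart_inv c q) * inverse (H.rho (chart_inv c q)))"
    by (intro smooth_on_mult smooth_on_inverse 1 open_image c nz)+
  then show "smooth_on (snd c ` fst c) (factor \<circ> chart_inv c)" "smooth_on (snd c ` fst c) (\<lambda>q. inverse (factor (chart_inv c q)))"
    by (simp_all add: factor_def o_def divide_inverse mult.commute)
qed

lemma y_has_derivative:
  assumes c: "c \<in> A" "p \<in> fst c"
  shows "((y \<circ> chart_inv c) has_derivative
      (\<lambda>v. factor p *\<^sub>R (chart_deriv c \<xi> p v, 0) + chart_deriv c factor p v *\<^sub>R (\<xi> p, 1))) (at (snd c p))"
    and "((y' \<circ> chart_inv c) has_derivative (\<lambda>v. (chart_deriv c \<xi>' p v, 0))) (at (snd c p))"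
proof -
  have q: "snd c p \<in> snd c ` fst c" using c by blast
  have inv: "chart_inv c (snd c p) = p" by (rule chart_inv_chart[OF H.atlas c])
  have D: "((\<lambda>q. factor (chart_inv c q)) has_derivative (\<lambda>v. chart_deriv c factor p v)) (at (snd c p))"
    "((\<lambda>q. \<xi> (chart_inv c q)) has_derivative (\<lambda>v. chart_deriv c \<xi> p v)) (at (snd c p))"
    "((\<lambda>q. \<xi>' (chart_inv c q)) has_derivative (\<lambda>v. chart_deriv c \<xi>' p v)) (at (snd c p))"
    using smooth_on_has_derivative[OF smooth_factor(1)[OF c(1)] q] smooth_on_has_derivative[OF smooth_rep(3)[OF c(1)] q]
      smooth_on_has_derivative[OF smooth_rep(4)[OF c(1)] q]
    by (simp_all add: chart_deriv_def o_def)
  show "((y \<circ> chart_inv c) has_derivative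
      (\<lambda>v. factor p *\<^sub>R (chart_deriv c \<xi> p v, 0) + chart_deriv c factor p v *\<^sub>R (\<xi> p, 1))) (at (snd c p))"
    using has_derivative_scaleR[OF D(1) has_derivative_Pair[OF D(2) has_derivative_const[of 1]]]
    by (simp only: y_def o_def inv)
  show "((y' \<circ> chart_inv c) has_derivative (\<lambda>v. (chart_deriv c \<xi>' p v, 0))) (at (snd c p))"
    using has_derivative_Pair[OF D(3) has_derivative_const[of 1]] by (simp only: y'_def o_def)
qed

lemma mip_derivatives:
  assumes c: "c \<in> A" "p \<in> fst c"
  shows "mip (dderiv v (y \<circ> chart_inv c) (snd c p)) (dderiv w (y \<circ> chart_inv c) (snd c p)) =
      chart_deriv c \<xi>' p v \<bullet> chart_deriv c \<xi>' p w"
    and "mip (dderiv v (y' \<circ> chart_inv c) (snd c p)) (dderiv w (y' \<circ> chart_inv c) (snd c p)) =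
      chart_deriv c \<xi>' p v \<bullet> chart_deriv c \<xi>' p w"
proof -
  have "\<xi> p \<bullet> \<xi> p = 1" using H.norm_\<xi>[of p] by (simp add: norm_eq_1)
  moreover have "chart_deriv c \<xi> p v \<bullet> \<xi> p = 0" for v
    by (subst inner_commute) (rule H.\<xi>_d\<xi>[OF c])
  ultimately show "mip (dderiv v (y \<circ> chart_inv c) (snd c p)) (dderiv w (y \<circ> chart_inv c) (snd c p)) =
      chart_deriv c \<xi>' p v \<bullet> chart_deriv c \<xi>' p w"
    unfolding dderiv_eqI[OF y_has_derivative(1)[OF c]] third_form_eq[OF c] using H.\<xi>_d\<xi>[OF c]
    by (simp add: mip_def inner_add_left inner_add_right power2_eq_square)
  show "mip (dderiv v (y' \<circ> chart_inv c) (snd c p)) (dderiv w (y' \<circ> chart_inv c) (snd c p)) =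
      chart_deriv c \<xi>' p v \<bullet> chart_deriv c \<xi>' p w"
    unfolding dderiv_eqI[OF y_has_derivative(2)[OF c]] by (simp add: mip_def)
qed

lemma isometric_null_immersions_chart:
  assumes c: "c \<in> A"
  shows "isometric_null_immersions (snd c ` fst c) (y \<circ> chart_inv c) (y' \<circ> chart_inv c)"
proof -
  let ?U = "snd c ` fst c"
  have in_chart: "\<exists>p\<in>fst c. q = snd c p" if "q \<in> ?U" for q using that by blast
  have sy: "smooth_on ?U (y \<circ> chart_inv c)" "smooth_on ?U (y' \<circ> chart_inv c)"
    using smooth_on_scaleR[OF open_image[OF c] smooth_factor(1)[OF c] smooth_on_Pair[OF open_image[OF c] smooth_rep(3)[OF c] smooth_on_const[of _ "1::real"]]]
      smooth_on_Pair[OF open_image[OF c] smooth_rep(4)[OF c] smooth_on_const[of _ "1::real"]]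
    by (simp_all add: y_def[abs_def] y'_def[abs_def] o_def)
  have null: "mip (y p) (y p) = 0" "mip (y' p) (y' p) = 0" for p
    using H.norm_\<xi>[of p] H'.norm_\<xi>[of p] by (simp_all add: y_def y'_def mip_def norm_eq_1)
  have orth: "\<exists>E :: 'm \<Rightarrow> real ^ 'm. \<forall>i j. chart_deriv c \<xi>' p (E i) \<bullet> chart_deriv c \<xi>' p (E j) = (if i = j then 1 else 0)"
    if p: "p \<in> fst c" for p
  proof -
    obtain E where "laguerre_orthonormal A x' \<xi>' c p E"
      using H'.laguerre_orthonormal_exists[OF c p] by blast
    then have E: "laguerre_metric A x' \<xi>' c p (E i) (E j) = (if i = j then 1 else 0)" for i j
      by (simp add: laguerre_orthonormal_def)
    have "chart_deriv c \<xi>' p (H'.rho p *\<^sub>R E i) \<bullet> chart_deriv c \<xi>' p (H'.rho p *\<^sub>R E j) = (if i = j then 1 else 0)" for i j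
      using E[of i j] by (simp add: H'.laguerre_metric_eq[OF c p] linear_cmul[OF H'.linear_d\<xi>[OF c p]] power2_eq_square)
    then show ?thesis by (intro exI[of _ "\<lambda>i. H'.rho p *\<^sub>R E i"] allI)
  qed
  interpret Y: null_immersion ?U "y \<circ> chart_inv c"
  proof
    show "\<exists>E :: 'm \<Rightarrow> real ^ 'm. \<forall>i j. mip (dderiv (E i) (y \<circ> chart_inv c) q) (dderiv (E j) (y \<circ> chart_inv c) q) = (if i = j then 1 else 0)"
      if q: "q \<in> ?U" for q
    proof -
      obtain p where p: "p \<in> fst c" "q = snd c p" using in_chart[OF q] by blast
      show ?thesis unfolding p(2) mip_derivatives(1)[OF c p(1)] by (rule orth[OF p(1)])
    qed
  qed (use H.card_n open_image[OF c] sy null in simp_all)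
  interpret Y': null_immersion ?U "y' \<circ> chart_inv c"
  proof
    show "\<exists>E :: 'm \<Rightarrow> real ^ 'm. \<forall>i j. mip (dderiv (E i) (y' \<circ> chart_inv c) q) (dderiv (E j) (y' \<circ> chart_inv c) q) = (if i = j then 1 else 0)"
      if q: "q \<in> ?U" for q
    proof -
      obtain p where p: "p \<in> fst c" "q = snd c p" using in_chart[OF q] by blast
      show ?thesis unfolding p(2) mip_derivatives(2)[OF c p(1)] by (rule orth[OF p(1)])
    qed
  qed (use H.card_n open_image[OF c] sy null in simp_all)
  show ?thesis
  proof
    show "Y'.g q v w = Y.g q v w" if "q \<in> ?U" for q v w
      using in_chart[OF that] mip_derivatives[OF c] by (auto simp: Y.g_def Y'.g_def)
    show "3 \<le> CARD('m)" using dimension H.card_n by simp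
  qed
qed

lemma germ_unique:
  assumes lin: "linear \<Lambda>1" "linear \<Lambda>2" and W: "open W" "p \<in> W"
    and eq: "\<And>q. q \<in> W \<Longrightarrow> y' q = \<Lambda>1 (y q)" "\<And>q. q \<in> W \<Longrightarrow> y' q = \<Lambda>2 (y q)"
  shows "\<Lambda>1 = \<Lambda>2"
proof
  fix X
  obtain c where c: "c \<in> A" "p \<in> fst c" by (rule chart_cover[OF H.atlas])
  let ?U = "snd c ` fst c"
  interpret isometric_null_immersions ?U "y \<circ> chart_inv c" "y' \<circ> chart_inv c"
    by (rule isometric_null_immersions_chart[OF c(1)])
  let ?B = "?U \<inter> chart_inv c -` W"
  have B: "open ?B" "?B \<subseteq> ?U" "snd c p \<in> ?B"
    using continuous_open_preimage[OF continuous_chart_inv[OF H.atlas c(1)] open_image[OF c(1)] W(1)]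
      c W chart_inv_chart[OF H.atlas c] by simp_all
  have "\<Lambda>1 ((y \<circ> chart_inv c) q) - \<Lambda>2 ((y \<circ> chart_inv c) q) = 0" if "q \<in> ?B" for q
  proof -
    have "chart_inv c q \<in> W" using that by simp
    from eq(1)[OF this] eq(2)[OF this] show ?thesis by (simp only: o_apply diff_self)
  qed
  then have "\<Lambda>1 X - \<Lambda>2 X = 0"
    by (rule Y.vanishing_linear_map[OF linear_compose_sub[OF lin] B])
  then show "\<Lambda>1 X = \<Lambda>2 X" by simp
qed

lemma congruent_near:
  "\<exists>\<Lambda> W. linear \<Lambda> \<and> (\<forall>X Y. mip (\<Lambda> X) (\<Lambda> Y) = mip X Y) \<and> open W \<and> p \<in> W \<and> (\<forall>q\<in>W. y' q = \<Lambda> (y q))"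
proof -
  obtain c where c: "c \<in> A" "p \<in> fst c" by (rule chart_cover[OF H.atlas])
  have "snd c p \<in> snd c ` fst c" using c by blast
  from isometric_null_immersions.locally_congruent[OF isometric_null_immersions_chart[OF c(1)] this]
  obtain \<Lambda> B where \<Lambda>: "linear \<Lambda>" "\<forall>X Y. mip (\<Lambda> X) (\<Lambda> Y) = mip X Y" "open B" "snd c p \<in> B"
    "\<forall>q\<in>B. (y' \<circ> chart_inv c) q = \<Lambda> ((y \<circ> chart_inv c) q)" by blast
  let ?W = "fst c \<inter> snd c -` B"
  have "open ?W"
    by (rule continuous_open_preimage[OF continuous_chart[OF H.atlas c(1)] open_chart_domain[OF H.atlas c(1)] \<Lambda>(3)])
  moreover have "y' q = \<Lambda> (y q)" if "q \<in> ?W" for q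
    using \<Lambda>(5)[rule_format, of "snd c q"] that chart_inv_chart[OF H.atlas c(1), of q] by simp
  ultimately show ?thesis using \<Lambda> c by (intro exI[of _ \<Lambda>] exI[of _ ?W]) simp
qed

text \<open>The local isometries fit together because each of them is determined by the germs of \<open>y\<close> and
  \<open>y'\<close>.\<close>

lemma congruent:
  "\<exists>\<Lambda>. linear \<Lambda> \<and> (\<forall>X Y. mip (\<Lambda> X) (\<Lambda> Y) = mip X Y) \<and> (\<forall>p. y' p = \<Lambda> (y p))"
proof -
  define P where "P p \<Lambda> W \<longleftrightarrow> linear \<Lambda> \<and> (\<forall>X Y. mip (\<Lambda> X) (\<Lambda> Y) = mip X Y) \<and> open W \<and> p \<in> W \<and> (\<forall>q\<in>W. y' q = \<Lambda> (y q))"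
    for p \<Lambda> W
  have "\<forall>p. \<exists>\<Lambda>. \<exists>W. P p \<Lambda> W" unfolding P_def using congruent_near by blast
  then obtain \<Lambda> where "\<forall>p. \<exists>W. P p (\<Lambda> p) W" by (rule choice[THEN exE])
  then obtain W where W: "\<forall>p. P p (\<Lambda> p) (W p)" by (rule choice[THEN exE])
  have P: "linear (\<Lambda> p)" "\<forall>X Y. mip (\<Lambda> p X) (\<Lambda> p Y) = mip X Y" "open (W p)" "p \<in> W p" "\<forall>q\<in>W p. y' q = \<Lambda> p (y q)" for p
    using W[rule_format, of p] unfolding P_def by blast+
  have const: "\<Lambda> p = \<Lambda> q" for p q
  proof (rule locally_constant_imp_constant[OF H.atlas connected])
    fix p
    have "\<Lambda> q = \<Lambda> p" if q: "q \<in> W p" for q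
    proof (rule germ_unique[OF P(1) P(1)])
      show "open (W p \<inter> W q)" by (intro open_Int P(3))
      show "q \<in> W p \<inter> W q" using q P(4) by simp
      show "y' r = \<Lambda> q (y r)" if "r \<in> W p \<inter> W q" for r using that P(5)[of q] by blast
      show "y' r = \<Lambda> p (y r)" if "r \<in> W p \<inter> W q" for r using that P(5)[of p] by blast
    qed
    then show "\<exists>W. open W \<and> p \<in> W \<and> (\<forall>q\<in>W. \<Lambda> q = \<Lambda> p)"
      using P(3,4) by blast
  qed
  obtain p0 :: 'p where True by blast
  have "y' p = \<Lambda> p0 (y p)" for p
    using P(4,5)[of p] unfolding const[of p0 p] by (rule bspec[rotated])
  with P(1,2)[of p0] show ?thesis by blast
qed

context
  fixes \<Lambda> :: "(real ^ 'n) \<times> real \<Rightarrow> (real ^ 'n) \<times> real"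
  assumes lin: "linear \<Lambda>" and iso: "\<And>X Y. mip (\<Lambda> X) (\<Lambda> Y) = mip X Y" and \<Lambda>y: "\<And>p. y' p = \<Lambda> (y p)"
begin

text \<open>Here \<open>\<Lambda> (x, 0) - (x', 0) = (W, q)\<close>. The map \<open>S\<close> is its projection to \<open>\<real>\<^sup>n\<close> along the null
  direction \<open>(\<xi>', 1)\<close>. The functions \<open>f\<close> and \<open>\<phi>\<close> are the coefficients of \<open>d\<xi>'\<close> in
  \<open>dW\<close> and in \<open>dS\<close>.\<close>

definition W :: "'p \<Rightarrow> real ^ 'n" where "W p = fst (\<Lambda> (x p, 0)) - x' p"
definition q :: "'p \<Rightarrow> real" where "q p = snd (\<Lambda> (x p, 0))"
definition f :: "'p \<Rightarrow> real" where "f p = H'.mean p - H.mean p * inverse (factor p)"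
definition S :: "'p \<Rightarrow> real ^ 'n" where "S p = W p - q p *\<^sub>R \<xi>' p"
definition \<phi> :: "'p \<Rightarrow> real" where "\<phi> p = f p - q p"

lemma bounded_linear_\<Lambda>: "bounded_linear \<Lambda>"
  using lin by (simp add: linear_conv_bounded_linear)

lemma smooth_W_q:
  assumes c: "c \<in> A"
  shows "smooth_on (snd c ` fst c) (W \<circ> chart_inv c)" "smooth_on (snd c ` fst c) (q \<circ> chart_inv c)"
    "smooth_on (snd c ` fst c) (S \<circ> chart_inv c)" "smooth_on (snd c ` fst c) (\<phi> \<circ> chart_inv c)"
proof -
  note U = open_image[OF c]
  have "smooth_on (snd c ` fst c) (\<lambda>r. (x (chart_inv c r), 0::real))"
    using smooth_on_Pair[OF U smooth_rep(1)[OF c] smooth_on_const] by (simp add: o_def)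
  from smooth_on_linear[OF bounded_linear_\<Lambda> U this]
  have L: "smooth_on (snd c ` fst c) (\<lambda>r. \<Lambda> (x (chart_inv c r), 0))" .
  show W: "smooth_on (snd c ` fst c) (W \<circ> chart_inv c)"
    using smooth_on_diff[OF U smooth_on_linear[OF bounded_linear_fst U L] smooth_rep(2)[OF c]]
    by (simp add: W_def[abs_def] o_def)
  show q: "smooth_on (snd c ` fst c) (q \<circ> chart_inv c)"
    using smooth_on_linear[OF bounded_linear_snd U L] by (simp add: q_def[abs_def] o_def)
  show "smooth_on (snd c ` fst c) (S \<circ> chart_inv c)"
    using smooth_on_diff[OF U W smooth_on_scaleR[OF U q smooth_rep(4)[OF c]]]
    by (simp add: S_def[abs_def] o_def)
  show "smooth_on (snd c ` fst c) (\<phi> \<circ> chart_inv c)"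
    using smooth_on_diff[OF U smooth_on_diff[OF U H'.smooth_mean_rho(1)[OF c]
          smooth_on_mult[OF U H.smooth_mean_rho(1)[OF c] smooth_factor(2)[OF c]]] q]
    by (simp add: \<phi>_def[abs_def] f_def[abs_def] o_def)
qed

text \<open>A vector of \<open>\<real>\<^sup>n\<close> is determined by its products with \<open>\<xi>'\<close> and with the derivatives of
  \<open>\<xi>'\<close>. The former follow from \<open>dx \<bullet> \<xi> = 0\<close> as \<open>\<Lambda>\<close> is an isometry, the latter
  are the content of the equality of the second fundamental forms.\<close>

lemma dW:
  assumes c: "c \<in> A" "p \<in> fst c"
  shows "chart_deriv c W p u = f p *\<^sub>R chart_deriv c \<xi>' p u + chart_deriv c q p u *\<^sub>R \<xi>' p"
proof -
  have r: "snd c p \<in> snd c ` fst c" using c by blast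
  have inv: "chart_inv c (snd c p) = p" by (rule chart_inv_chart[OF H.atlas c])
  have D: "((\<lambda>q. x (chart_inv c q)) has_derivative (\<lambda>v. chart_deriv c x p v)) (at (snd c p))"
    "((\<lambda>q. x' (chart_inv c q)) has_derivative (\<lambda>v. chart_deriv c x' p v)) (at (snd c p))"
    using smooth_on_has_derivative[OF smooth_rep(1)[OF c(1)] r] smooth_on_has_derivative[OF smooth_rep(2)[OF c(1)] r]
    by (simp_all add: chart_deriv_def o_def)
  have L: "((\<lambda>q. \<Lambda> (x (chart_inv c q), 0)) has_derivative (\<lambda>v. \<Lambda> (chart_deriv c x p v, 0))) (at (snd c p))"
    by (rule bounded_linear.has_derivative[OF bounded_linear_\<Lambda> has_derivative_Pair[OF D(1) has_derivative_const]])
  have dW: "chart_deriv c W p v = fst (\<Lambda> (chart_deriv c x p v, 0)) - chart_deriv c x' p v" for v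
    unfolding chart_deriv_def[of c W]
    by (rule dderiv_eqI) (simp only: W_def o_def, intro has_derivative_diff has_derivative_fst L D)
  have dq: "chart_deriv c q p v = snd (\<Lambda> (chart_deriv c x p v, 0))" for v
    unfolding chart_deriv_def[of c q]
    by (rule dderiv_eqI) (simp only: q_def o_def, intro has_derivative_snd L)
  have dy: "\<Lambda> (factor p *\<^sub>R (chart_deriv c \<xi> p v, 0) + chart_deriv c factor p v *\<^sub>R (\<xi> p, 1)) = (chart_deriv c \<xi>' p v, 0)" for v
  proof -
    have "y' \<circ> chart_inv c = (\<lambda>q. \<Lambda> ((y \<circ> chart_inv c) q))" by (simp add: fun_eq_iff \<Lambda>y)
    then have "((y' \<circ> chart_inv c) has_derivative
        (\<lambda>v. \<Lambda> (factor p *\<^sub>R (chart_deriv c \<xi> p v, 0) + chart_deriv c factor p v *\<^sub>R (\<xi> p, 1)))) (at (snd c p))"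
      using bounded_linear.has_derivative[OF bounded_linear_\<Lambda> y_has_derivative(1)[OF c]] by simp
    from has_derivative_unique[OF this y_has_derivative(2)[OF c]] show ?thesis by (rule fun_cong)
  qed
  have x\<xi>: "chart_deriv c x p v \<bullet> \<xi> p = 0" "chart_deriv c x' p v \<bullet> \<xi>' p = 0" for v
    by (subst inner_commute, rule H.\<xi>_dx[OF c] H'.\<xi>_dx[OF c])+
  have normal: "chart_deriv c W p u \<bullet> \<xi>' p = chart_deriv c q p u"
  proof -
    have "mip (\<Lambda> (chart_deriv c x p u, 0)) (y' p) = mip (chart_deriv c x p u, 0) (y p)"
      unfolding \<Lambda>y iso ..
    also have "\<dots> = 0" by (simp add: y_def mip_def x\<xi>)
    finally have "fst (\<Lambda> (chart_deriv c x p u, 0)) \<bullet> \<xi>' p = snd (\<Lambda> (chart_deriv c x p u, 0))"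
      by (simp add: y'_def mip_def)
    then show ?thesis by (simp add: dW dq inner_diff_left x\<xi>)
  qed
  have tangential: "chart_deriv c W p u \<bullet> chart_deriv c \<xi>' p v = f p * (chart_deriv c \<xi>' p u \<bullet> chart_deriv c \<xi>' p v)" for v
  proof -
    have "mip (\<Lambda> (chart_deriv c x p u, 0)) (chart_deriv c \<xi>' p v, 0) =
        mip (chart_deriv c x p u, 0) (factor p *\<^sub>R (chart_deriv c \<xi> p v, 0) + chart_deriv c factor p v *\<^sub>R (\<xi> p, 1))"
      unfolding dy[symmetric] iso ..
    then have 1: "fst (\<Lambda> (chart_deriv c x p u, 0)) \<bullet> chart_deriv c \<xi>' p v = factor p * (chart_deriv c x p u \<bullet> chart_deriv c \<xi> p v)"
      by (simp add: mip_def inner_add_right x\<xi>)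
    define a where "a = chart_deriv c x p u \<bullet> chart_deriv c \<xi> p v"
    define a' where "a' = chart_deriv c x' p u \<bullet> chart_deriv c \<xi>' p v"
    define b where "b = chart_deriv c \<xi> p u \<bullet> chart_deriv c \<xi> p v"
    define b' where "b' = chart_deriv c \<xi>' p u \<bullet> chart_deriv c \<xi>' p v"
    have "H.rho p * (a + H.mean p * b) = H'.rho p * (a' + H'.mean p * b')"
      using second_form_eq[OF c, of u v]
      by (simp only: H.laguerre_second_form_eq[OF c] H'.laguerre_second_form_eq[OF c] a_def a'_def b_def b'_def)
    then have 2: "factor p * (a + H.mean p * b) = a' + H'.mean p * b'"
      using H'.rho_pos[of p] by (simp add: factor_def field_simps)
    have 3: "b' = (factor p)\<^sup>2 * b" unfolding b_def b'_def by (rule third_form_eq[OF c])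
    have "f p * b' = H'.mean p * b' - factor p * (H.mean p * b)"
      using factor_pos[of p] unfolding f_def 3 by (simp add: field_simps power2_eq_square)
    then have "factor p * a - a' = f p * b'" using 2 by (simp add: distrib_left)
    then show ?thesis using 1 by (simp add: dW inner_diff_left a_def a'_def b'_def)
  qed
  define r where "r = chart_deriv c W p u - f p *\<^sub>R chart_deriv c \<xi>' p u - chart_deriv c q p u *\<^sub>R \<xi>' p"
  have \<xi>\<xi>: "\<xi>' p \<bullet> \<xi>' p = 1" using H'.norm_\<xi>[of p] by (simp add: norm_eq_1)
  have d\<xi>\<xi>: "chart_deriv c \<xi>' p v \<bullet> \<xi>' p = 0" for v by (subst inner_commute) (rule H'.\<xi>_d\<xi>[OF c])
  have "r \<bullet> \<xi>' p = 0" by (simp add: r_def inner_diff_left normal \<xi>\<xi> d\<xi>\<xi>)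
  then have "r \<in> range (chart_deriv c \<xi>' p)"
    unfolding H'.range_d\<xi>[OF c] by (simp add: inner_commute)
  then obtain v where v: "r = chart_deriv c \<xi>' p v" by blast
  have "r \<bullet> r = r \<bullet> chart_deriv c \<xi>' p v" using v by simp
  also have "\<dots> = 0" by (simp add: r_def inner_diff_left tangential H'.\<xi>_d\<xi>[OF c])
  finally have "r = 0" by simp
  then show ?thesis by (simp add: r_def algebra_simps)
qed

lemma dS:
  assumes c: "c \<in> A" and r: "r \<in> snd c ` fst c"
  shows "dderiv u (S \<circ> chart_inv c) r = (\<phi> \<circ> chart_inv c) r *\<^sub>R dderiv u (\<xi>' \<circ> chart_inv c) r"
proof -
  obtain p where p: "p \<in> fst c" "r = snd c p" using r by blast
  have inv: "chart_inv c r = p" unfolding p(2) by (rule chart_inv_chart[OF H.atlas c p(1)])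
  have "((S \<circ> chart_inv c) has_derivative (\<lambda>u. dderiv u (W \<circ> chart_inv c) r -
      ((q \<circ> chart_inv c) r *\<^sub>R dderiv u (\<xi>' \<circ> chart_inv c) r + dderiv u (q \<circ> chart_inv c) r *\<^sub>R (\<xi>' \<circ> chart_inv c) r))) (at r)"
    using has_derivative_diff[OF smooth_on_has_derivative[OF smooth_W_q(1)[OF c] r]
        has_derivative_scaleR[OF smooth_on_has_derivative[OF smooth_W_q(2)[OF c] r] smooth_on_has_derivative[OF smooth_rep(4)[OF c] r]]]
    by (simp add: S_def[abs_def] o_def)
  from dderiv_eqI[OF this, of u]
  have 1: "dderiv u (S \<circ> chart_inv c) r = dderiv u (W \<circ> chart_inv c) r -
      (q p *\<^sub>R dderiv u (\<xi>' \<circ> chart_inv c) r + dderiv u (q \<circ> chart_inv c) r *\<^sub>R \<xi>' p)"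
    by (simp only: o_apply inv)
  have 2: "dderiv u (W \<circ> chart_inv c) r =
      f p *\<^sub>R dderiv u (\<xi>' \<circ> chart_inv c) r + dderiv u (q \<circ> chart_inv c) r *\<^sub>R \<xi>' p"
    using dW[OF c p(1), of u] by (simp only: chart_deriv_def p(2)[symmetric])
  have "(\<phi> \<circ> chart_inv c) r = f p - q p" by (simp add: inv \<phi>_def)
  moreover have "a *\<^sub>R N + d *\<^sub>R X - (b *\<^sub>R N + d *\<^sub>R X) = (a - b) *\<^sub>R N" for a b d and N X :: "real ^ 'n"
    by (simp add: algebra_simps)
  ultimately show ?thesis unfolding 1 2 by simp
qed

text \<open>The second derivatives of \<open>S\<close> and of \<open>\<xi>'\<close> are symmetric, so \<open>dS = \<phi> d\<xi>'\<close> implies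
  \<open>d\<phi>(v) d\<xi>'(u) = d\<phi>(u) d\<xi>'(v)\<close>. As \<open>d\<xi>'\<close> is injective and \<open>M\<close> has dimension at
  least two, \<open>d\<phi> = 0\<close>.\<close>

lemma \<phi>_constant: "\<phi> p = \<phi> p'"
proof (rule zero_chart_derivative_imp_constant[OF H.atlas connected])
  fix c r assume c: "c \<in> A" and r: "r \<in> snd c ` fst c"
  let ?\<phi> = "\<phi> \<circ> chart_inv c" and ?N = "\<xi>' \<circ> chart_inv c" and ?S = "S \<circ> chart_inv c"
  note U = open_image[OF c]
  obtain p where p: "p \<in> fst c" "r = snd c p" using r by blast
  have linN: "linear (\<lambda>v. dderiv v ?N r)" "inj (\<lambda>v. dderiv v ?N r)"
    using H'.linear_d\<xi>[OF c p(1)] H'.inj_d\<xi>[OF c p(1)] by (simp_all add: chart_deriv_def[abs_def] p(2))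
  have D2: "dderiv v (dderiv u ?S) r = ?\<phi> r *\<^sub>R dderiv v (dderiv u ?N) r + dderiv v ?\<phi> r *\<^sub>R dderiv u ?N r" for u v
  proof -
    have "dderiv v (dderiv u ?S) r = dderiv v (\<lambda>r. ?\<phi> r *\<^sub>R dderiv u ?N r) r"
      by (rule dderiv_cong[OF U dS[OF c] r])
    also have "\<dots> = ?\<phi> r *\<^sub>R dderiv v (dderiv u ?N) r + dderiv v ?\<phi> r *\<^sub>R dderiv u ?N r"
      by (rule dderiv_bilinear[OF bounded_bilinear_scaleR smooth_on_differentiable[OF smooth_W_q(4)[OF c] r]
            smooth_on_differentiable[OF smooth_on_dderiv[OF smooth_rep(4)[OF c]] r]])
    finally show ?thesis .
  qed
  have sym: "dderiv v ?\<phi> r *\<^sub>R u = dderiv u ?\<phi> r *\<^sub>R v" for u v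
  proof -
    have "dderiv v ?\<phi> r *\<^sub>R dderiv u ?N r = dderiv u ?\<phi> r *\<^sub>R dderiv v ?N r"
      using D2[of v u] D2[of u v] dderiv_commute[OF U smooth_W_q(3)[OF c] r, of u v]
        dderiv_commute[OF U smooth_rep(4)[OF c] r, of u v] by simp
    then have "dderiv (dderiv v ?\<phi> r *\<^sub>R u) ?N r = dderiv (dderiv u ?\<phi> r *\<^sub>R v) ?N r"
      by (simp only: linear_cmul[OF linN(1)])
    then show ?thesis using linN(2) by (simp only: inj_eq)
  qed
  note l\<phi> = linear_dderiv[OF smooth_on_differentiable[OF smooth_W_q(4)[OF c] r]]
  have "dderiv (axis j 1) ?\<phi> r = 0" for j
  proof -
    have "\<exists>i. i \<noteq> j"
    proof (rule ccontr)
      assume "\<nexists>i. i \<noteq> j"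
      then have "UNIV \<subseteq> {j}" by blast
      then have "CARD('m) \<le> card {j}" by (intro card_mono) simp_all
      then show False using dimension H.card_n by simp
    qed
    then obtain i where i: "i \<noteq> j" by blast
    have "(dderiv (axis j 1) ?\<phi> r *\<^sub>R axis i 1) $ i = (dderiv (axis i 1) ?\<phi> r *\<^sub>R axis j (1::real)) $ i"
      by (simp only: sym)
    then show ?thesis using i by (simp add: axis_def)
  qed
  then have "dderiv v ?\<phi> r = 0" for v
    using linear_sum[OF l\<phi>, of "\<lambda>i. v $ i *\<^sub>R axis i 1" UNIV] by (simp add: axis_expansion linear_cmul[OF l\<phi>])
  then show "((\<phi> \<circ> chart_inv c) has_derivative (\<lambda>_. 0)) (at r)"
    using smooth_on_has_derivative[OF smooth_W_q(4)[OF c] r] by simp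
qed

lemma translation_constant: "S p - \<phi> p *\<^sub>R \<xi>' p = S p' - \<phi> p' *\<^sub>R \<xi>' p'"
proof -
  obtain p0 :: 'p where True by blast
  have "S p - \<phi> p0 *\<^sub>R \<xi>' p = S p' - \<phi> p0 *\<^sub>R \<xi>' p'"
  proof (rule zero_chart_derivative_imp_constant[OF H.atlas connected])
    fix c r assume c: "c \<in> A" and r: "r \<in> snd c ` fst c"
    have "(\<phi> \<circ> chart_inv c) r = \<phi> p0" using \<phi>_constant by simp
    then have "dderiv u (S \<circ> chart_inv c) r - \<phi> p0 *\<^sub>R dderiv u (\<xi>' \<circ> chart_inv c) r = 0" for u
      unfolding dS[OF c r] by simp
    then show "(((\<lambda>p. S p - \<phi> p0 *\<^sub>R \<xi>' p) \<circ> chart_inv c) has_derivative (\<lambda>_. 0)) (at r)"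
      using has_derivative_diff[OF smooth_on_has_derivative[OF smooth_W_q(3)[OF c] r]
          has_derivative_scaleR_right[OF smooth_on_has_derivative[OF smooth_rep(4)[OF c] r], of "\<phi> p0"]]
      by (simp add: o_def)
  qed
  then show ?thesis using \<phi>_constant[of p p0] \<phi>_constant[of p' p0] by simp
qed

lemma affine_motion: "\<exists>t. \<forall>p. \<exists>\<sigma>. \<Lambda> (x p, 0) + t = (x' p, 0) + \<sigma> *\<^sub>R (\<xi>' p, 1)"
proof -
  obtain p0 :: 'p where True by blast
  let ?t = "(\<phi> p0 *\<^sub>R \<xi>' p0 - S p0, \<phi> p0)"
  have "\<Lambda> (x p, 0) + ?t = (x' p, 0) + (q p + \<phi> p) *\<^sub>R (\<xi>' p, 1)" for p
  proof -
    have "\<Lambda> (x p, 0) = (x' p + W p, q p)" by (simp add: W_def q_def)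
    moreover have "W p = S p + q p *\<^sub>R \<xi>' p" by (simp add: S_def)
    moreover have "S p = \<phi> p *\<^sub>R \<xi>' p + (S p0 - \<phi> p0 *\<^sub>R \<xi>' p0)"
      using translation_constant[of p p0] by (simp add: algebra_simps)
    ultimately show ?thesis using \<phi>_constant[of p p0] by (simp add: algebra_simps)
  qed
  then show ?thesis by blast
qed

end

text \<open>The transformation preserves orientation because \<open>gamma2\<close> is multiplied by \<open>1 / factor > 0\<close>.\<close>

lemma equivalent: "laguerre_equivalent x \<xi> x' \<xi>'"
proof -
  obtain \<Lambda> where \<Lambda>: "linear \<Lambda>" "\<And>X Y. mip (\<Lambda> X) (\<Lambda> Y) = mip X Y" "\<And>p. y' p = \<Lambda> (y p)"
    using congruent by blast
  obtain t where t: "\<And>p. \<exists>\<sigma>. \<Lambda> (x p, 0) + t = (x' p, 0) + \<sigma> *\<^sub>R (\<xi>' p, 1)"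
    using affine_motion[OF \<Lambda>] by blast
  let ?T = "affine_to_laguerre \<Lambda> t"
  have T: "?T \<in> laguerre_group" by (rule affine_to_laguerre_in_group[OF \<Lambda>(1,2)])
  have dir: "\<Lambda> (\<xi> p, 1) = inverse (factor p) *\<^sub>R (\<xi>' p, 1)" for p
  proof -
    have "(\<xi>' p, 1) = factor p *\<^sub>R \<Lambda> (\<xi> p, 1)"
      using \<Lambda>(3)[of p] by (simp only: y_def y'_def linear_cmul[OF \<Lambda>(1)])
    then show ?thesis using factor_pos[of p] by simp
  qed
  have "?T (gamma2 (x p, \<xi> p)) = inverse (factor p) *\<^sub>R gamma2 (x' p, \<xi>' p)"
    "laguerre_transformation ?T (x p, \<xi> p) = (x' p, \<xi>' p)" for p
  proof -
    obtain \<sigma> where \<sigma>: "\<Lambda> (x p, 0) + t = (x' p, 0) + \<sigma> *\<^sub>R (\<xi>' p, 1)" using t by blast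
    note T12 = affine_to_laguerre_contact[OF \<Lambda>(1,2) H.norm_\<xi> H'.norm_\<xi> dir \<sigma>]
    show "?T (gamma2 (x p, \<xi> p)) = inverse (factor p) *\<^sub>R gamma2 (x' p, \<xi>' p)" by (rule T12(2))
    have "inverse (factor p) \<noteq> 0" using factor_pos[of p] by simp
    then show "laguerre_transformation ?T (x p, \<xi> p) = (x' p, \<xi>' p)"
      by (rule laguerre_transformation_eqI[OF H'.norm_\<xi> T12])
  qed
  note image = this
  obtain p0 :: 'p where True by blast
  have "0 < snd (snd (snd (?T (gamma2 (x p0, \<xi> p0)))))"
    unfolding image(1) using factor_pos[of p0] by (simp add: gamma2_def)
  then have "orientation_preserving ?T"
    using orientation_sign(1)[OF T H.norm_\<xi>[of p0] refl, of "x p0"] by blast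
  with T image(2) show ?thesis unfolding laguerre_equivalent_def by (intro bexI[of _ ?T]) simp_all
qed

end

section \<open>Laguerre equivalence\<close>

theorem theorem6p2:
  fixes A :: "('p::{t2_space, second_countable_topology}, 'm::finite) chart set"
    and x \<xi> x' \<xi>' :: "'p \<Rightarrow> real ^ 'n::finite"
  assumes "CARD('n) > 3"
    and "smooth_atlas A"
    and "connected (UNIV :: 'p set)"
    and "oriented_hypersurface A x \<xi>"
    and "umbilical_free A x \<xi>"
    and "nonzero_principal_curvatures A x \<xi>"
    and "oriented_hypersurface A x' \<xi>'"
    and "umbilical_free A x' \<xi>'"
    and "nonzero_principal_curvatures A x' \<xi>'"
  shows "laguerre_equivalent x \<xi> x' \<xi>' \<longleftrightarrow>
    (\<forall>c\<in>A. \<forall>p\<in>fst c. \<forall>v w.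
       laguerre_metric A x \<xi> c p v w = laguerre_metric A x' \<xi>' c p v w \<and>
       laguerre_second_form A x \<xi> c p v w = laguerre_second_form A x' \<xi>' c p v w)"
    (is "_ \<longleftrightarrow> ?same")
proof
  interpret H: laguerre_hypersurface A x \<xi> using assms by unfold_locales
  interpret H': laguerre_hypersurface A x' \<xi>' using assms by unfold_locales
  show ?same if eq: "laguerre_equivalent x \<xi> x' \<xi>'"
  proof -
    obtain T where "T \<in> laguerre_group" "orientation_preserving T"
      "\<And>p. (x' p, \<xi>' p) = laguerre_transformation T (x p, \<xi> p)"
      using eq unfolding laguerre_equivalent_def by blast
    then interpret laguerre_image A x \<xi> x' \<xi>' T by unfold_locales
    show ?thesis using laguerre_invariants_eq by blast
  qed
  show "laguerre_equivalent x \<xi> x' \<xi>'" if same: ?same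
  proof -
    interpret same_invariants A x \<xi> x' \<xi>'
      using assms(1,3) same by unfold_locales blast+
    show ?thesis by (rule equivalent)
  qed
qed

end
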